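(* Let $Y=(Y_t)_{t\in\mathbb{R}}$ and $X=(X_t)_{t\in\mathbb{R}}$ be the processes of the supOUSV model defined in the context, with $\overline{Y}=\mathbb{E}[Y_t]$ and $\overline{V}=\mathbb{V}[Y_t]$. Then for any $t\in\mathbb{R}$ the following hold: $$\mathbb{E}[X_t]=0,$$ $$\mathbb{V}[X_t]=\frac{1}{2}\sigma^2\overline{Y}+\mu^2\overline{V}\left(\int_0^{+\infty}\frac{\pi(\mathrm{d}r)}{r}\right)^{-1}\int_{R=0}^{R=+\infty}\int_{P=0}^{P=+\infty}\int_{r=0}^{r=+\infty}\frac{1}{r}\,\frac{PR}{P+R}\left(\frac{1}{P+r}+\frac{1}{R+r}\right)\pi(\mathrm{d}r)\rho(\mathrm{d}R)\rho(\mathrm{d}P),$$ and $$\mathbb{E}[X_tY_t]=\mu\overline{V}\left(\int_0^{+\infty}\frac{\pi(\mathrm{d}r)}{r}\right)^{-1}\int_{R=0}^{R=+\infty}\int_{r=0}^{r=+\infty}\frac{R}{r(R+r)}\,\pi(\mathrm{d}r)\rho(\mathrm{d}R).$$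
   Context: Work on a complete (filtered) probability space; $\mathbb{E}$ and $\mathbb{V}$ denote expectation and variance. Measures and parameters. $\nu$ is the Lévy measure on $(0,+\infty)$ of a pure-jump subordinator with $\int_0^{+\infty}z^k\,\nu(\mathrm{d}z)<+\infty$ for $k=1,2,3,\dots$; $\pi$ is a probability measure on $(0,+\infty)$ with $\int_0^{+\infty}r^{-1}\pi(\mathrm{d}r)<+\infty$; $\rho$ is a probability measure on $(0,+\infty)$; $\mu\in\mathbb{R}$ and $\sigma>0$ are constants. Noises. $N$ is a Poisson random measure on $\mathbb{R}\times(0,+\infty)\times(0,+\infty)$ with compensator (intensity) $\mathrm{d}s\,\nu(\mathrm{d}z)\,\pi(\mathrm{d}r)$. $B(\mathrm{d}R,\mathrm{d}s)$ is a centered space-time Gaussian random measure (white noise) on $(0,+\infty)\times\mathbb{R}$ with control measure $\rho(\mathrm{d}R)\,\mathrm{d}s$, i.e. $\mathbb{E}[B(A)B(A')]=(\rho\otimes\mathrm{Leb})(A\cap A')$ for Borel sets $A,A'$ of finite measure. $B$ and $N$ are mutually independent. supOUSV model (in its stationary state). For $t\in\mathbb{R}$, $$Y_t=\int_{s=-\infty}^{s=t}\int_{z=0}^{z=+\infty}\int_{r=0}^{r=+\infty}z\,e^{-r(t-s)}N(\mathrm{d}s,\mathrm{d}z,\mathrm{d}r),$$ $$X_t=\int_{R=0}^{R=+\infty}\int_{s=-\infty}^{s=t}e^{-R(t-s)}\left\{R\mu\,(Y_s-\overline{Y})\,\rho(\mathrm{d}R)\,\mathrm{d}s+\sigma\sqrt{R\,Y_s}\,B(\mathrm{d}R,\mathrm{d}s)\right\},$$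 where $\overline{Y}=\mathbb{E}[Y_t]$ (independent of $t$ because $Y$ is stationary), $\overline{V}=\mathbb{V}[Y_t]$, and the integral against $B$ is in the Itô sense. *)

theory Defs
  imports "HOL-Probability.Probability"
begin

definition gen_events :: "'a measure \<Rightarrow> ('i \<Rightarrow> 'a \<Rightarrow> 'b::topological_space) \<Rightarrow> 'i set \<Rightarrow> 'a set set" where
  "gen_events M Z I =
     sigma_sets (space M) {Z i -` S \<inter> space M | i S. i \<in> I \<and> S \<in> sets borel}"

definition finite_sets :: "'b measure \<Rightarrow> 'b set set" where
  "finite_sets m = {A \<in> sets m. emeasure m A < \<infinity>}"

definition subordinator_levy_measure :: "real measure \<Rightarrow> bool" where
  "subordinator_levy_measure \<nu> \<longleftrightarrow>
     sets \<nu> = sets (restrict_space borel {0<..}) \<and> integrable \<nu> (\<lambda>z. min 1 z)"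

definition prob_on_positive_reals :: "real measure \<Rightarrow> bool" where
  "prob_on_positive_reals p \<longleftrightarrow>
     prob_space p \<and> sets p = sets (restrict_space borel {0<..})"

text \<open>A random measure is a family of measures indexed by the sample points. As usual, a Poisson
  variable with infinite mean is almost surely infinite.\<close>

definition poisson_random_measure :: "'a measure \<Rightarrow> 'b measure \<Rightarrow> ('a \<Rightarrow> 'b measure) \<Rightarrow> bool" where
  "poisson_random_measure M m N \<longleftrightarrow>
     (\<forall>\<omega>\<in>space M. sets (N \<omega>) = sets m) \<and>
     (\<forall>A\<in>sets m. (\<lambda>\<omega>. emeasure (N \<omega>) A) \<in> borel_measurable M) \<and>
     (\<forall>A\<in>sets m. emeasure m A < \<infinity> \<longrightarrow>
        (\<forall>k::nat. measure M {\<omega> \<in> space M. emeasure (N \<omega>) A = of_nat k} =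
           exp (- measure m A) * measure m A ^ k / fact k)) \<and>
     (\<forall>A\<in>sets m. emeasure m A = \<infinity> \<longrightarrow> (AE \<omega> in M. emeasure (N \<omega>) A = \<infinity>)) \<and>
     (\<forall>(n::nat) A. (\<forall>i<n. A i \<in> sets m) \<and> disjoint_family_on A {..<n} \<longrightarrow>
        prob_space.indep_vars M (\<lambda>_. borel) (\<lambda>i \<omega>. emeasure (N \<omega>) (A i)) {..<n})"

text \<open>The degenerate normal law with variance \<open>0\<close> has to be admitted separately, since
  \<^const>\<open>normal_density\<close> is a density only for positive standard deviations.\<close>

definition centered_gaussian :: "'a measure \<Rightarrow> ('a \<Rightarrow> real) \<Rightarrow> bool" where
  "centered_gaussian M Z \<longleftrightarrow>
     Z \<in> borel_measurable M \<and>
     ((AE \<omega> in M. Z \<omega> = 0) \<or> (\<exists>s>0. distributed M lborel Z (normal_density 0 s)))"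

text \<open>Gaussian random measure with control measure \<open>m\<close>: a jointly Gaussian centered family indexed by
  the sets of finite \<open>m\<close>-measure. The values of \<open>B\<close> at all other sets are irrelevant.\<close>

definition gaussian_white_noise :: "'a measure \<Rightarrow> 'b measure \<Rightarrow> ('b set \<Rightarrow> 'a \<Rightarrow> real) \<Rightarrow> bool" where
  "gaussian_white_noise M m B \<longleftrightarrow>
     (\<forall>S c. finite S \<and> S \<subseteq> finite_sets m \<longrightarrow>
        centered_gaussian M (\<lambda>\<omega>. \<Sum>A\<in>S. c A * B A \<omega>)) \<and>
     (\<forall>A\<in>finite_sets m. \<forall>A'\<in>finite_sets m.
        prob_space.expectation M (\<lambda>\<omega>. B A \<omega> * B A' \<omega>) = measure m (A \<inter> A'))"

definition jump_intensity :: "real measure \<Rightarrow> real measure \<Rightarrow> (real \<times> real \<times> real) measure" where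
  "jump_intensity \<nu> \<pi> = lborel \<Otimes>\<^sub>M (\<nu> \<Otimes>\<^sub>M \<pi>)"

definition control_measure :: "real measure \<Rightarrow> (real \<times> real) measure" where
  "control_measure \<rho> = \<rho> \<Otimes>\<^sub>M lborel"

definition complete_filtration :: "'a measure \<Rightarrow> (real \<Rightarrow> 'a measure) \<Rightarrow> bool" where
  "complete_filtration M F \<longleftrightarrow>
     filtration (space M) F \<and> (\<forall>t. sets (F t) \<subseteq> sets M \<and> null_sets M \<subseteq> sets (F t))"

text \<open>Points of \<open>N\<close> are triples \<open>(s, z, r)\<close>, points of \<open>B\<close> are pairs \<open>(R, s)\<close>, with \<open>s\<close> the time.
  Both noises are adapted, and their restrictions to \<open>{t<..}\<close> are (jointly) independent of \<open>F t\<close>.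
  The filtration generated by the two noises, augmented by the null sets, is an instance.\<close>

definition noise_filtration ::
  "'a measure \<Rightarrow> (real \<Rightarrow> 'a measure) \<Rightarrow>
   (real \<times> real \<times> real) measure \<Rightarrow> ('a \<Rightarrow> (real \<times> real \<times> real) measure) \<Rightarrow>
   (real \<times> real) measure \<Rightarrow> ((real \<times> real) set \<Rightarrow> 'a \<Rightarrow> real) \<Rightarrow> bool" where
  "noise_filtration M F mN N mB B \<longleftrightarrow>
     complete_filtration M F \<and>
     (\<forall>t. \<forall>A\<in>sets mN. A \<subseteq> {..t} \<times> UNIV \<longrightarrow>
        (\<lambda>\<omega>. emeasure (N \<omega>) A) \<in> borel_measurable (F t)) \<and>
     (\<forall>t. \<forall>A\<in>finite_sets mB. A \<subseteq> UNIV \<times> {..t} \<longrightarrow> B A \<in> borel_measurable (F t)) \<and>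
     (\<forall>t. prob_space.indep_set M (sets (F t))
        (sigma_sets (space M)
          (gen_events M (\<lambda>A \<omega>. emeasure (N \<omega>) A) {A \<in> sets mN. A \<subseteq> {t<..} \<times> UNIV} \<union>
           gen_events M B {A \<in> finite_sets mB. A \<subseteq> UNIV \<times> {t<..}})))"

text \<open>Ito integral against \<open>B\<close>: defined on finite sums of \<open>\<xi> \<cdot> 1\<^sub>A(R) \<cdot> 1\<^sub>(\<^sub>a\<^sub>,\<^sub>b\<^sub>](s)\<close> with
  \<open>\<xi>\<close> bounded and \<open>F a\<close>-measurable, and extended to their closure in \<open>L\<^sup>2\<close>.\<close>

definition simple_ito_integral ::
  "'a measure \<Rightarrow> (real \<Rightarrow> 'a measure) \<Rightarrow> real measure \<Rightarrow> ((real \<times> real) set \<Rightarrow> 'a \<Rightarrow> real) \<Rightarrow>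
   (real \<times> real \<Rightarrow> 'a \<Rightarrow> real) \<Rightarrow> ('a \<Rightarrow> real) \<Rightarrow> bool" where
  "simple_ito_integral M F \<rho> B \<phi> J \<longleftrightarrow>
     (\<exists>(n::nat) \<xi> A a b.
        (\<forall>i<n. \<xi> i \<in> borel_measurable (F (a i)) \<and> (\<exists>c. \<forall>\<omega>\<in>space M. \<bar>\<xi> i \<omega>\<bar> \<le> c) \<and>
               A i \<in> sets \<rho> \<and> a i \<le> b i) \<and>
        \<phi> = (\<lambda>(R, s) \<omega>. \<Sum>i<n. \<xi> i \<omega> * indicator (A i) R * indicator {a i<..b i} s) \<and>
        J = (\<lambda>\<omega>. \<Sum>i<n. \<xi> i \<omega> * B (A i \<times> {a i<..b i}) \<omega>))"

text \<open>The completion only means that integrands need to be measurable up to null sets.\<close>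

definition has_ito_integral ::
  "'a measure \<Rightarrow> (real \<Rightarrow> 'a measure) \<Rightarrow> real measure \<Rightarrow> ((real \<times> real) set \<Rightarrow> 'a \<Rightarrow> real) \<Rightarrow>
   (real \<times> real \<Rightarrow> 'a \<Rightarrow> real) \<Rightarrow> ('a \<Rightarrow> real) \<Rightarrow> bool" where
  "has_ito_integral M F \<rho> B \<phi> J \<longleftrightarrow>
     (let Q = completion (control_measure \<rho> \<Otimes>\<^sub>M M) in
      case_prod \<phi> \<in> borel_measurable Q \<and> J \<in> borel_measurable M \<and>
      (\<exists>\<Phi> I. (\<forall>n::nat. simple_ito_integral M F \<rho> B (\<Phi> n) (I n)) \<and>
         (\<lambda>n. \<integral>\<^sup>+(x, \<omega>). ennreal ((\<Phi> n x \<omega> - \<phi> x \<omega>)\<^sup>2) \<partial>Q) \<longlonglongrightarrow> 0 \<and>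
         (\<lambda>n. \<integral>\<^sup>+\<omega>. ennreal ((I n \<omega> - J \<omega>)\<^sup>2) \<partial>M) \<longlonglongrightarrow> 0))"

text \<open>The integral is determined up to almost sure equality only; a version is chosen.\<close>

definition ito_integral ::
  "'a measure \<Rightarrow> (real \<Rightarrow> 'a measure) \<Rightarrow> real measure \<Rightarrow> ((real \<times> real) set \<Rightarrow> 'a \<Rightarrow> real) \<Rightarrow>
   (real \<times> real \<Rightarrow> 'a \<Rightarrow> real) \<Rightarrow> 'a \<Rightarrow> real" where
  "ito_integral M F \<rho> B \<phi> = (SOME J. has_ito_integral M F \<rho> B \<phi> J)"

definition supOU :: "('a \<Rightarrow> (real \<times> real \<times> real) measure) \<Rightarrow> real \<Rightarrow> 'a \<Rightarrow> real" where
  "supOU N t \<omega> = (LINT (s, z, r)|N \<omega>. indicator {..t} s * (z * exp (- r * (t - s))))"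

definition supOUSV ::
  "'a measure \<Rightarrow> (real \<Rightarrow> 'a measure) \<Rightarrow> real measure \<Rightarrow> ((real \<times> real) set \<Rightarrow> 'a \<Rightarrow> real) \<Rightarrow>
   real \<Rightarrow> real \<Rightarrow> real \<Rightarrow> (real \<Rightarrow> 'a \<Rightarrow> real) \<Rightarrow> real \<Rightarrow> 'a \<Rightarrow> real" where
  "supOUSV M F \<rho> B \<mu> \<sigma> Ybar Y t \<omega> =
     (LINT (R, s)|control_measure \<rho>.
        indicator {..t} s * (exp (- R * (t - s)) * (R * \<mu> * (Y s \<omega> - Ybar)))) +
     ito_integral M F \<rho> B
       (\<lambda>(R, s) \<omega>. indicator {..t} s * (exp (- R * (t - s)) * (\<sigma> * sqrt (R * Y s \<omega>)))) \<omega>"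

end

theory Submission
  imports Defs "HOL-Real_Asymp.Real_Asymp"
begin

text \<open>
  Write \<open>m\<^sub>k = \<integral>z\<^sup>k \<nu>(dz)\<close> and \<open>I = \<integral>r\<^sup>-\<^sup>1 \<pi>(dr)\<close>. The variable \<open>Y\<^sub>t\<close> is the integral of the kernel
  \<open>z exp (- r (t - s)) 1(s \<le> t)\<close> against the Poisson measure \<open>N\<close>, so Campbell's formulas for the first two
  moments of such integrals (\<open>campbell_mean\<close>, \<open>campbell_second\<close>) give \<open>E Y\<^sub>t = m\<^sub>1 I\<close> and
  \<open>Cov (Y\<^sub>s, Y\<^sub>u) = m\<^sub>2 \<integral> exp (- r \<bar>s - u\<bar>) / (2 r) \<pi>(dr)\<close>. In particular the variance of \<open>Y\<close> is
  \<open>m\<^sub>2 I / 2\<close>, and the prefactor (variance of \<open>Y\<close>) \<open>/ I\<close> in the statement is just \<open>m\<^sub>2 / 2\<close>.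

  Now split \<open>X\<^sub>t\<close> into its drift part and its Ito integral.
  The weight \<open>R exp (- R (t - s)) \<rho>(dR) ds\<close> on \<open>s \<le> t\<close> has total mass one, so the drift part is
  \<open>\<mu> (G - E Y)\<close>, where \<open>G\<close> is the average of \<open>s \<mapsto> Y\<^sub>s\<close> under this weight. By Tonelli's theorem the
  moments of \<open>G\<close> are averages of the moments of \<open>Y\<close>: \<open>E G = E Y\<close>, and \<open>Var G\<close> and \<open>Cov (G, Y\<^sub>t)\<close> are the
  double and the single average of \<open>Cov (Y\<^sub>s, Y\<^sub>u)\<close> (\<open>drift_moments\<close>). The integrals over time are integrals of
  exponentials (\<open>nn_integral_exp_pair\<close>), and what is left are the rational functions of \<open>R\<close>, \<open>P\<close>
  and \<open>r\<close> in the statement.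

  The Ito integral \<open>J\<close> has second moment \<open>\<sigma>\<^sup>2 E Y \<integral>\<integral> R exp (- 2 R (t - s)) ds \<rho>(dR) = \<sigma>\<^sup>2 E Y / 2\<close> by the Ito
  isometry, and it is orthogonal to every square-integrable variable that is a function of \<open>N\<close>, because \<open>B\<close> is
  centered and independent of \<open>N\<close> (\<open>vol_integral_moments\<close>). Orthogonality to \<open>1\<close>, to \<open>G\<close> and to \<open>Y\<^sub>t\<close> removes
  all mixed terms from \<open>E X\<^sub>t\<close>, \<open>E X\<^sub>t\<^sup>2\<close> and \<open>E (X\<^sub>t Y\<^sub>t)\<close>, and the three formulas follow.

  The work lies in showing that \<open>J\<close> exists, since an integral that is picked by a choice operator has
  no properties otherwise. For this the integrand is approximated by explicit step functions
  on a grid whose random coefficients are truncations of \<open>sqrt Y\<^sub>a\<close> at the left endpoint \<open>a\<close> of each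
  time cell. They are adapted, and they converge in \<open>L\<^sup>2\<close> because \<open>E (Y\<^sub>s - Y\<^sub>a)\<^sup>2 \<le> m\<^sub>2 \<bar>s - a\<bar>\<close>. The coefficients are
  functions of \<open>N\<close>, so the approximating integrals already have the orthogonality property. By the isometry any
  approximating sequence leads to the same limit, hence everything carries over to \<open>J\<close>
  (\<open>ito_integral_of_approximation\<close>).
\<close>

section \<open>Moments of integrals against a Poisson random measure\<close>

lemma poisson_factorial_moments:
  fixes l :: real
  assumes "0 \<le> l"
  shows "(\<lambda>k. exp (-l) * l ^ k / fact k) sums 1"
    and "(\<lambda>k. real k * (exp (-l) * l ^ k / fact k)) sums l"
    and "(\<lambda>k. (real k)\<^sup>2 * (exp (-l) * l ^ k / fact k)) sums (l\<^sup>2 + l)"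
proof -
  have e: "(\<lambda>k. l ^ k / fact k) sums exp l"
    using exp_converges[of l] by (simp add: divide_inverse mult.commute)
  from sums_mult[OF e, of "exp (-l)"]
  show 0: "(\<lambda>k. exp (-l) * l ^ k / fact k) sums 1"
    by (simp add: exp_minus)
  have "(\<lambda>k. real (Suc k) * (exp (-l) * l ^ Suc k / fact (Suc k))) = (\<lambda>k. l * (exp (-l) * l ^ k / fact k))"
    by (rule ext) (simp add: field_simps del: of_nat_Suc)
  with sums_mult[OF 0, of l]
  have "(\<lambda>k. real (Suc k) * (exp (-l) * l ^ Suc k / fact (Suc k))) sums l" by simp
  then show 1: "(\<lambda>k. real k * (exp (-l) * l ^ k / fact k)) sums l"
    by (subst (asm) sums_Suc_iff) simp
  have "(\<lambda>k. (real (Suc k))\<^sup>2 * (exp (-l) * l ^ Suc k / fact (Suc k))) =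
        (\<lambda>k. l * (real k * (exp (-l) * l ^ k / fact k)) + l * (exp (-l) * l ^ k / fact k))"
  proof
    fix k :: nat
    have "(real (Suc k))\<^sup>2 * (exp (-l) * l ^ Suc k / fact (Suc k))
        = real (Suc k) * (l * (exp (-l) * l ^ k / fact k))"
      by (simp add: field_simps power2_eq_square del: of_nat_Suc)
    then show "(real (Suc k))\<^sup>2 * (exp (-l) * l ^ Suc k / fact (Suc k)) =
        l * (real k * (exp (-l) * l ^ k / fact k)) + l * (exp (-l) * l ^ k / fact k)"
      by (simp only: of_nat_Suc distrib_left distrib_right mult_1 mult.left_commute[of "real k"] add.commute)
  qed
  with sums_add[OF sums_mult[OF 1, of l] sums_mult[OF 0, of l]]
  have "(\<lambda>k. (real (Suc k))\<^sup>2 * (exp (-l) * l ^ Suc k / fact (Suc k))) sums (l\<^sup>2 + l)"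
    by (simp add: power2_eq_square)
  then show "(\<lambda>k. (real k)\<^sup>2 * (exp (-l) * l ^ k / fact k)) sums (l\<^sup>2 + l)"
    by (subst (asm) sums_Suc_iff) simp
qed

locale poisson_measure = prob_space M + intensity: sigma_finite_measure m
  for M :: "'a measure" and m :: "'b measure" +
  fixes N :: "'a \<Rightarrow> 'b measure"
  assumes prm: "poisson_random_measure M m N"
begin

lemma sets_N [simp]: "\<omega> \<in> space M \<Longrightarrow> sets (N \<omega>) = sets m"
  using prm unfolding poisson_random_measure_def by blast

lemma count_measurable [measurable]:
  "A \<in> sets m \<Longrightarrow> (\<lambda>\<omega>. emeasure (N \<omega>) A) \<in> borel_measurable M"
  using prm unfolding poisson_random_measure_def by blast

lemma measurable_N: "\<omega> \<in> space M \<Longrightarrow> f \<in> borel_measurable m \<Longrightarrow> f \<in> borel_measurable (N \<omega>)"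
  using measurable_cong_sets[OF sets_N refl] by blast

text \<open>The definition prescribes the probabilities of the finite counts. They add up to one, so the
  count is almost surely a natural number and its law is the Poisson law.\<close>

lemma count_law:
  assumes A: "A \<in> sets m" "emeasure m A < \<infinity>"
  shows "(\<integral>\<^sup>+\<omega>. g (emeasure (N \<omega>) A) \<partial>M) =
    (\<Sum>k. g (of_nat k) * ennreal (exp (- measure m A) * measure m A ^ k / fact k))"
proof -
  define E where "E k = {\<omega> \<in> space M. emeasure (N \<omega>) A = of_nat k}" for k :: nat
  have [measurable]: "E k \<in> events" for k
    using A(1) unfolding E_def by measurable
  have pE: "prob (E k) = exp (- measure m A) * measure m A ^ k / fact k" for k
    using prm A unfolding poisson_random_measure_def E_def by blast
  have "disjoint_family E"
    unfolding disjoint_family_on_def E_def by (auto dest: of_nat_eq_iff[THEN iffD1, OF trans, OF sym])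
  then have "(\<lambda>k. prob (E k)) sums prob (\<Union>k. E k)"
    by (intro finite_measure_UNION) auto
  with poisson_factorial_moments(1)[of "measure m A"]
  have "prob (\<Union>k. E k) = 1"
    by (simp add: pE sums_iff)
  then have "AE \<omega> in M. \<omega> \<in> (\<Union>k. E k)"
    by (subst (asm) prob_eq_1) auto
  then have "AE \<omega> in M. g (emeasure (N \<omega>) A) = (\<Sum>k. g (of_nat k) * indicator (E k) \<omega>)"
  proof eventually_elim
    case (elim \<omega>)
    then obtain j where j: "\<omega> \<in> E j" by auto
    have "(\<Sum>k. g (of_nat k) * indicator (E k) \<omega>) = (\<Sum>k\<in>{j}. g (of_nat k) * indicator (E k) \<omega>)"
      using j by (intro suminf_finite) (auto simp: E_def indicator_def)
    with j show ?case by (simp add: E_def)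
  qed
  then have "(\<integral>\<^sup>+\<omega>. g (emeasure (N \<omega>) A) \<partial>M) = (\<integral>\<^sup>+\<omega>. (\<Sum>k. g (of_nat k) * indicator (E k) \<omega>) \<partial>M)"
    by (rule nn_integral_cong_AE)
  also have "\<dots> = (\<Sum>k. g (of_nat k) * emeasure M (E k))"
    by (subst nn_integral_suminf) (auto simp: nn_integral_cmult_indicator)
  finally show ?thesis by (simp add: emeasure_eq_measure pE)
qed

lemma count_moments:
  assumes A: "A \<in> sets m" "emeasure m A < \<infinity>"
  shows "(\<integral>\<^sup>+\<omega>. emeasure (N \<omega>) A \<partial>M) = emeasure m A"
    and "(\<integral>\<^sup>+\<omega>. (emeasure (N \<omega>) A)\<^sup>2 \<partial>M) = (emeasure m A)\<^sup>2 + emeasure m A"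
proof -
  have mA: "emeasure m A = ennreal (measure m A)"
    using A by (simp add: emeasure_eq_ennreal_measure less_top)
  note mom = poisson_factorial_moments[OF measure_nonneg[of m A]]
  have 1: "of_nat k * ennreal (exp (- measure m A) * measure m A ^ k / fact k) =
     ennreal (real k * (exp (- measure m A) * measure m A ^ k / fact k))" for k
    by (simp only: ennreal_of_nat_eq_real_of_nat) (simp add: ennreal_mult[symmetric])
  have 2: "(of_nat k)\<^sup>2 * ennreal (exp (- measure m A) * measure m A ^ k / fact k) =
     ennreal ((real k)\<^sup>2 * (exp (- measure m A) * measure m A ^ k / fact k))" for k
    by (simp only: ennreal_of_nat_eq_real_of_nat ennreal_power of_nat_0_le_iff) (simp add: ennreal_mult[symmetric])
  show "(\<integral>\<^sup>+\<omega>. emeasure (N \<omega>) A \<partial>M) = emeasure m A"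
    by (subst count_law[OF A]) (simp only: 1 mA suminf_ennreal_eq[OF _ mom(2)] mult_nonneg_nonneg of_nat_0_le_iff
      divide_nonneg_nonneg exp_ge_zero zero_le_power measure_nonneg fact_ge_zero)
  have "(\<integral>\<^sup>+\<omega>. (emeasure (N \<omega>) A)\<^sup>2 \<partial>M) = ennreal ((measure m A)\<^sup>2 + measure m A)"
    by (subst count_law[OF A, of "\<lambda>x. x\<^sup>2"]) (simp only: 2 suminf_ennreal_eq[OF _ mom(3)] mult_nonneg_nonneg of_nat_0_le_iff
      divide_nonneg_nonneg exp_ge_zero zero_le_power measure_nonneg fact_ge_zero zero_le_power2)
  then show "(\<integral>\<^sup>+\<omega>. (emeasure (N \<omega>) A)\<^sup>2 \<partial>M) = (emeasure m A)\<^sup>2 + emeasure m A"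
    by (simp add: mA ennreal_power)
qed

lemma disjoint_counts:
  assumes A: "A \<in> sets m" "B \<in> sets m" "A \<inter> B = {}"
    and fin: "emeasure m A < \<infinity>" "emeasure m B < \<infinity>"
  shows "(\<integral>\<^sup>+\<omega>. emeasure (N \<omega>) A * emeasure (N \<omega>) B \<partial>M) = emeasure m A * emeasure m B"
proof -
  define C where "C i = (if i = (0::nat) then A else B)" for i
  have "indep_vars (\<lambda>_. borel) (\<lambda>i \<omega>. emeasure (N \<omega>) (C i)) {..<2::nat}"
  proof -
    have "(\<forall>i<2. C i \<in> sets m) \<and> disjoint_family_on C {..<2}"
      using A by (auto simp: C_def disjoint_family_on_def)
    then show ?thesis using prm unfolding poisson_random_measure_def by blast
  qed
  from indep_vars_nn_integral[OF _ this]
  show ?thesis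
    using A fin by (simp add: C_def numeral_2_eq_2 count_moments)
qed

text \<open>Only counts of disjoint sets are independent. Cutting \<^term>\<open>A\<close> and \<^term>\<open>B\<close> into the overlap and
  the two rests leaves the second moment of the overlap, which contributes the extra summand.\<close>

lemma two_counts_finite:
  assumes A: "A \<in> sets m" "B \<in> sets m" "emeasure m A < \<infinity>" "emeasure m B < \<infinity>"
  shows "(\<integral>\<^sup>+\<omega>. emeasure (N \<omega>) A * emeasure (N \<omega>) B \<partial>M) =
    emeasure m A * emeasure m B + emeasure m (A \<inter> B)"
proof -
  define P where "P = A - B"
  define Q where "Q = A \<inter> B"
  define S where "S = B - A"
  have [measurable]: "P \<in> sets m" "Q \<in> sets m" "S \<in> sets m"
    using A by (auto simp: P_def Q_def S_def)
  have fin: "emeasure m P < \<infinity>" "emeasure m Q < \<infinity>" "emeasure m S < \<infinity>"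
    using A emeasure_mono[of P A m] emeasure_mono[of Q A m] emeasure_mono[of S B m]
    by (auto simp: P_def Q_def S_def intro: le_less_trans)
  have split: "emeasure K A = emeasure K P + emeasure K Q" "emeasure K B = emeasure K Q + emeasure K S"
    if "sets K = sets m" for K
  proof -
    have "P \<union> Q = A" "Q \<union> S = B" "P \<inter> Q = {}" "Q \<inter> S = {}" by (auto simp: P_def Q_def S_def)
    then show "emeasure K A = emeasure K P + emeasure K Q" "emeasure K B = emeasure K Q + emeasure K S"
      using plus_emeasure[of P K Q] plus_emeasure[of Q K S] that by auto
  qed
  have "(\<integral>\<^sup>+\<omega>. emeasure (N \<omega>) A * emeasure (N \<omega>) B \<partial>M) =
    (\<integral>\<^sup>+\<omega>. emeasure (N \<omega>) P * emeasure (N \<omega>) Q + emeasure (N \<omega>) P * emeasure (N \<omega>) S +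
      (emeasure (N \<omega>) Q)\<^sup>2 + emeasure (N \<omega>) Q * emeasure (N \<omega>) S \<partial>M)"
    by (intro nn_integral_cong) (simp add: split algebra_simps power2_eq_square)
  also have "\<dots> = emeasure m P * emeasure m Q + emeasure m P * emeasure m S +
      ((emeasure m Q)\<^sup>2 + emeasure m Q) + emeasure m Q * emeasure m S"
  proof -
    have "P \<inter> Q = {}" "P \<inter> S = {}" "Q \<inter> S = {}" by (auto simp: P_def Q_def S_def)
    then show ?thesis
      using fin by (simp add: nn_integral_add count_moments disjoint_counts)
  qed
  also have "\<dots> = emeasure m A * emeasure m B + emeasure m Q"
    by (simp add: split algebra_simps power2_eq_square)
  finally show ?thesis by (simp add: Q_def)
qed

text \<open>The \<open>\<sigma>\<close>-algebra of \<^term>\<open>W\<close> only has to make the counts of sets inside the support of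
  \<^term>\<open>f\<close> measurable. With \<open>f\<close> supported in the past of a time \<open>t\<close> this gives adaptedness.\<close>

lemma nn_integral_N_measurable_on:
  assumes [measurable]: "f \<in> borel_measurable m"
    and W: "space W = space M"
      "\<And>A. A \<in> sets m \<Longrightarrow> (\<And>x. x \<in> A \<Longrightarrow> f x \<noteq> 0) \<Longrightarrow> (\<lambda>\<omega>. emeasure (N \<omega>) A) \<in> borel_measurable W"
  shows "(\<lambda>\<omega>. \<integral>\<^sup>+x. f x \<partial>N \<omega>) \<in> borel_measurable W"
proof -
  from borel_measurable_implies_simple_function_sequence'[OF assms(1)]
  obtain F where F: "\<And>i. simple_function m (F i)" "incseq F" "\<And>i x. F i x < top" "\<And>x. (SUP i. F i x) = f x"
    by blast
  have Fm[measurable]: "F i \<in> borel_measurable m" for i using F(1) by (rule borel_measurable_simple_function)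
  have "(\<lambda>\<omega>. \<integral>\<^sup>+x. F i x \<partial>N \<omega>) \<in> borel_measurable W" for i
  proof -
    have "(\<lambda>\<omega>. \<Sum>c\<in>F i ` space m. c * emeasure (N \<omega>) (F i -` {c} \<inter> space m)) \<in> borel_measurable W"
    proof (intro borel_measurable_sum)
      fix c assume "c \<in> F i ` space m"
      show "(\<lambda>\<omega>. c * emeasure (N \<omega>) (F i -` {c} \<inter> space m)) \<in> borel_measurable W"
      proof (cases "c = 0")
        case False
        have "F i x \<le> f x" for x using F(4)[of x] by (metis SUP_upper UNIV_I)
        with False have "f x \<noteq> 0" if "x \<in> F i -` {c} \<inter> space m" for x
          using that by (metis Int_iff le_zero_eq singletonD vimageE)
        then have "(\<lambda>\<omega>. emeasure (N \<omega>) (F i -` {c} \<inter> space m)) \<in> borel_measurable W"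
          by (intro W(2)) (auto simp: measurable_sets)
        then show ?thesis by simp
      qed simp
    qed
    also have "?this \<longleftrightarrow> ?thesis"
    proof (rule measurable_cong)
      fix \<omega> assume "\<omega> \<in> space W"
      then have o: "\<omega> \<in> space M" by (simp add: W)
      then have "simple_function (N \<omega>) (F i)" "space (N \<omega>) = space m"
        using F(1)[of i] sets_N[OF o] sets_eq_imp_space_eq[OF sets_N[OF o]] simple_function_cong_algebra[of "N \<omega>" m "F i"] by auto
      then show "(\<Sum>c\<in>F i ` space m. c * emeasure (N \<omega>) (F i -` {c} \<inter> space m)) = (\<integral>\<^sup>+x. F i x \<partial>N \<omega>)"
        by (simp add: nn_integral_eq_simple_integral simple_integral_def)
    qed
    finally show ?thesis .
  qed
  then have "(\<lambda>\<omega>. SUP i. \<integral>\<^sup>+x. F i x \<partial>N \<omega>) \<in> borel_measurable W" by simp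
  also have "?this \<longleftrightarrow> ?thesis"
  proof (rule measurable_cong)
    fix \<omega> assume "\<omega> \<in> space W"
    then have o: "\<omega> \<in> space M" by (simp add: W)
    have "(\<integral>\<^sup>+x. (SUP i. F i x) \<partial>N \<omega>) = (SUP i. \<integral>\<^sup>+x. F i x \<partial>N \<omega>)"
      by (rule nn_integral_monotone_convergence_SUP[OF F(2)]) (rule measurable_N[OF o Fm])
    then show "(SUP i. \<integral>\<^sup>+x. F i x \<partial>N \<omega>) = (\<integral>\<^sup>+x. f x \<partial>N \<omega>)" by (simp add: F)
  qed
  finally show ?thesis .
qed

lemma nn_integral_N_measurable [measurable (raw)]:
  "f \<in> borel_measurable m \<Longrightarrow> (\<lambda>\<omega>. \<integral>\<^sup>+x. f x \<partial>N \<omega>) \<in> borel_measurable M"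
  by (rule nn_integral_N_measurable_on) auto

text \<open>Both moment formulas are instances of this extension from sets to functions: the
  first with weight \<open>1\<close>, the second by two applications, with the weight first a count
  and then an integral against the random measure. Sets of finite intensity suffice as a start, since all others
  are countable disjoint unions of those.\<close>

lemma campbell_weighted:
  assumes [measurable]: "W \<in> borel_measurable M" "h \<in> borel_measurable m"
    and sets: "\<And>A. A \<in> sets m \<Longrightarrow> emeasure m A < \<infinity> \<Longrightarrow>
      (\<integral>\<^sup>+\<omega>. W \<omega> * emeasure (N \<omega>) A \<partial>M) = a * emeasure m A + (\<integral>\<^sup>+x. h x * indicator A x \<partial>m)"
    and f: "f \<in> borel_measurable m"
  shows "(\<integral>\<^sup>+\<omega>. W \<omega> * (\<integral>\<^sup>+x. f x \<partial>N \<omega>) \<partial>M) = a * (\<integral>\<^sup>+x. f x \<partial>m) + (\<integral>\<^sup>+x. h x * f x \<partial>m)"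
  using f
proof induction
  case (cong f g)
  have "(\<integral>\<^sup>+x. f x \<partial>N \<omega>) = (\<integral>\<^sup>+x. g x \<partial>N \<omega>)" if "\<omega> \<in> space M" for \<omega>
    using cong sets_eq_imp_space_eq[OF sets_N[OF that]] by (intro nn_integral_cong) auto
  then show ?case using cong by (simp cong: nn_integral_cong)
next
  case (set A)
  obtain S :: "nat \<Rightarrow> 'b set" where S: "range S \<subseteq> sets m" "(\<Union>i. S i) = space m"
      "\<And>i. emeasure m (S i) \<noteq> \<infinity>" "disjoint_family S"
    using intensity.sigma_finite_disjoint by blast
  define T where "T i = A \<inter> S i" for i
  have T [measurable]: "T i \<in> sets m" for i using S(1) set by (auto simp: T_def)
  have fin: "emeasure m (T i) < \<infinity>" for i
    using emeasure_mono[of "T i" "S i" m] S(1) S(3)[of i] by (auto simp: T_def less_top intro: le_less_trans)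
  have disj: "disjoint_family T" using S(4) by (auto simp: disjoint_family_on_def T_def)
  have A: "A = (\<Union>i. T i)" using S(2) sets.sets_into_space[OF set] by (auto simp: T_def)
  have sum: "emeasure K A = (\<Sum>i. emeasure K (T i))" if "sets K = sets m" for K
  proof -
    have "range T \<subseteq> sets K" unfolding that using T by blast
    from suminf_emeasure[OF this disj] show ?thesis unfolding A[symmetric] by (rule sym)
  qed
  have "(\<integral>\<^sup>+\<omega>. W \<omega> * emeasure (N \<omega>) A \<partial>M) = (\<integral>\<^sup>+\<omega>. (\<Sum>i. W \<omega> * emeasure (N \<omega>) (T i)) \<partial>M)"
    by (intro nn_integral_cong) (simp add: sum)
  also have "\<dots> = (\<Sum>i. a * emeasure m (T i) + (\<integral>\<^sup>+x. h x * indicator (T i) x \<partial>m))"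
    using fin by (subst nn_integral_suminf) (simp_all add: sets)
  also have "\<dots> = a * emeasure m A + (\<Sum>i. \<integral>\<^sup>+x. h x * indicator (T i) x \<partial>m)"
    by (simp add: suminf_add[symmetric] sum)
  also have "(\<Sum>i. \<integral>\<^sup>+x. h x * indicator (T i) x \<partial>m) = (\<integral>\<^sup>+x. h x * indicator A x \<partial>m)"
    using nn_integral_disjoint_family[OF assms(2) T disj] unfolding A[symmetric] by (rule sym)
  finally show ?case using set by (simp cong: nn_integral_cong)
next
  case (mult u c)
  then show ?case
    by (simp add: nn_integral_cmult measurable_N mult.left_commute[of _ c] distrib_left cong: nn_integral_cong)
next
  case (add u v)
  then show ?case
    by (simp add: nn_integral_add measurable_N distrib_left add_ac cong: nn_integral_cong)
next
  case (seq U)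
  have mono: "incseq (\<lambda>i. \<integral>\<^sup>+x. U i x \<partial>K)" "incseq (\<lambda>i x. h x * U i x)" for K
    using \<open>incseq U\<close> by (auto simp: incseq_def le_fun_def intro!: nn_integral_mono mult_left_mono)
  have "(\<integral>\<^sup>+\<omega>. W \<omega> * (\<integral>\<^sup>+x. (SUP i. U i x) \<partial>N \<omega>) \<partial>M) = (\<integral>\<^sup>+\<omega>. (SUP i. W \<omega> * (\<integral>\<^sup>+x. U i x \<partial>N \<omega>)) \<partial>M)"
    using seq by (intro nn_integral_cong) (simp add: nn_integral_monotone_convergence_SUP measurable_N SUP_mult_left_ennreal)
  also have "\<dots> = (SUP i. a * (\<integral>\<^sup>+x. U i x \<partial>m) + (\<integral>\<^sup>+x. h x * U i x \<partial>m))"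
    using seq mono by (subst nn_integral_monotone_convergence_SUP)
      (auto simp: incseq_def le_fun_def intro!: mult_left_mono)
  also have "\<dots> = (SUP i. a * (\<integral>\<^sup>+x. U i x \<partial>m)) + (SUP i. \<integral>\<^sup>+x. h x * U i x \<partial>m)"
    using \<open>incseq U\<close> by (intro ennreal_SUP_add) (auto simp: incseq_def le_fun_def intro!: nn_integral_mono mult_left_mono)
  also have "\<dots> = a * (\<integral>\<^sup>+x. (SUP i. U i x) \<partial>m) + (\<integral>\<^sup>+x. h x * (SUP i. U i x) \<partial>m)"
    using seq mono
    by (simp add: nn_integral_monotone_convergence_SUP SUP_mult_left_ennreal[symmetric]
        nn_integral_monotone_convergence_SUP[OF mono(2), symmetric])
  finally show ?case by (simp add: image_comp)
qed

lemma campbell_mean: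
  assumes "f \<in> borel_measurable m"
  shows "(\<integral>\<^sup>+\<omega>. (\<integral>\<^sup>+x. f x \<partial>N \<omega>) \<partial>M) = (\<integral>\<^sup>+x. f x \<partial>m)"
  using campbell_weighted[of "\<lambda>_. 1" "\<lambda>_. 0" 1 f] assms by (simp add: count_moments)

lemma campbell_second:
  assumes [measurable]: "f \<in> borel_measurable m" "g \<in> borel_measurable m"
  shows "(\<integral>\<^sup>+\<omega>. (\<integral>\<^sup>+x. f x \<partial>N \<omega>) * (\<integral>\<^sup>+x. g x \<partial>N \<omega>) \<partial>M) =
    (\<integral>\<^sup>+x. f x \<partial>m) * (\<integral>\<^sup>+x. g x \<partial>m) + (\<integral>\<^sup>+x. f x * g x \<partial>m)"
proof (rule campbell_weighted)
  fix B assume [measurable]: "B \<in> sets m" and B: "emeasure m B < \<infinity>"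
  have "(\<integral>\<^sup>+\<omega>. emeasure (N \<omega>) B * (\<integral>\<^sup>+x. f x \<partial>N \<omega>) \<partial>M) =
      emeasure m B * (\<integral>\<^sup>+x. f x \<partial>m) + (\<integral>\<^sup>+x. indicator B x * f x \<partial>m)"
    using B by (intro campbell_weighted) (auto simp: two_counts_finite indicator_inter_arith[symmetric])
  then show "(\<integral>\<^sup>+\<omega>. (\<integral>\<^sup>+x. f x \<partial>N \<omega>) * emeasure (N \<omega>) B \<partial>M) =
      (\<integral>\<^sup>+x. f x \<partial>m) * emeasure m B + (\<integral>\<^sup>+x. f x * indicator B x \<partial>m)"
    by (simp only: mult.commute)
qed measurable

end

section \<open>Joint measurability of parameter integrals\<close>

text \<open>For random measures of mass at most one this is a property of the Giry monad. Here the measure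
  is only \<open>\<sigma>\<close>-finite, so each piece \<^term>\<open>S i\<close> is normalised by its own random mass (or by \<open>1\<close> if
  that is smaller), and the pieces are reassembled with the masses as factors. Where the mass of a
  piece is infinite, the normalising factor is \<open>0\<close>, so that the subprobability property holds at
  every sample point.\<close>

lemma measurable_nn_integral_random_measure:
  fixes K :: "'w \<Rightarrow> 'b measure" and S :: "nat \<Rightarrow> 'b set"
  assumes sets_K: "\<And>w. w \<in> space W \<Longrightarrow> sets (K w) = sets m"
    and K: "\<And>A. A \<in> sets m \<Longrightarrow> (\<lambda>w. emeasure (K w) A) \<in> borel_measurable W"
    and S: "range S \<subseteq> sets m" "(\<Union>i. S i) = space m" "disjoint_family S"
    and ne: "space m \<noteq> {}"
    and f[measurable]: "(\<lambda>(s, x). f s x) \<in> borel_measurable (T \<Otimes>\<^sub>M m)"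
  shows "(\<lambda>(s, w). if \<forall>i. emeasure (K w) (S i) < \<infinity> then \<integral>\<^sup>+x. f s x \<partial>K w else 0) \<in> borel_measurable (T \<Otimes>\<^sub>M W)"
proof -
  have [measurable]: "S i \<in> sets m" for i using S(1) by auto
  define c where "c i w = inverse (max 1 (emeasure (K w) (S i)))" for i w
  define L where "L i w = density (K w) (\<lambda>x. c i w * indicator (S i) x)" for i w
  have [measurable]: "c i \<in> borel_measurable W" for i
    unfolding c_def using K by measurable
  have emL: "emeasure (L i w) A = c i w * emeasure (K w) (A \<inter> S i)" if "w \<in> space W" "A \<in> sets m" for i w A
  proof -
    have [measurable_cong]: "sets (K w) = sets m" using sets_K that by simp
    have "emeasure (L i w) A = (\<integral>\<^sup>+x. c i w * indicator (A \<inter> S i) x \<partial>K w)"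
      unfolding L_def using that
      by (subst emeasure_density) (auto simp: indicator_inter_arith mult_ac sets_K intro!: nn_integral_cong)
    then show ?thesis using that by (simp add: nn_integral_cmult_indicator sets_K)
  qed
  have c1: "c i w * max 1 (emeasure (K w) (S i)) \<le> 1" for i w
  proof (cases "emeasure (K w) (S i) = \<infinity>")
    case False
    then show ?thesis unfolding c_def by (subst mult.commute, subst ennreal_divide_self[unfolded divide_ennreal_def]) (auto simp: max_def less_top)
  qed (simp add: c_def max_def)
  have [measurable]: "L i \<in> measurable W (subprob_algebra m)" for i
  proof (rule measurable_subprob_algebra)
    fix w assume w: "w \<in> space W"
    note sp = sets_eq_imp_space_eq[OF sets_K[OF w]]
    show "sets (L i w) = sets m" by (simp add: L_def sets_K w)
    have "emeasure (L i w) (space m) = c i w * emeasure (K w) (S i)"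
      using w by (simp add: emL Int_absorb1 sets.sets_into_space)
    also have "\<dots> \<le> c i w * max 1 (emeasure (K w) (S i))" by (intro mult_left_mono) auto
    finally have "emeasure (L i w) (space m) \<le> 1" using c1[of i w] by simp
    then show "subprob_space (L i w)"
      using sets_eq_imp_space_eq[OF \<open>sets (L i w) = sets m\<close>] ne by (intro subprob_spaceI) (simp_all add: L_def sp)
  next
    fix A assume A: "A \<in> sets m"
    have "(\<lambda>w. c i w * emeasure (K w) (A \<inter> S i)) \<in> borel_measurable W" using K A by measurable
    then show "(\<lambda>w. emeasure (L i w) A) \<in> borel_measurable W"
      by (rule measurable_cong[THEN iffD1, rotated]) (simp add: emL A)
  qed
  have [measurable]: "(\<lambda>p. \<integral>\<^sup>+x. f (fst p) x \<partial>L i (snd p)) \<in> borel_measurable (T \<Otimes>\<^sub>M W)" for i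
    by (rule nn_integral_measurable_subprob_algebra2) measurable
  have [measurable]: "Measurable.pred W (\<lambda>w. \<forall>i. emeasure (K w) (S i) < \<infinity>)"
    using K by measurable
  have "(\<lambda>p. if \<forall>i. emeasure (K (snd p)) (S i) < \<infinity>
      then \<Sum>i. max 1 (emeasure (K (snd p)) (S i)) * (\<integral>\<^sup>+x. f (fst p) x \<partial>L i (snd p)) else 0) \<in> borel_measurable (T \<Otimes>\<^sub>M W)"
    using K by measurable
  then show ?thesis
  proof (rule measurable_cong[THEN iffD1, rotated])
    fix p assume "p \<in> space (T \<Otimes>\<^sub>M W)"
    then obtain s w where p: "p = (s, w)" "s \<in> space T" and w: "w \<in> space W" by (auto simp: space_pair_measure)
    note [measurable_cong] = sets_K[OF w]
    have [measurable]: "f s \<in> borel_measurable m" using measurable_Pair2[OF f p(2)] by simp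
    show "(if \<forall>i. emeasure (K (snd p)) (S i) < \<infinity>
      then \<Sum>i. max 1 (emeasure (K (snd p)) (S i)) * (\<integral>\<^sup>+x. f (fst p) x \<partial>L i (snd p)) else 0) =
      (case p of (s, w) \<Rightarrow> if \<forall>i. emeasure (K w) (S i) < \<infinity> then \<integral>\<^sup>+x. f s x \<partial>K w else 0)"
    proof (cases "\<forall>i. emeasure (K w) (S i) < \<infinity>")
      case True
      have c2: "max 1 (emeasure (K w) (S i)) * c i w = 1" for i
        using True[rule_format, of i] unfolding c_def
        by (subst ennreal_divide_self[unfolded divide_ennreal_def]) (auto simp: max_def)
      have "max 1 (emeasure (K w) (S i)) * (\<integral>\<^sup>+x. f s x \<partial>L i w) = (\<integral>\<^sup>+x. f s x * indicator (S i) x \<partial>K w)" for i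
      proof -
        have "(\<integral>\<^sup>+x. f s x \<partial>L i w) = c i w * (\<integral>\<^sup>+x. f s x * indicator (S i) x \<partial>K w)"
          unfolding L_def by (subst nn_integral_density) (auto simp: nn_integral_cmult[symmetric] mult_ac intro!: nn_integral_cong)
        then show ?thesis by (simp add: mult.assoc[symmetric] c2)
      qed
      moreover have "(\<Sum>i. \<integral>\<^sup>+x. f s x * indicator (S i) x \<partial>K w) = (\<integral>\<^sup>+x. f s x \<partial>K w)"
      proof -
        have "(\<integral>\<^sup>+x\<in>(\<Union>i. S i). f s x \<partial>K w) = (\<Sum>i. \<integral>\<^sup>+x\<in>S i. f s x \<partial>K w)"
          using S(3) sets_K[OF w] by (intro nn_integral_disjoint_family) auto
        moreover have "(\<integral>\<^sup>+x\<in>(\<Union>i. S i). f s x \<partial>K w) = (\<integral>\<^sup>+x. f s x \<partial>K w)"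
          using S(2) sets_eq_imp_space_eq[OF sets_K[OF w]] by (intro nn_integral_cong) auto
        ultimately show ?thesis by simp
      qed
      ultimately show ?thesis using True by (simp add: p)
    qed (auto simp: p)
  qed
qed

section \<open>Convergence in the square mean\<close>

text \<open>The squared norm is kept in the extended nonnegative reals, so that no integrability has
  to be known before a convergence statement can be made.\<close>

definition l2 :: "'b measure \<Rightarrow> ('b \<Rightarrow> real) \<Rightarrow> ennreal" where
  "l2 M f = (\<integral>\<^sup>+x. ennreal ((f x)\<^sup>2) \<partial>M)"

lemma square_sum_weighted:
  fixes a b e :: real
  assumes "0 < e"
  shows "(a + b)\<^sup>2 \<le> (1 + e) * a\<^sup>2 + (1 + 1 / e) * b\<^sup>2"
proof -
  have "0 \<le> (e * a - b)\<^sup>2 / e" using assms by simp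
  also have "\<dots> = (1 + e) * a\<^sup>2 + (1 + 1 / e) * b\<^sup>2 - (a + b)\<^sup>2"
    using assms by (simp add: field_simps power2_eq_square)
  finally show ?thesis by simp
qed

lemma l2_add_weighted:
  assumes [measurable]: "f \<in> borel_measurable M" "g \<in> borel_measurable M" and e: "0 < e"
  shows "l2 M (\<lambda>x. f x + g x) \<le> ennreal (1 + e) * l2 M f + ennreal (1 + 1 / e) * l2 M g"
proof -
  have "l2 M (\<lambda>x. f x + g x) \<le> (\<integral>\<^sup>+x. ennreal (1 + e) * ennreal ((f x)\<^sup>2) + ennreal (1 + 1 / e) * ennreal ((g x)\<^sup>2) \<partial>M)"
    unfolding l2_def using e square_sum_weighted[OF e]
    by (intro nn_integral_mono) (simp add: ennreal_mult[symmetric] ennreal_plus[symmetric] del: ennreal_plus)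
  also have "\<dots> = ennreal (1 + e) * l2 M f + ennreal (1 + 1 / e) * l2 M g"
    unfolding l2_def by (simp add: nn_integral_add nn_integral_cmult)
  finally show ?thesis .
qed

lemma l2_add_le:
  assumes "f \<in> borel_measurable M" "g \<in> borel_measurable M"
  shows "l2 M (\<lambda>x. f x + g x) \<le> 2 * l2 M f + 2 * l2 M g"
  using l2_add_weighted[OF assms, of 1] by simp

lemma l2_diff_commute: "l2 M (\<lambda>x. f x - g x) = l2 M (\<lambda>x. g x - f x)"
  unfolding l2_def by (simp add: power2_commute)

lemma l2_triangle:
  assumes [measurable]: "f \<in> borel_measurable M" "g \<in> borel_measurable M" "h \<in> borel_measurable M"
  shows "l2 M (\<lambda>x. f x - h x) \<le> 2 * l2 M (\<lambda>x. f x - g x) + 2 * l2 M (\<lambda>x. g x - h x)"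
  using l2_add_le[of "\<lambda>x. f x - g x" M "\<lambda>x. g x - h x"] by simp

text \<open>Norm inequalities survive limits in \<open>L\<^sup>2\<close>. The weight \<open>e\<close> in the quadratic triangle inequality
  tends to zero only after the limit along the sequence, which replaces the use of Minkowski's
  inequality.\<close>

lemma l2_limit_mono:
  assumes [measurable]: "\<And>n. f n \<in> borel_measurable M" "F \<in> borel_measurable M"
    "\<And>n. g n \<in> borel_measurable Q" "G \<in> borel_measurable Q"
    and f: "(\<lambda>n. l2 M (\<lambda>x. f n x - F x)) \<longlonglongrightarrow> 0"
    and g: "(\<lambda>n. l2 Q (\<lambda>x. g n x - G x)) \<longlonglongrightarrow> 0"
    and le: "\<And>n. l2 M (f n) \<le> l2 Q (g n)"
  shows "l2 M F \<le> l2 Q G"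
proof -
  have e: "l2 M F \<le> ennreal ((1 + e)\<^sup>2) * l2 Q G" if e: "0 < e" for e
  proof -
    let ?c = "ennreal (1 + 1 / e)" and ?d = "ennreal (1 + e)"
    have "l2 M F \<le> ?d * (?d * l2 Q G + ?c * l2 Q (\<lambda>x. g n x - G x)) + ?c * l2 M (\<lambda>x. f n x - F x)" for n
    proof -
      have "l2 M F \<le> ?d * l2 M (f n) + ?c * l2 M (\<lambda>x. f n x - F x)"
        using l2_add_weighted[of "f n" M "\<lambda>x. F x - f n x" e] e by (simp add: l2_diff_commute[of M F])
      also have "\<dots> \<le> ?d * l2 Q (g n) + ?c * l2 M (\<lambda>x. f n x - F x)"
        using le by (intro add_right_mono mult_left_mono) auto
      also have "l2 Q (g n) \<le> ?d * l2 Q G + ?c * l2 Q (\<lambda>x. g n x - G x)"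
        using l2_add_weighted[of G Q "\<lambda>x. g n x - G x" e] e by simp
      finally show ?thesis by (simp add: add_right_mono mult_left_mono)
    qed
    moreover have "(\<lambda>n. ?d * (?d * l2 Q G + ?c * l2 Q (\<lambda>x. g n x - G x)) + ?c * l2 M (\<lambda>x. f n x - F x))
       \<longlonglongrightarrow> ?d * (?d * l2 Q G + ?c * 0) + ?c * 0"
      using f g by (intro tendsto_intros ennreal_tendsto_cmult) auto
    ultimately have "l2 M F \<le> ?d * (?d * l2 Q G + ?c * 0) + ?c * 0"
      by (intro tendsto_lowerbound[OF _ always_eventually]) auto
    then show ?thesis using e by (simp add: power2_eq_square ennreal_mult mult.assoc)
  qed
  show ?thesis
  proof (cases "l2 Q G = \<infinity>")
    case False
    have "(\<lambda>n. ennreal ((1 + 1 / real (Suc n))\<^sup>2)) \<longlonglongrightarrow> ennreal ((1 + 0)\<^sup>2)"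
      by (intro tendsto_intros LIMSEQ_inverse_real_of_nat[unfolded inverse_eq_divide])
    then have lim: "(\<lambda>n. l2 Q G * ennreal ((1 + 1 / real (Suc n))\<^sup>2)) \<longlonglongrightarrow> l2 Q G * ennreal ((1 + 0)\<^sup>2)"
      using False by (intro ennreal_tendsto_cmult) (auto simp: less_top)
    have "l2 M F \<le> l2 Q G * ennreal ((1 + 1 / real (Suc n))\<^sup>2)" for n
      by (subst mult.commute) (rule e, simp)
    then have "l2 M F \<le> l2 Q G * ennreal ((1 + 0)\<^sup>2)"
      by (intro tendsto_lowerbound[OF lim always_eventually]) auto
    then show ?thesis by simp
  qed simp
qed

lemma integrable_of_l2_finite:
  "f \<in> borel_measurable M \<Longrightarrow> l2 M f < \<infinity> \<Longrightarrow> integrable M (\<lambda>x. (f x)\<^sup>2)"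
  unfolding l2_def by (intro integrableI_bounded) auto

lemma l2_eq_integral: "integrable M (\<lambda>x. (f x)\<^sup>2) \<Longrightarrow> l2 M f = ennreal (\<integral>x. (f x)\<^sup>2 \<partial>M)"
  unfolding l2_def by (rule nn_integral_eq_integral) auto

lemma integrable_mult_of_squares:
  fixes f g :: "'b \<Rightarrow> real"
  assumes [measurable]: "f \<in> borel_measurable M" "g \<in> borel_measurable M"
    and "integrable M (\<lambda>x. (f x)\<^sup>2)" "integrable M (\<lambda>x. (g x)\<^sup>2)"
  shows "integrable M (\<lambda>x. f x * g x)"
proof (rule Bochner_Integration.integrable_bound)
  show "integrable M (\<lambda>x. (f x)\<^sup>2 + (g x)\<^sup>2)" using assms by simp
  have "\<bar>a * b\<bar> \<le> a\<^sup>2 + b\<^sup>2" for a b :: real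
  proof -
    have "2 * (\<bar>a\<bar> * \<bar>b\<bar>) \<le> a\<^sup>2 + b\<^sup>2" "0 \<le> \<bar>a\<bar> * \<bar>b\<bar>"
      using sum_squares_bound[of "\<bar>a\<bar>" "\<bar>b\<bar>"] by (auto simp: mult.assoc)
    then show ?thesis unfolding abs_mult by linarith
  qed
  then show "AE x in M. norm (f x * g x) \<le> norm ((f x)\<^sup>2 + (g x)\<^sup>2)" by simp
qed simp

text \<open>Instead of the Cauchy--Schwarz inequality the bound \<open>\<bar>a b\<bar> \<le> e a\<^sup>2 + b\<^sup>2 / e\<close> is used, again with
  \<open>e\<close> sent to zero at the end.\<close>

lemma orthogonal_l2_limit:
  fixes G J :: "'b \<Rightarrow> real"
  assumes [measurable]: "G \<in> borel_measurable M" "J \<in> borel_measurable M" "\<And>n. I n \<in> borel_measurable M"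
    and G: "integrable M (\<lambda>x. (G x)\<^sup>2)" and J: "integrable M (\<lambda>x. (J x)\<^sup>2)"
    and I: "\<And>n. integrable M (\<lambda>x. (I n x)\<^sup>2)"
    and orth: "\<And>n. (\<integral>x. G x * I n x \<partial>M) = 0"
    and lim: "(\<lambda>n. l2 M (\<lambda>x. I n x - J x)) \<longlonglongrightarrow> 0"
  shows "(\<integral>x. G x * J x \<partial>M) = 0"
proof -
  let ?c = "\<bar>\<integral>x. G x * J x \<partial>M\<bar>"
  have D: "integrable M (\<lambda>x. (I n x - J x)\<^sup>2)" for n
    unfolding power2_diff mult.assoc
    by (intro Bochner_Integration.integrable_add Bochner_Integration.integrable_diff integrable_mult_right
        integrable_mult_of_squares I J) measurable
  define d where "d n = (\<integral>x. (I n x - J x)\<^sup>2 \<partial>M)" for n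
  have "(\<lambda>n. ennreal (d n)) \<longlonglongrightarrow> ennreal 0"
    using lim by (simp add: l2_eq_integral[OF D] d_def)
  then have d: "d \<longlonglongrightarrow> 0"
    by (subst (asm) tendsto_ennreal_iff) (auto simp: d_def)
  have e: "?c \<le> e * (\<integral>x. (G x)\<^sup>2 \<partial>M)" if "0 < e" for e
  proof -
    have "?c \<le> e * (\<integral>x. (G x)\<^sup>2 \<partial>M) + 1 / e * d n" for n
    proof -
      have "(\<integral>x. G x * J x \<partial>M) = (\<integral>x. G x * J x \<partial>M) - (\<integral>x. G x * I n x \<partial>M)" by (simp add: orth)
      also have "\<dots> = (\<integral>x. G x * (J x - I n x) \<partial>M)"
        using G I J by (subst Bochner_Integration.integral_diff[symmetric])
          (auto intro!: integrable_mult_of_squares simp: right_diff_distrib)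
      finally have "?c \<le> (\<integral>x. \<bar>G x * (J x - I n x)\<bar> \<partial>M)" by (simp add: integral_abs_bound)
      also have "\<dots> \<le> (\<integral>x. e * (G x)\<^sup>2 + 1 / e * (I n x - J x)\<^sup>2 \<partial>M)"
      proof (rule integral_mono)
        show "integrable M (\<lambda>x. \<bar>G x * (J x - I n x)\<bar>)"
          using G D[of n] by (intro integrable_abs integrable_mult_of_squares) (auto simp: power2_commute)
        show "\<bar>G x * (J x - I n x)\<bar> \<le> e * (G x)\<^sup>2 + 1 / e * (I n x - J x)\<^sup>2" for x
        proof -
          have "\<bar>a * b\<bar> \<le> e * a\<^sup>2 + 1 / e * b\<^sup>2" for a b
          proof -
            have "0 \<le> (e * \<bar>a\<bar> - \<bar>b\<bar>)\<^sup>2 / e + \<bar>a * b\<bar>" using that by (simp add: divide_nonneg_pos)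
            also have "\<dots> = e * a\<^sup>2 + 1 / e * b\<^sup>2 - \<bar>a * b\<bar>"
              using that by (simp add: field_simps power2_eq_square abs_mult)
            finally show ?thesis by simp
          qed
          from this[of "G x" "J x - I n x"] show ?thesis by (simp add: power2_commute)
        qed
      qed (use G D in auto)
      also have "\<dots> = e * (\<integral>x. (G x)\<^sup>2 \<partial>M) + 1 / e * d n"
        using G D by (simp add: d_def)
      finally show ?thesis .
    qed
    moreover have "(\<lambda>n. e * (\<integral>x. (G x)\<^sup>2 \<partial>M) + 1 / e * d n) \<longlonglongrightarrow> e * (\<integral>x. (G x)\<^sup>2 \<partial>M) + 1 / e * 0"
      by (intro tendsto_intros d)
    ultimately show ?thesis by (intro tendsto_lowerbound[OF _ always_eventually]) auto
  qed
  have "(\<lambda>n. 1 / real (Suc n) * (\<integral>x. (G x)\<^sup>2 \<partial>M)) \<longlonglongrightarrow> 0 * (\<integral>x. (G x)\<^sup>2 \<partial>M)"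
    by (intro tendsto_intros LIMSEQ_inverse_real_of_nat[unfolded inverse_eq_divide])
  then have "?c \<le> 0 * (\<integral>x. (G x)\<^sup>2 \<partial>M)"
    by (rule LIMSEQ_le_const) (intro exI allI impI e, simp)
  then show ?thesis by simp
qed

text \<open>Completeness of \<open>L\<^sup>2\<close> for sequences with geometric decay: the
  expected increments are summable, so the sequence converges almost surely, and Fatou's lemma turns
  the Cauchy bound into a bound for the distance to the limit.\<close>

lemma (in prob_space) l2_complete_fast:
  fixes I :: "nat \<Rightarrow> 'a \<Rightarrow> real" and C :: real
  assumes [measurable]: "\<And>n. I n \<in> borel_measurable M"
    and C: "0 \<le> C" "\<And>n k. l2 M (\<lambda>x. I n x - I (n + k) x) \<le> ennreal (C / 4 ^ n)"
  obtains J where "J \<in> borel_measurable M" "(\<lambda>n. l2 M (\<lambda>x. I n x - J x)) \<longlonglongrightarrow> 0"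
proof -
  let ?D = "\<lambda>n x. \<bar>I (Suc n) x - I n x\<bar>"
  have D: "(\<integral>\<^sup>+x. ennreal (?D n x) \<partial>M) \<le> ennreal ((1 + C) * (1 / 2) ^ n)" for n
  proof -
    have "?D n x \<le> (1 / 2) ^ n + 2 ^ n * (I n x - I (n + 1) x)\<^sup>2" for x
    proof -
      \<comment> \<open>with this scaling both terms decay like \<open>2\<close> to the power \<open>- n\<close> after integration\<close>
      let ?u = "2 ^ n * ?D n x"
      have "?u \<le> 1 + ?u\<^sup>2"
      proof -
        have "2 * ?u \<le> 1 + ?u\<^sup>2" "0 \<le> ?u" using sum_squares_bound[of 1 ?u] by auto
        then show ?thesis by linarith
      qed
      then have "?u / 2 ^ n \<le> (1 + ?u\<^sup>2) / 2 ^ n" by (intro divide_right_mono) auto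
      also have "\<dots> = (1 / 2) ^ n + 2 ^ n * (I n x - I (n + 1) x)\<^sup>2"
        by (simp add: add_divide_distrib power_divide power_mult_distrib power2_commute[of "I n x"])
          (simp add: power2_eq_square)
      finally show ?thesis by simp
    qed
    then have "(\<integral>\<^sup>+x. ennreal (?D n x) \<partial>M) \<le> (\<integral>\<^sup>+x. ennreal ((1 / 2) ^ n) + ennreal (2 ^ n) * ennreal ((I n x - I (n + 1) x)\<^sup>2) \<partial>M)"
      by (intro nn_integral_mono) (simp add: ennreal_mult[symmetric] ennreal_plus[symmetric] del: ennreal_plus)
    also have "\<dots> = ennreal ((1 / 2) ^ n) + ennreal (2 ^ n) * l2 M (\<lambda>x. I n x - I (n + 1) x)"
      unfolding l2_def by (simp add: nn_integral_add nn_integral_cmult emeasure_space_1)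
    also have "\<dots> \<le> ennreal ((1 / 2) ^ n) + ennreal (2 ^ n) * ennreal (C / 4 ^ n)"
      by (intro add_left_mono mult_left_mono C) auto
    also have "\<dots> = ennreal ((1 / 2) ^ n + 2 ^ n * (C / 4 ^ n))"
      using C by (simp add: ennreal_mult[symmetric] ennreal_plus[symmetric] del: ennreal_plus)
    also have "(1 / 2) ^ n + 2 ^ n * (C / 4 ^ n) = (1 + C) * (1 / 2 :: real) ^ n"
    proof -
      have "(2::real) ^ n / 4 ^ n = (2 / 4) ^ n" by (rule power_divide[symmetric])
      then have *: "(2::real) ^ n / 4 ^ n = (1 / 2) ^ n" by simp
      have "2 ^ n * (C / 4 ^ n) = C * (2 ^ n / 4 ^ n)" by (simp only: times_divide_eq_right mult.commute)
      then show ?thesis unfolding * by (simp only: distrib_right mult_1)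
    qed
    finally show ?thesis .
  qed
  have "(\<integral>\<^sup>+x. (\<Sum>n. ennreal (?D n x)) \<partial>M) = (\<Sum>n. \<integral>\<^sup>+x. ennreal (?D n x) \<partial>M)"
    by (rule nn_integral_suminf) simp
  also have "\<dots> \<le> (\<Sum>n. ennreal ((1 + C) * (1 / 2) ^ n))"
    by (intro suminf_le D) auto
  also have "\<dots> = ennreal (\<Sum>n. (1 + C) * (1 / 2) ^ n)"
    using C by (intro suminf_ennreal2 summable_mult summable_geometric) auto
  also have "\<dots> < \<infinity>" by simp
  finally have "AE x in M. (\<Sum>n. ennreal (?D n x)) \<noteq> \<infinity>"
    by (intro nn_integral_PInf_AE) auto
  then have conv: "AE x in M. convergent (\<lambda>n. I n x)"
  proof eventually_elim
    case (elim x)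
    then have "summable (\<lambda>n. ?D n x)" by (intro summable_suminf_not_top) auto
    then have "summable (\<lambda>n. I (Suc n) x - I n x)" by (rule summable_rabs_cancel)
    then have "convergent (\<lambda>n. \<Sum>i<n. I (Suc i) x - I i x)" by (simp add: summable_iff_convergent)
    then have "convergent (\<lambda>n. I n x - I 0 x)" using sum_lessThan_telescope[of "\<lambda>i. I i x"] by simp
    from convergent_add[OF this convergent_const[of "I 0 x"]] show ?case by simp
  qed
  define J where "J x = lim (\<lambda>n. I n x)" for x
  have [measurable]: "J \<in> borel_measurable M" unfolding J_def by measurable
  have "l2 M (\<lambda>x. I n x - J x) \<le> ennreal (C / 4 ^ n)" for n
  proof -
    have "l2 M (\<lambda>x. I n x - J x) = (\<integral>\<^sup>+x. liminf (\<lambda>k. ennreal ((I n x - I (n + k) x)\<^sup>2)) \<partial>M)"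
      unfolding l2_def
    proof (rule nn_integral_cong_AE)
      show "AE x in M. ennreal ((I n x - J x)\<^sup>2) = liminf (\<lambda>k. ennreal ((I n x - I (n + k) x)\<^sup>2))"
        using conv
      proof eventually_elim
        case (elim x)
        then have "(\<lambda>k. I k x) \<longlonglongrightarrow> J x" unfolding J_def by (simp add: convergent_LIMSEQ_iff)
        from LIMSEQ_ignore_initial_segment[OF this, of n]
        have "(\<lambda>k. I (n + k) x) \<longlonglongrightarrow> J x" by (simp add: add.commute)
        then have "(\<lambda>k. ennreal ((I n x - I (n + k) x)\<^sup>2)) \<longlonglongrightarrow> ennreal ((I n x - J x)\<^sup>2)"
          by (intro tendsto_intros)
        then show ?case by (intro lim_imp_Liminf[symmetric]) auto
      qed
    qed
    also have "\<dots> \<le> liminf (\<lambda>k. l2 M (\<lambda>x. I n x - I (n + k) x))"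
      unfolding l2_def by (rule nn_integral_liminf) measurable
    also have "\<dots> \<le> ennreal (C / 4 ^ n)"
      by (intro Liminf_le) (auto simp: C)
    finally show ?thesis .
  qed
  moreover have "(\<lambda>n. ennreal (C / 4 ^ n)) \<longlonglongrightarrow> ennreal 0"
    by (intro tendsto_ennrealI) real_asymp
  ultimately have "(\<lambda>n. l2 M (\<lambda>x. I n x - J x)) \<longlonglongrightarrow> 0"
    using tendsto_sandwich[of "\<lambda>_. 0" "\<lambda>n. l2 M (\<lambda>x. I n x - J x)" sequentially "\<lambda>n. ennreal (C / 4 ^ n)" 0]
    by (simp add: always_eventually)
  with \<open>J \<in> borel_measurable M\<close> show thesis by (rule that)
qed

section \<open>Independence and Gaussian white noise\<close>

lemma (in prob_space) indep_set_expectation_mult: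
  fixes X Z :: "'a \<Rightarrow> real"
  assumes ind: "indep_set \<A> \<B>"
    and \<A>: "sigma_algebra (space M) \<A>" "\<And>S. S \<in> sets borel \<Longrightarrow> X -` S \<inter> space M \<in> \<A>"
    and \<B>: "sigma_algebra (space M) \<B>" "\<And>S. S \<in> sets borel \<Longrightarrow> Z -` S \<inter> space M \<in> \<B>"
    and int: "integrable M X" "integrable M Z"
  shows "integrable M (\<lambda>\<omega>. X \<omega> * Z \<omega>)"
    and "expectation (\<lambda>\<omega>. X \<omega> * Z \<omega>) = expectation X * expectation Z"
proof -
  have "sigma_sets (space M) {X -` S \<inter> space M | S. S \<in> sets borel} \<subseteq> \<A>"
    by (rule sigma_algebra.sigma_sets_subset[OF \<A>(1)]) (use \<A>(2) in blast)
  moreover have "sigma_sets (space M) {Z -` S \<inter> space M | S. S \<in> sets borel} \<subseteq> \<B>"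
    by (rule sigma_algebra.sigma_sets_subset[OF \<B>(1)]) (use \<B>(2) in blast)
  ultimately have "indep_var borel X borel Z"
    using ind int unfolding indep_var_eq indep_sets2_eq by (meson borel_measurable_integrable subset_eq)
  then show "integrable M (\<lambda>\<omega>. X \<omega> * Z \<omega>)" "expectation (\<lambda>\<omega>. X \<omega> * Z \<omega>) = expectation X * expectation Z"
    using int by (auto intro: indep_var_integrable indep_var_lebesgue_integral)
qed

lemma sigma_algebra_gen_events:
  "sigma_algebra (space M) (gen_events M Z I)"
  unfolding gen_events_def by (intro sigma_algebra_sigma_sets) auto

lemma gen_eventsI: "i \<in> I \<Longrightarrow> S \<in> sets borel \<Longrightarrow> Z i -` S \<inter> space M \<in> gen_events M Z I"
  unfolding gen_events_def by blast

lemma (in prob_space) centered_gaussian_moments: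
  assumes "centered_gaussian M Z"
  shows "Z \<in> borel_measurable M" "integrable M Z" "integrable M (\<lambda>\<omega>. (Z \<omega>)\<^sup>2)" "expectation Z = 0"
proof -
  show [measurable]: "Z \<in> borel_measurable M" using assms by (simp add: centered_gaussian_def)
  have "integrable M Z \<and> integrable M (\<lambda>\<omega>. (Z \<omega>)\<^sup>2) \<and> expectation Z = 0"
  proof (cases "AE \<omega> in M. Z \<omega> = 0")
    case True
    then have 0: "AE \<omega> in M. Z \<omega> = (\<lambda>_. 0) \<omega>" "AE \<omega> in M. (Z \<omega>)\<^sup>2 = (\<lambda>_. 0) \<omega>" by auto
    show ?thesis
      using integrable_cong_AE[OF _ _ 0(1)] integrable_cong_AE[OF _ _ 0(2)] integral_cong_AE[OF _ _ 0(1)] by simp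
  next
    case False
    then obtain s where s: "s > 0" and D: "distributed M lborel Z (normal_density 0 s)"
      using assms by (auto simp: centered_gaussian_def)
    have "integrable M Z"
      using distributed_integrable[OF D, of "\<lambda>x. x"] integrable_normal_moment[OF s, of 0 1] by simp
    moreover have "integrable M (\<lambda>\<omega>. (Z \<omega>)\<^sup>2)"
      using distributed_integrable[OF D, of "\<lambda>x. x\<^sup>2"] integrable_normal_moment[OF s, of 0 2] by simp
    moreover have "expectation Z = 0"
      using distributed_integral[OF D, of "\<lambda>x. x"] integral_normal_moment_nz_1[OF s, of 0] by simp
    ultimately show ?thesis by simp
  qed
  then show "integrable M Z" "integrable M (\<lambda>\<omega>. (Z \<omega>)\<^sup>2)" "expectation Z = 0" by auto
qed

locale white_noise = prob_space M for M :: "'a measure" +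
  fixes m :: "'b measure" and B :: "'b set \<Rightarrow> 'a \<Rightarrow> real"
  assumes noise: "gaussian_white_noise M m B"
begin

lemma noise_moments:
  assumes "A \<in> finite_sets m"
  shows "B A \<in> borel_measurable M" "integrable M (B A)" "integrable M (\<lambda>\<omega>. (B A \<omega>)\<^sup>2)" "expectation (B A) = 0"
proof -
  have "finite {A} \<and> {A} \<subseteq> finite_sets m" using assms by simp
  with noise have "centered_gaussian M (\<lambda>\<omega>. \<Sum>A'\<in>{A}. (1::real) * B A' \<omega>)"
    unfolding gaussian_white_noise_def by (auto dest!: conjunct1 spec[of _ "{A}"] spec[of _ "\<lambda>_. 1"])
  then have "centered_gaussian M (\<lambda>\<omega>. B A \<omega>)" by simp
  from centered_gaussian_moments[OF this]
  show "B A \<in> borel_measurable M" "integrable M (B A)" "integrable M (\<lambda>\<omega>. (B A \<omega>)\<^sup>2)" "expectation (B A) = 0"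
    by auto
qed

lemma noise_product:
  assumes "A \<in> finite_sets m" "A' \<in> finite_sets m"
  shows "integrable M (\<lambda>\<omega>. B A \<omega> * B A' \<omega>)" "expectation (\<lambda>\<omega>. B A \<omega> * B A' \<omega>) = measure m (A \<inter> A')"
  using noise assms unfolding gaussian_white_noise_def
  by (auto intro!: integrable_mult_of_squares noise_moments)

text \<open>White noise is additive although it is not assumed to be a measure: the covariances
  determine the second moment of the defect, and it is zero.\<close>

lemma noise_Un:
  assumes C: "C \<in> finite_sets m" and D: "D \<in> finite_sets m" and disj: "C \<inter> D = {}"
  shows "C \<union> D \<in> finite_sets m" "AE \<omega> in M. B (C \<union> D) \<omega> = B C \<omega> + B D \<omega>"
proof -
  have m: "measure m (C \<union> D) = measure m C + measure m D"
    using C D disj by (intro measure_Union) (auto simp: finite_sets_def)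
  show U: "C \<union> D \<in> finite_sets m"
    using C D emeasure_subadditive[of C m D] unfolding finite_sets_def
    by (auto simp: ennreal_add_less_top intro: le_less_trans)
  note [measurable] = noise_moments(1)[OF C] noise_moments(1)[OF D] noise_moments(1)[OF U]
  note int = noise_product[OF C C] noise_product[OF D D] noise_product[OF U U]
    noise_product[OF C D] noise_product[OF U C] noise_product[OF U D]
  have sq: "(\<lambda>\<omega>. (B (C \<union> D) \<omega> - (B C \<omega> + B D \<omega>))\<^sup>2) =
    (\<lambda>\<omega>. B (C \<union> D) \<omega> * B (C \<union> D) \<omega> + B C \<omega> * B C \<omega> + B D \<omega> * B D \<omega>
      + 2 * (B C \<omega> * B D \<omega>) - 2 * (B (C \<union> D) \<omega> * B C \<omega>) - 2 * (B (C \<union> D) \<omega> * B D \<omega>))"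
    by (simp add: power2_eq_square algebra_simps)
  have i: "integrable M (\<lambda>\<omega>. (B (C \<union> D) \<omega> - (B C \<omega> + B D \<omega>))\<^sup>2)"
    unfolding sq using int by (intro Bochner_Integration.integrable_add Bochner_Integration.integrable_diff integrable_mult_right)
  have "expectation (\<lambda>\<omega>. (B (C \<union> D) \<omega> - (B C \<omega> + B D \<omega>))\<^sup>2) = 0"
    unfolding sq using int disj m by (simp add: Int_absorb1 Int_absorb2)
  then have "AE \<omega> in M. (B (C \<union> D) \<omega> - (B C \<omega> + B D \<omega>))\<^sup>2 = 0"
    by (subst (asm) integral_nonneg_eq_0_iff_AE[OF i]) auto
  then show "AE \<omega> in M. B (C \<union> D) \<omega> = B C \<omega> + B D \<omega>" by eventually_elim simp
qed

end

lemma integrable_bounded_mult: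
  fixes f g :: "'b \<Rightarrow> real"
  assumes g: "integrable M g" and [measurable]: "f \<in> borel_measurable M"
    and b: "\<And>x. x \<in> space M \<Longrightarrow> \<bar>f x\<bar> \<le> c"
  shows "integrable M (\<lambda>x. f x * g x)"
proof (rule Bochner_Integration.integrable_bound)
  show "integrable M (\<lambda>x. c * g x)" using g by simp
  show "AE x in M. norm (f x * g x) \<le> norm (c * g x)"
    by (intro AE_I2) (auto simp: abs_mult intro!: mult_right_mono order_trans[OF b])
qed (use g in measurable)

section \<open>The Ito isometry for simple integrands\<close>

locale ito_noise = white_noise M "control_measure \<rho>" B
  for M :: "'a measure" and \<rho> :: "real measure" and B :: "(real \<times> real) set \<Rightarrow> 'a \<Rightarrow> real" +
  fixes F :: "real \<Rightarrow> 'a measure"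
  assumes rho: "prob_on_positive_reals \<rho>"
    and filtration: "complete_filtration M F"
    and past: "\<And>t A. A \<in> finite_sets (control_measure \<rho>) \<Longrightarrow> A \<subseteq> UNIV \<times> {..t} \<Longrightarrow> B A \<in> borel_measurable (F t)"
    and future: "\<And>t. indep_set (sets (F t))
      (gen_events M B {A \<in> finite_sets (control_measure \<rho>). A \<subseteq> UNIV \<times> {t<..}})"
begin

abbreviation "ctrl \<equiv> control_measure \<rho>"

sublocale rho: prob_space \<rho>
  using rho by (simp add: prob_on_positive_reals_def)

sublocale ctrl: sigma_finite_measure ctrl
  unfolding control_measure_def by (intro sigma_finite_pair_measure) (rule rho.sigma_finite_measure_axioms, rule sigma_finite_lborel)

sublocale ctrl_M: pair_sigma_finite ctrl M ..

lemma space_F [simp]: "space (F t) = space M"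
  using filtration by (simp add: complete_filtration_def filtration_def)

lemma measurable_F_mono: "s \<le> t \<Longrightarrow> f \<in> borel_measurable (F s) \<Longrightarrow> f \<in> borel_measurable (F t)"
  using filtration unfolding complete_filtration_def filtration_def measurable_def by auto

lemma measurable_F: "f \<in> borel_measurable (F t) \<Longrightarrow> f \<in> borel_measurable M"
  using filtration unfolding complete_filtration_def measurable_def by auto

lemma cell_finite:
  assumes "A \<in> sets \<rho>" shows "A \<times> {a<..b} \<in> finite_sets ctrl"
proof (cases "a \<le> b")
  case True
  then show ?thesis
    using assms rho.emeasure_finite[of A] unfolding finite_sets_def control_measure_def
    by (simp add: lborel.emeasure_pair_measure_Times less_top[symmetric] ennreal_mult_eq_top_iff)
qed (simp add: finite_sets_def)

text \<open>Noise on the future of \<open>t\<close> is independent of \<^term>\<open>F t\<close>; the third claim applies this to the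
  product of two noise values.\<close>

lemma expectation_past_future:
  assumes "X \<in> borel_measurable (F t)" "integrable M X"
    and D: "D \<in> finite_sets ctrl" "D \<subseteq> UNIV \<times> {t<..}"
  shows "integrable M (\<lambda>\<omega>. X \<omega> * B D \<omega>)" "expectation (\<lambda>\<omega>. X \<omega> * B D \<omega>) = 0"
    and "D' \<in> finite_sets ctrl \<Longrightarrow> D' \<subseteq> UNIV \<times> {t<..} \<Longrightarrow>
      expectation (\<lambda>\<omega>. X \<omega> * (B D \<omega> * B D' \<omega>)) = expectation X * measure ctrl (D \<inter> D')"
proof -
  let ?I = "{A \<in> finite_sets ctrl. A \<subseteq> UNIV \<times> {t<..}}"
  let ?G = "sigma (space M) (gen_events M B ?I)"
  have G: "sets ?G = gen_events M B ?I"
    using sigma_algebra_gen_events[of M B ?I] by (simp add: sigma_algebra.sets_measure_of_eq)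
  have sF: "sigma_algebra (space M) (sets (F t))" using sets.sigma_algebra_axioms[of "F t"] by simp
  have XF: "X -` S \<inter> space M \<in> sets (F t)" if "S \<in> sets borel" for S
    using measurable_sets[OF assms(1) that] by simp
  have BG: "B E \<in> borel_measurable ?G" if "E \<in> ?I" for E
    using gen_eventsI[OF that, of _ B M] by (intro measurableI) (auto simp: G space_measure_of_conv)
  have sp: "space ?G = space M" by (simp add: space_measure_of_conv)
  have gen: "Z -` S \<inter> space M \<in> gen_events M B ?I" if "Z \<in> borel_measurable ?G" "S \<in> sets borel" for Z :: "'a \<Rightarrow> real" and S
    using measurable_sets[OF that] unfolding G sp .
  have ind: "integrable M (\<lambda>\<omega>. X \<omega> * Z \<omega>)" "expectation (\<lambda>\<omega>. X \<omega> * Z \<omega>) = expectation X * expectation Z"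
    if "Z \<in> borel_measurable ?G" "integrable M Z" for Z
    by (rule indep_set_expectation_mult[OF future[of t] sF _ sigma_algebra_gen_events _ assms(2) that(2)];
        intro XF gen that; assumption)+
  have 1: "B D \<in> borel_measurable ?G" using D by (intro BG) simp
  show "integrable M (\<lambda>\<omega>. X \<omega> * B D \<omega>)" "expectation (\<lambda>\<omega>. X \<omega> * B D \<omega>) = 0"
    using ind[OF 1 noise_moments(2)[OF D(1)]] noise_moments(4)[OF D(1)] by auto
  assume D': "D' \<in> finite_sets ctrl" "D' \<subseteq> UNIV \<times> {t<..}"
  then have "B D' \<in> borel_measurable ?G" by (intro BG) simp
  with 1 have "(\<lambda>\<omega>. B D \<omega> * B D' \<omega>) \<in> borel_measurable ?G" by simp
  from ind(2)[OF this noise_product(1)[OF D(1) D'(1)]]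
  show "expectation (\<lambda>\<omega>. X \<omega> * (B D \<omega> * B D' \<omega>)) = expectation X * measure ctrl (D \<inter> D')"
    by (simp add: noise_product(2)[OF D(1) D'(1)])
qed

text \<open>The part of the first cell up to time \<open>a'\<close> and both coefficients are known at time \<open>a'\<close>,
  so they are orthogonal to the noise on the second cell. The rest of the first cell lies in the future of \<open>a'\<close>,
  where the noise is independent of the coefficients and its covariance is the measure of the overlap.\<close>

lemma isometry_cells_ordered:
  assumes xi: "\<xi> \<in> borel_measurable (F a)" "\<And>\<omega>. \<omega> \<in> space M \<Longrightarrow> \<bar>\<xi> \<omega>\<bar> \<le> c"
    and xi': "\<xi>' \<in> borel_measurable (F a')" "\<And>\<omega>. \<omega> \<in> space M \<Longrightarrow> \<bar>\<xi>' \<omega>\<bar> \<le> c'"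
    and A: "A \<in> sets \<rho>" "A' \<in> sets \<rho>" and aa': "a \<le> a'"
  shows "expectation (\<lambda>\<omega>. (\<xi> \<omega> * B (A \<times> {a<..b}) \<omega>) * (\<xi>' \<omega> * B (A' \<times> {a'<..b'}) \<omega>)) =
    expectation (\<lambda>\<omega>. \<xi> \<omega> * \<xi>' \<omega>) * measure ctrl ((A \<times> {a<..b}) \<inter> (A' \<times> {a'<..b'}))"
proof -
  let ?C = "A \<times> {a<..min a' b}" and ?D = "A \<times> {max a a'<..b}" and ?C' = "A' \<times> {a'<..b'}"
  have fin: "?C \<in> finite_sets ctrl" "?D \<in> finite_sets ctrl" "?C' \<in> finite_sets ctrl"
    using A by (auto intro: cell_finite)
  have un: "A \<times> {a<..b} = ?C \<union> ?D" and disj: "?C \<inter> ?D = {}" using aa' by auto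
  have "?C' \<inter> ?C = {}" by auto
  then have cap: "(A \<times> {a<..b}) \<inter> ?C' = ?D \<inter> ?C'" unfolding un by auto
  have [measurable]: "\<xi> \<in> borel_measurable M" "\<xi>' \<in> borel_measurable M"
    "\<xi> \<in> borel_measurable (F a')" "\<xi>' \<in> borel_measurable (F a')"
    using xi xi' aa' by (auto intro: measurable_F measurable_F_mono)
  have [measurable]: "B ?C \<in> borel_measurable (F a')"
    using fin by (intro past) auto
  note [measurable] = noise_moments(1)[OF fin(1)] noise_moments(1)[OF fin(2)] noise_moments(1)[OF fin(3)]
  have [measurable]: "B (A \<times> {a<..b}) \<in> borel_measurable M" using A by (intro noise_moments cell_finite)
  have bd: "\<bar>\<xi> \<omega> * \<xi>' \<omega>\<bar> \<le> c * c'" if "\<omega> \<in> space M" for \<omega>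
    unfolding abs_mult using xi(2)[OF that] xi'(2)[OF that] by (intro mult_mono) auto
  have X: "integrable M (\<lambda>\<omega>. \<xi> \<omega> * \<xi>' \<omega>)"
    using bd by (intro integrable_const_bound[of _ "c * c'"]) auto
  have XC: "integrable M (\<lambda>\<omega>. (\<xi> \<omega> * \<xi>' \<omega>) * B ?C \<omega>)"
    using bd by (intro integrable_bounded_mult noise_moments fin) auto
  have XCC: "integrable M (\<lambda>\<omega>. ((\<xi> \<omega> * \<xi>' \<omega>) * B ?C \<omega>) * B ?C' \<omega>)"
    unfolding mult.assoc[of "_ * _"] using bd by (intro integrable_bounded_mult noise_product fin) auto
  have XDC: "integrable M (\<lambda>\<omega>. (\<xi> \<omega> * \<xi>' \<omega>) * (B ?D \<omega> * B ?C' \<omega>))"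
    using bd by (intro integrable_bounded_mult noise_product fin) auto
  have "expectation (\<lambda>\<omega>. (\<xi> \<omega> * B (A \<times> {a<..b}) \<omega>) * (\<xi>' \<omega> * B ?C' \<omega>)) =
    expectation (\<lambda>\<omega>. ((\<xi> \<omega> * \<xi>' \<omega>) * B ?C \<omega>) * B ?C' \<omega> + (\<xi> \<omega> * \<xi>' \<omega>) * (B ?D \<omega> * B ?C' \<omega>))"
  proof (rule integral_cong_AE)
    show "AE \<omega> in M. (\<xi> \<omega> * B (A \<times> {a<..b}) \<omega>) * (\<xi>' \<omega> * B ?C' \<omega>) =
       ((\<xi> \<omega> * \<xi>' \<omega>) * B ?C \<omega>) * B ?C' \<omega> + (\<xi> \<omega> * \<xi>' \<omega>) * (B ?D \<omega> * B ?C' \<omega>)"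
      using noise_Un(2)[OF fin(1,2) disj] unfolding un[symmetric]
      by eventually_elim (simp add: algebra_simps)
  qed measurable
  also have "\<dots> = expectation (\<lambda>\<omega>. ((\<xi> \<omega> * \<xi>' \<omega>) * B ?C \<omega>) * B ?C' \<omega>) +
     expectation (\<lambda>\<omega>. (\<xi> \<omega> * \<xi>' \<omega>) * (B ?D \<omega> * B ?C' \<omega>))"
    using XCC XDC by (rule Bochner_Integration.integral_add)
  also have "expectation (\<lambda>\<omega>. ((\<xi> \<omega> * \<xi>' \<omega>) * B ?C \<omega>) * B ?C' \<omega>) = 0"
    using XC fin by (intro expectation_past_future(2)[of _ a']) auto
  also have "expectation (\<lambda>\<omega>. (\<xi> \<omega> * \<xi>' \<omega>) * (B ?D \<omega> * B ?C' \<omega>)) =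
     expectation (\<lambda>\<omega>. \<xi> \<omega> * \<xi>' \<omega>) * measure ctrl (?D \<inter> ?C')"
    using X fin by (intro expectation_past_future(3)[of _ a']) auto
  finally show ?thesis by (simp add: cap)
qed

lemma isometry_cells:
  assumes xi: "\<xi> \<in> borel_measurable (F a)" "\<And>\<omega>. \<omega> \<in> space M \<Longrightarrow> \<bar>\<xi> \<omega>\<bar> \<le> c"
    and xi': "\<xi>' \<in> borel_measurable (F a')" "\<And>\<omega>. \<omega> \<in> space M \<Longrightarrow> \<bar>\<xi>' \<omega>\<bar> \<le> c'"
    and A: "A \<in> sets \<rho>" "A' \<in> sets \<rho>"
  shows "integrable M (\<lambda>\<omega>. (\<xi> \<omega> * B (A \<times> {a<..b}) \<omega>) * (\<xi>' \<omega> * B (A' \<times> {a'<..b'}) \<omega>))"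
    "expectation (\<lambda>\<omega>. (\<xi> \<omega> * B (A \<times> {a<..b}) \<omega>) * (\<xi>' \<omega> * B (A' \<times> {a'<..b'}) \<omega>)) =
    expectation (\<lambda>\<omega>. \<xi> \<omega> * \<xi>' \<omega>) * measure ctrl ((A \<times> {a<..b}) \<inter> (A' \<times> {a'<..b'}))"
proof -
  have [measurable]: "\<xi> \<in> borel_measurable M" "\<xi>' \<in> borel_measurable M"
    using xi xi' by (auto intro: measurable_F)
  have bd: "\<bar>\<xi> \<omega> * \<xi>' \<omega>\<bar> \<le> c * c'" if "\<omega> \<in> space M" for \<omega>
    unfolding abs_mult using xi(2)[OF that] xi'(2)[OF that] by (intro mult_mono) auto
  have "integrable M (\<lambda>\<omega>. (\<xi> \<omega> * \<xi>' \<omega>) * (B (A \<times> {a<..b}) \<omega> * B (A' \<times> {a'<..b'}) \<omega>))"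
    using bd A by (intro integrable_bounded_mult noise_product cell_finite) auto
  then show "integrable M (\<lambda>\<omega>. (\<xi> \<omega> * B (A \<times> {a<..b}) \<omega>) * (\<xi>' \<omega> * B (A' \<times> {a'<..b'}) \<omega>))"
    by (simp add: mult_ac)
  show "expectation (\<lambda>\<omega>. (\<xi> \<omega> * B (A \<times> {a<..b}) \<omega>) * (\<xi>' \<omega> * B (A' \<times> {a'<..b'}) \<omega>)) =
    expectation (\<lambda>\<omega>. \<xi> \<omega> * \<xi>' \<omega>) * measure ctrl ((A \<times> {a<..b}) \<inter> (A' \<times> {a'<..b'}))"
  proof (cases "a \<le> a'")
    case True
    show ?thesis by (rule isometry_cells_ordered[OF xi xi' A True])
  next
    case False
    then have "a' \<le> a" by simp
    from isometry_cells_ordered[OF xi' xi A(2,1) this, of b' b]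
    show ?thesis by (simp only: mult.commute Int_commute)
  qed
qed

text \<open>The cells of a simple integrand may overlap, so the isometry is obtained by expanding both squares
  into double sums and comparing them term by term.\<close>

lemma simple_isometry:
  assumes "simple_ito_integral M F \<rho> B \<phi> J"
  shows "J \<in> borel_measurable M" "integrable M (\<lambda>\<omega>. (J \<omega>)\<^sup>2)"
    and "case_prod \<phi> \<in> borel_measurable (ctrl \<Otimes>\<^sub>M M)"
    and "l2 M J = l2 (completion (ctrl \<Otimes>\<^sub>M M)) (case_prod \<phi>)"
proof -
  obtain n :: nat and \<xi> A a b where
    xi: "\<And>i. i < n \<Longrightarrow> \<xi> i \<in> borel_measurable (F (a i))" "\<And>i. i < n \<Longrightarrow> \<exists>c. \<forall>\<omega>\<in>space M. \<bar>\<xi> i \<omega>\<bar> \<le> c"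
    and A: "\<And>i. i < n \<Longrightarrow> A i \<in> sets \<rho>"
    and phi: "\<phi> = (\<lambda>(R, s) \<omega>. \<Sum>i<n. \<xi> i \<omega> * indicator (A i) R * indicator {a i<..b i} s)"
    and J: "J = (\<lambda>\<omega>. \<Sum>i<n. \<xi> i \<omega> * B (A i \<times> {a i<..b i}) \<omega>)"
    using assms unfolding simple_ito_integral_def by blast
  obtain c where c: "\<And>i \<omega>. i < n \<Longrightarrow> \<omega> \<in> space M \<Longrightarrow> \<bar>\<xi> i \<omega>\<bar> \<le> c i"
    using xi(2) by metis
  define C where "C i = A i \<times> {a i<..b i}" for i
  have C: "i < n \<Longrightarrow> C i \<in> finite_sets ctrl" for i unfolding C_def using A by (intro cell_finite)
  have Cs[measurable]: "i < n \<Longrightarrow> C i \<in> sets ctrl" for i using C by (auto simp: finite_sets_def)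
  have xM[measurable]: "i < n \<Longrightarrow> \<xi> i \<in> borel_measurable M" for i using xi by (auto intro: measurable_F)
  have BM[measurable]: "i < n \<Longrightarrow> B (C i) \<in> borel_measurable M" for i using C noise_moments by auto
  have phi': "\<phi> x \<omega> = (\<Sum>i<n. \<xi> i \<omega> * indicator (C i) x)" for x \<omega>
    unfolding phi C_def by (cases x) (auto simp: indicator_def intro!: sum.cong)
  show JM[measurable]: "J \<in> borel_measurable M" unfolding J C_def[symmetric] by (intro borel_measurable_sum) simp
  have phim: "(\<lambda>p. \<Sum>i<n. \<xi> i (snd p) * indicator (C i) (fst p)) \<in> borel_measurable (ctrl \<Otimes>\<^sub>M M)"
    by (intro borel_measurable_sum) simp
  then show "case_prod \<phi> \<in> borel_measurable (ctrl \<Otimes>\<^sub>M M)"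
    by (simp add: phi' case_prod_beta' cong: measurable_cong)
  let ?e = "\<lambda>i j. expectation (\<lambda>\<omega>. \<xi> i \<omega> * \<xi> j \<omega>)"
  let ?m = "\<lambda>i j. measure ctrl (C i \<inter> C j)"
  have Jsq: "(J \<omega>)\<^sup>2 = (\<Sum>i<n. \<Sum>j<n. (\<xi> i \<omega> * B (C i) \<omega>) * (\<xi> j \<omega> * B (C j) \<omega>))" for \<omega>
    unfolding J C_def[symmetric] by (simp add: power2_eq_square sum_product)
  have iso1: "integrable M (\<lambda>\<omega>. (\<xi> i \<omega> * B (C i) \<omega>) * (\<xi> j \<omega> * B (C j) \<omega>))" if "i < n" "j < n" for i j
    unfolding C_def using that by (intro isometry_cells(1)[of _ _ "c i" _ _ "c j"] xi(1) A c)
  have iso2: "expectation (\<lambda>\<omega>. (\<xi> i \<omega> * B (C i) \<omega>) * (\<xi> j \<omega> * B (C j) \<omega>)) = ?e i j * ?m i j" if "i < n" "j < n" for i j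
    unfolding C_def using that by (intro isometry_cells(2)[of _ _ "c i" _ _ "c j"] xi(1) A c)
  show J2: "integrable M (\<lambda>\<omega>. (J \<omega>)\<^sup>2)"
    unfolding Jsq by (intro Bochner_Integration.integrable_sum iso1) auto
  have "expectation (\<lambda>\<omega>. (J \<omega>)\<^sup>2) = (\<Sum>i<n. \<Sum>j<n. ?e i j * ?m i j)"
  proof -
    have "expectation (\<lambda>\<omega>. (J \<omega>)\<^sup>2) = (\<Sum>i<n. expectation (\<lambda>\<omega>. \<Sum>j<n. (\<xi> i \<omega> * B (C i) \<omega>) * (\<xi> j \<omega> * B (C j) \<omega>)))"
      unfolding Jsq by (intro Bochner_Integration.integral_sum Bochner_Integration.integrable_sum iso1) auto
    also have "\<dots> = (\<Sum>i<n. \<Sum>j<n. expectation (\<lambda>\<omega>. (\<xi> i \<omega> * B (C i) \<omega>) * (\<xi> j \<omega> * B (C j) \<omega>)))"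
      by (intro sum.cong refl Bochner_Integration.integral_sum iso1) auto
    finally show ?thesis by (simp add: iso2)
  qed
  then have L: "l2 M J = ennreal (\<Sum>i<n. \<Sum>j<n. ?e i j * ?m i j)"
    by (simp add: l2_eq_integral[OF J2])
  define g where "g x = (\<Sum>i<n. \<Sum>j<n. ?e i j * indicator (C i \<inter> C j) x)" for x
  have xx: "integrable M (\<lambda>\<omega>. \<xi> i \<omega> * \<xi> j \<omega>)" if "i < n" "j < n" for i j
  proof (rule integrable_const_bound[of _ "c i * c j"])
    show "AE \<omega> in M. norm (\<xi> i \<omega> * \<xi> j \<omega>) \<le> c i * c j"
    proof (intro AE_I2)
      fix \<omega> assume "\<omega> \<in> space M"
      then show "norm (\<xi> i \<omega> * \<xi> j \<omega>) \<le> c i * c j"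
        using c[OF that(1), of \<omega>] c[OF that(2), of \<omega>] by (simp add: abs_mult mult_mono)
    qed
  qed (use that in measurable)
  have gx: "integrable M (\<lambda>\<omega>. (\<phi> x \<omega>)\<^sup>2)" "g x = expectation (\<lambda>\<omega>. (\<phi> x \<omega>)\<^sup>2)" for x
  proof -
    have sq: "(\<phi> x \<omega>)\<^sup>2 = (\<Sum>i<n. \<Sum>j<n. (\<xi> i \<omega> * \<xi> j \<omega>) * indicator (C i \<inter> C j) x)" for \<omega>
      unfolding phi' by (simp only: power2_eq_square sum_product indicator_inter_arith mult_ac)
    show "integrable M (\<lambda>\<omega>. (\<phi> x \<omega>)\<^sup>2)"
      unfolding sq using xx by (intro Bochner_Integration.integrable_sum integrable_mult_left) auto
    show "g x = expectation (\<lambda>\<omega>. (\<phi> x \<omega>)\<^sup>2)"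
    proof -
      have "expectation (\<lambda>\<omega>. (\<phi> x \<omega>)\<^sup>2) = (\<Sum>i<n. expectation (\<lambda>\<omega>. \<Sum>j<n. (\<xi> i \<omega> * \<xi> j \<omega>) * indicator (C i \<inter> C j) x))"
        unfolding sq using xx
        by (intro Bochner_Integration.integral_sum Bochner_Integration.integrable_sum integrable_mult_left) auto
      also have "\<dots> = (\<Sum>i<n. \<Sum>j<n. expectation (\<lambda>\<omega>. (\<xi> i \<omega> * \<xi> j \<omega>) * indicator (C i \<inter> C j) x))"
        using xx by (intro sum.cong refl Bochner_Integration.integral_sum integrable_mult_left) auto
      finally show ?thesis by (simp only: g_def integral_mult_left_zero)
    qed
  qed
  have gint: "integrable ctrl (\<lambda>x. indicator (C i \<inter> C j) x :: real)" if "i < n" "j < n" for i j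
    using C[OF that(1)] C[OF that(2)] emeasure_mono[of "C i \<inter> C j" "C i" ctrl]
    by (intro integrable_real_indicator) (auto simp: finite_sets_def)
  have "l2 (completion (ctrl \<Otimes>\<^sub>M M)) (case_prod \<phi>) = (\<integral>\<^sup>+p. ennreal ((case_prod \<phi> p)\<^sup>2) \<partial>(ctrl \<Otimes>\<^sub>M M))"
    by (simp add: l2_def nn_integral_completion)
  also have "\<dots> = (\<integral>\<^sup>+x. \<integral>\<^sup>+\<omega>. ennreal ((\<phi> x \<omega>)\<^sup>2) \<partial>M \<partial>ctrl)"
    using \<open>case_prod \<phi> \<in> borel_measurable (ctrl \<Otimes>\<^sub>M M)\<close> by (subst nn_integral_fst[symmetric]) auto
  also have "\<dots> = (\<integral>\<^sup>+x. ennreal (g x) \<partial>ctrl)"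
    using gx by (intro nn_integral_cong) (simp add: nn_integral_eq_integral)
  also have "\<dots> = ennreal (\<integral>x. g x \<partial>ctrl)"
  proof (rule nn_integral_eq_integral)
    show "integrable ctrl g"
      unfolding g_def using gint by (intro Bochner_Integration.integrable_sum integrable_mult_right) auto
  qed (simp add: gx)
  also have "(\<integral>x. g x \<partial>ctrl) = (\<Sum>i<n. \<Sum>j<n. ?e i j * ?m i j)"
  proof -
    have "(\<integral>x. g x \<partial>ctrl) = (\<Sum>i<n. \<integral>x. (\<Sum>j<n. ?e i j * indicator (C i \<inter> C j) x) \<partial>ctrl)"
      unfolding g_def using gint
      by (intro Bochner_Integration.integral_sum Bochner_Integration.integrable_sum integrable_mult_right) auto
    also have "\<dots> = (\<Sum>i<n. \<Sum>j<n. \<integral>x. ?e i j * indicator (C i \<inter> C j) x \<partial>ctrl)"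
      using gint by (intro sum.cong refl Bochner_Integration.integral_sum integrable_mult_right) auto
    finally show ?thesis
      using Cs by (simp only: integral_mult_right_zero) (intro sum.cong refl, simp add: sets.Int sets.sets_into_space Int_absorb2)
  qed
  finally show "l2 M J = l2 (completion (ctrl \<Otimes>\<^sub>M M)) (case_prod \<phi>)" by (simp add: L)
qed

lemma simple_add:
  assumes "simple_ito_integral M F \<rho> B \<phi> J" "simple_ito_integral M F \<rho> B \<phi>' J'"
  shows "simple_ito_integral M F \<rho> B (\<lambda>x \<omega>. \<phi> x \<omega> + \<phi>' x \<omega>) (\<lambda>\<omega>. J \<omega> + J' \<omega>)"
proof -
  obtain n :: nat and \<xi> A a b where
    1: "\<forall>i<n. \<xi> i \<in> borel_measurable (F (a i)) \<and> (\<exists>c. \<forall>\<omega>\<in>space M. \<bar>\<xi> i \<omega>\<bar> \<le> c) \<and> A i \<in> sets \<rho> \<and> a i \<le> b i"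
    "\<phi> = (\<lambda>(R, s) \<omega>. \<Sum>i<n. \<xi> i \<omega> * indicator (A i) R * indicator {a i<..b i} s)"
    "J = (\<lambda>\<omega>. \<Sum>i<n. \<xi> i \<omega> * B (A i \<times> {a i<..b i}) \<omega>)"
    using assms(1) unfolding simple_ito_integral_def by blast
  obtain n' :: nat and \<xi>' A' a' b' where
    2: "\<forall>i<n'. \<xi>' i \<in> borel_measurable (F (a' i)) \<and> (\<exists>c. \<forall>\<omega>\<in>space M. \<bar>\<xi>' i \<omega>\<bar> \<le> c) \<and> A' i \<in> sets \<rho> \<and> a' i \<le> b' i"
    "\<phi>' = (\<lambda>(R, s) \<omega>. \<Sum>i<n'. \<xi>' i \<omega> * indicator (A' i) R * indicator {a' i<..b' i} s)"
    "J' = (\<lambda>\<omega>. \<Sum>i<n'. \<xi>' i \<omega> * B (A' i \<times> {a' i<..b' i}) \<omega>)"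
    using assms(2) unfolding simple_ito_integral_def by blast
  have sum: "(\<Sum>i<n + n'. if i < n then f i else g (i - n)) = (\<Sum>i<n. f i) + (\<Sum>i<n'. g i)" for f g :: "nat \<Rightarrow> real"
    by (induction n') auto
  let ?j = "\<lambda>f g i. if i < n then f i else g (i - n)"
  show ?thesis
    unfolding simple_ito_integral_def
  proof (intro exI conjI)
    show "\<forall>i<n + n'. ?j \<xi> \<xi>' i \<in> borel_measurable (F (?j a a' i)) \<and> (\<exists>c. \<forall>\<omega>\<in>space M. \<bar>?j \<xi> \<xi>' i \<omega>\<bar> \<le> c) \<and>
      ?j A A' i \<in> sets \<rho> \<and> ?j a a' i \<le> ?j b b' i"
      using 1(1) 2(1) by (auto simp: not_less)
    have *: "?j \<xi> \<xi>' i \<omega> * indicator (?j A A' i) R * indicator {?j a a' i<..?j b b' i} s =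
      ?j (\<lambda>i. \<xi> i \<omega> * indicator (A i) R * indicator {a i<..b i} s) (\<lambda>i. \<xi>' i \<omega> * indicator (A' i) R * indicator {a' i<..b' i} s) i" for i \<omega> R s
      by simp
    show "(\<lambda>x \<omega>. \<phi> x \<omega> + \<phi>' x \<omega>) = (\<lambda>(R, s) \<omega>. \<Sum>i<n + n'. ?j \<xi> \<xi>' i \<omega> * indicator (?j A A' i) R * indicator {?j a a' i<..?j b b' i} s)"
      unfolding 1(2) 2(2) by (rule ext, rule ext) (simp only: split_beta * sum[symmetric])
    have *: "?j \<xi> \<xi>' i \<omega> * B (?j A A' i \<times> {?j a a' i<..?j b b' i}) \<omega> =
      ?j (\<lambda>i. \<xi> i \<omega> * B (A i \<times> {a i<..b i}) \<omega>) (\<lambda>i. \<xi>' i \<omega> * B (A' i \<times> {a' i<..b' i}) \<omega>) i" for i \<omega>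
      by simp
    show "(\<lambda>\<omega>. J \<omega> + J' \<omega>) = (\<lambda>\<omega>. \<Sum>i<n + n'. ?j \<xi> \<xi>' i \<omega> * B (?j A A' i \<times> {?j a a' i<..?j b b' i}) \<omega>)"
      unfolding 1(3) 2(3) by (rule ext) (simp only: * sum[symmetric])
  qed
qed

lemma simple_uminus:
  assumes "simple_ito_integral M F \<rho> B \<phi> J"
  shows "simple_ito_integral M F \<rho> B (\<lambda>x \<omega>. - \<phi> x \<omega>) (\<lambda>\<omega>. - J \<omega>)"
proof -
  obtain n :: nat and \<xi> A a b where
    1: "\<forall>i<n. \<xi> i \<in> borel_measurable (F (a i)) \<and> (\<exists>c. \<forall>\<omega>\<in>space M. \<bar>\<xi> i \<omega>\<bar> \<le> c) \<and> A i \<in> sets \<rho> \<and> a i \<le> b i"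
    "\<phi> = (\<lambda>(R, s) \<omega>. \<Sum>i<n. \<xi> i \<omega> * indicator (A i) R * indicator {a i<..b i} s)"
    "J = (\<lambda>\<omega>. \<Sum>i<n. \<xi> i \<omega> * B (A i \<times> {a i<..b i}) \<omega>)"
    using assms(1) unfolding simple_ito_integral_def by blast
  show ?thesis
    unfolding simple_ito_integral_def
  proof (intro exI conjI)
    show "\<forall>i<n. (\<lambda>\<omega>. - \<xi> i \<omega>) \<in> borel_measurable (F (a i)) \<and> (\<exists>c. \<forall>\<omega>\<in>space M. \<bar>- \<xi> i \<omega>\<bar> \<le> c) \<and> A i \<in> sets \<rho> \<and> a i \<le> b i"
      using 1(1) by auto
  qed (auto simp: 1 fun_eq_iff sum_negf)
qed

lemma simple_diff:
  assumes "simple_ito_integral M F \<rho> B \<phi> J" "simple_ito_integral M F \<rho> B \<phi>' J'"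
  shows "simple_ito_integral M F \<rho> B (\<lambda>x \<omega>. \<phi> x \<omega> - \<phi>' x \<omega>) (\<lambda>\<omega>. J \<omega> - J' \<omega>)"
  using simple_add[OF assms(1) simple_uminus[OF assms(2)]] by simp

lemma simple_isometry_diff:
  assumes "simple_ito_integral M F \<rho> B \<phi> J" "simple_ito_integral M F \<rho> B \<phi>' J'"
  shows "l2 M (\<lambda>\<omega>. J \<omega> - J' \<omega>) = l2 (completion (ctrl \<Otimes>\<^sub>M M)) (\<lambda>p. case_prod \<phi> p - case_prod \<phi>' p)"
  using simple_isometry(4)[OF simple_diff[OF assms]] by (simp add: case_prod_beta')

end

section \<open>The Ito integral as a limit in the square mean\<close>

context ito_noise
begin

abbreviation "Q \<equiv> completion (ctrl \<Otimes>\<^sub>M M)"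

text \<open>One approximating sequence suffices: a fast subsequence yields a limit, so an integral
  exists and the chosen version is one. Two approximating sequences of the same integrand approach
  each other, by the isometry, and thus the given sequence also converges to the chosen version.\<close>

lemma ito_integral_of_approximation:
  assumes phi[measurable]: "case_prod \<phi> \<in> borel_measurable Q"
    and simple: "\<And>n. simple_ito_integral M F \<rho> B (\<Phi> n) (I n)"
    and lim: "(\<lambda>n. l2 Q (\<lambda>p. case_prod (\<Phi> n) p - case_prod \<phi> p)) \<longlonglongrightarrow> 0"
  defines "J \<equiv> ito_integral M F \<rho> B \<phi>"
  shows "J \<in> borel_measurable M" "(\<lambda>n. l2 M (\<lambda>\<omega>. I n \<omega> - J \<omega>)) \<longlonglongrightarrow> 0"
    and "l2 M J = l2 Q (case_prod \<phi>)"
proof -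
  have sm: "case_prod \<psi> \<in> borel_measurable Q" "K \<in> borel_measurable M" if "simple_ito_integral M F \<rho> B \<psi> K" for \<psi> K
    using simple_isometry[OF that] by (auto intro: measurable_completion)
  have l2_0: "(\<lambda>n. 2 * f n + 2 * g n) \<longlonglongrightarrow> 0" if "f \<longlonglongrightarrow> 0" "g \<longlonglongrightarrow> 0" for f g :: "nat \<Rightarrow> ennreal"
  proof -
    have "(\<lambda>n. 2 * f n + 2 * g n) \<longlonglongrightarrow> 2 * 0 + 2 * 0"
      using that by (intro tendsto_intros ennreal_tendsto_cmult) auto
    then show ?thesis by simp
  qed
  have "\<exists>k. l2 Q (\<lambda>p. case_prod (\<Phi> k) p - case_prod \<phi> p) \<le> ennreal (1 / 4 ^ n)" for n
  proof -
    have "eventually (\<lambda>k. l2 Q (\<lambda>p. case_prod (\<Phi> k) p - case_prod \<phi> p) < ennreal (1 / 4 ^ n)) sequentially"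
      using lim by (rule order_tendstoD) simp
    then obtain k where "l2 Q (\<lambda>p. case_prod (\<Phi> k) p - case_prod \<phi> p) < ennreal (1 / 4 ^ n)"
      using eventually_happens'[OF sequentially_bot] by blast
    then show ?thesis using less_imp_le by blast
  qed
  then obtain k where k: "\<And>n. l2 Q (\<lambda>p. case_prod (\<Phi> (k n)) p - case_prod \<phi> p) \<le> ennreal (1 / 4 ^ n)"
    by metis
  have "l2 M (\<lambda>\<omega>. I (k n) \<omega> - I (k (n + j)) \<omega>) \<le> ennreal (4 / 4 ^ n)" for n j
  proof -
    have "l2 M (\<lambda>\<omega>. I (k n) \<omega> - I (k (n + j)) \<omega>) = l2 Q (\<lambda>p. case_prod (\<Phi> (k n)) p - case_prod (\<Phi> (k (n + j))) p)"
      by (rule simple_isometry_diff[OF simple simple])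
    also have "\<dots> \<le> 2 * l2 Q (\<lambda>p. case_prod (\<Phi> (k n)) p - case_prod \<phi> p) + 2 * l2 Q (\<lambda>p. case_prod \<phi> p - case_prod (\<Phi> (k (n + j))) p)"
      by (intro l2_triangle sm[OF simple] phi)
    also have "\<dots> \<le> 2 * ennreal (1 / 4 ^ n) + 2 * ennreal (1 / 4 ^ (n + j))"
      by (subst (2) l2_diff_commute) (intro add_mono mult_left_mono k; simp)
    also have "\<dots> \<le> 2 * ennreal (1 / 4 ^ n) + 2 * ennreal (1 / 4 ^ n)"
      by (intro add_mono mult_left_mono ennreal_leI order_refl) (auto simp: power_add field_simps)
    also have "\<dots> = ennreal (4 / 4 ^ n)"
    proof -
      have "2 * ennreal x + 2 * ennreal x = ennreal (4 * x)" if "0 \<le> x" for x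
        using that by (simp add: ennreal_mult' flip: distrib_right)
      from this[of "1 / 4 ^ n"] show ?thesis by simp
    qed
    finally show ?thesis .
  qed
  then obtain J' where J'[measurable]: "J' \<in> borel_measurable M" and limJ': "(\<lambda>n. l2 M (\<lambda>\<omega>. I (k n) \<omega> - J' \<omega>)) \<longlonglongrightarrow> 0"
    using l2_complete_fast[of "\<lambda>n. I (k n)" 4] sm(2)[OF simple] by auto
  have "(\<lambda>n. ennreal (1 / 4 ^ n)) \<longlonglongrightarrow> ennreal 0"
    by (intro tendsto_ennrealI) real_asymp
  then have limk: "(\<lambda>n. l2 Q (\<lambda>p. case_prod (\<Phi> (k n)) p - case_prod \<phi> p)) \<longlonglongrightarrow> 0"
    using k tendsto_sandwich[of "\<lambda>_. 0" "\<lambda>n. l2 Q (\<lambda>p. case_prod (\<Phi> (k n)) p - case_prod \<phi> p)" sequentially "\<lambda>n. ennreal (1 / 4 ^ n)" 0]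
    by simp
  have "has_ito_integral M F \<rho> B \<phi> J'"
    unfolding has_ito_integral_def Let_def
  proof (intro conjI exI allI)
    show "simple_ito_integral M F \<rho> B (\<Phi> (k n)) (I (k n))" for n by (rule simple)
    show "(\<lambda>n. \<integral>\<^sup>+(x, \<omega>). ennreal ((\<Phi> (k n) x \<omega> - \<phi> x \<omega>)\<^sup>2) \<partial>Q) \<longlonglongrightarrow> 0"
      using limk by (simp add: l2_def case_prod_beta')
    show "(\<lambda>n. \<integral>\<^sup>+\<omega>. ennreal ((I (k n) \<omega> - J' \<omega>)\<^sup>2) \<partial>M) \<longlonglongrightarrow> 0"
      using limJ' by (simp add: l2_def)
  qed (use phi J' in simp_all)
  then have "has_ito_integral M F \<rho> B \<phi> J"
    unfolding J_def ito_integral_def by (rule someI[of "has_ito_integral M F \<rho> B \<phi>"])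
  then obtain \<Psi> K where JM: "J \<in> borel_measurable M" and K: "\<And>n. simple_ito_integral M F \<rho> B (\<Psi> n) (K n)"
    and limPsi: "(\<lambda>n. l2 Q (\<lambda>p. case_prod (\<Psi> n) p - case_prod \<phi> p)) \<longlonglongrightarrow> 0"
    and limK: "(\<lambda>n. l2 M (\<lambda>\<omega>. K n \<omega> - J \<omega>)) \<longlonglongrightarrow> 0"
    unfolding has_ito_integral_def Let_def l2_def by (auto simp: case_prod_beta')
  show JM[measurable]: "J \<in> borel_measurable M" by (rule JM)
  note [measurable] = sm[OF simple] sm[OF K]
  show limI: "(\<lambda>n. l2 M (\<lambda>\<omega>. I n \<omega> - J \<omega>)) \<longlonglongrightarrow> 0"
  proof (rule tendsto_sandwich[OF always_eventually always_eventually tendsto_const])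
    let ?b = "\<lambda>n. 2 * (2 * l2 Q (\<lambda>p. case_prod (\<Phi> n) p - case_prod \<phi> p) + 2 * l2 Q (\<lambda>p. case_prod (\<Psi> n) p - case_prod \<phi> p))
      + 2 * l2 M (\<lambda>\<omega>. K n \<omega> - J \<omega>)"
    show "?b \<longlonglongrightarrow> 0" by (intro l2_0 lim limPsi limK)
    show "\<forall>n. l2 M (\<lambda>\<omega>. I n \<omega> - J \<omega>) \<le> ?b n"
    proof
      fix n
      have "l2 M (\<lambda>\<omega>. I n \<omega> - J \<omega>) \<le> 2 * l2 M (\<lambda>\<omega>. I n \<omega> - K n \<omega>) + 2 * l2 M (\<lambda>\<omega>. K n \<omega> - J \<omega>)"
        by (rule l2_triangle) measurable
      also have "l2 M (\<lambda>\<omega>. I n \<omega> - K n \<omega>) = l2 Q (\<lambda>p. case_prod (\<Phi> n) p - case_prod (\<Psi> n) p)"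
        by (rule simple_isometry_diff[OF simple K])
      also have "\<dots> \<le> 2 * l2 Q (\<lambda>p. case_prod (\<Phi> n) p - case_prod \<phi> p) + 2 * l2 Q (\<lambda>p. case_prod \<phi> p - case_prod (\<Psi> n) p)"
        by (rule l2_triangle) measurable
      also have "l2 Q (\<lambda>p. case_prod \<phi> p - case_prod (\<Psi> n) p) = l2 Q (\<lambda>p. case_prod (\<Psi> n) p - case_prod \<phi> p)"
        by (rule l2_diff_commute)
      finally show "l2 M (\<lambda>\<omega>. I n \<omega> - J \<omega>) \<le> ?b n" by (simp add: add_right_mono mult_left_mono)
    qed
  qed simp
  show "l2 M J = l2 Q (case_prod \<phi>)"
  proof (rule antisym)
    show "l2 M J \<le> l2 Q (case_prod \<phi>)"
      using simple_isometry(4)[OF simple] by (intro l2_limit_mono[OF _ _ _ _ limI lim]) auto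
    show "l2 Q (case_prod \<phi>) \<le> l2 M J"
      using simple_isometry(4)[OF simple] by (intro l2_limit_mono[OF _ _ _ _ lim limI]) auto
  qed
qed

lemma simple_cell:
  assumes "\<xi> \<in> borel_measurable (F a)" "\<And>\<omega>. \<omega> \<in> space M \<Longrightarrow> \<bar>\<xi> \<omega>\<bar> \<le> c" "A \<in> sets \<rho>" "a \<le> b"
  shows "simple_ito_integral M F \<rho> B (\<lambda>(R, s) \<omega>. \<xi> \<omega> * indicator A R * indicator {a<..b} s) (\<lambda>\<omega>. \<xi> \<omega> * B (A \<times> {a<..b}) \<omega>)"
  unfolding simple_ito_integral_def
  by (rule exI[of _ 1], rule exI[of _ "\<lambda>_. \<xi>"], rule exI[of _ "\<lambda>_. A"], rule exI[of _ "\<lambda>_. a"], rule exI[of _ "\<lambda>_. b"])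
    (use assms in auto)

lemma simple_zero: "simple_ito_integral M F \<rho> B (\<lambda>_ _. 0) (\<lambda>_. 0)"
  unfolding simple_ito_integral_def
  by (rule exI[of _ 0]) (auto simp: fun_eq_iff)

lemma simple_sum:
  assumes "finite S" "\<And>i. i \<in> S \<Longrightarrow> simple_ito_integral M F \<rho> B (\<phi> i) (J i)"
  shows "simple_ito_integral M F \<rho> B (\<lambda>x \<omega>. \<Sum>i\<in>S. \<phi> i x \<omega>) (\<lambda>\<omega>. \<Sum>i\<in>S. J i \<omega>)"
  using assms
proof (induction S)
  case (insert i S)
  then show ?case using simple_add[of "\<phi> i" "J i" "\<lambda>x \<omega>. \<Sum>i\<in>S. \<phi> i x \<omega>"] by simp
qed (simp add: simple_zero)

end

section \<open>Moments of the superposed Ornstein--Uhlenbeck process\<close>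

lemma nn_integral_exp_atMost:
  fixes c s :: real
  assumes c: "0 < c"
  shows "(\<integral>\<^sup>+u. ennreal (indicator {..s} u * exp (- c * (s - u))) \<partial>lborel) = ennreal (1 / c)"
proof -
  interpret E: prob_space "density lborel (exponential_density c)"
    using c by (rule prob_space_exponential_density)
  have "(\<integral>\<^sup>+u. ennreal (indicator {..s} u * exp (- c * (s - u))) \<partial>lborel) =
     (\<integral>\<^sup>+u. ennreal (indicator {..s} (s + (-1) * u) * exp (- c * (s - (s + (-1) * u)))) \<partial>lborel)"
    by (subst nn_integral_real_affine[where c = "-1" and t = s]) auto
  \<comment> \<open>the reflection at \<open>s\<close> yields a multiple of the exponential density\<close>
  also have "\<dots> = (\<integral>\<^sup>+u. ennreal (1 / c) * ennreal (exponential_density c u) \<partial>lborel)"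
    using c by (intro nn_integral_cong) (auto simp: exponential_density_def indicator_def mult.commute simp flip: ennreal_mult')
  also have "\<dots> = ennreal (1 / c) * (\<integral>\<^sup>+u. ennreal (exponential_density c u) \<partial>lborel)"
    by (rule nn_integral_cmult) simp
  also have "(\<integral>\<^sup>+u. ennreal (exponential_density c u) \<partial>lborel) = 1"
    using E.emeasure_space_1 by (simp add: emeasure_density)
  finally show ?thesis by simp
qed

text \<open>The integrable function \<open>min 1 z\<close> is positive, hence its superlevel sets have finite measure and exhaust
  the space.\<close>

lemma sigma_finite_levy_measure:
  assumes "subordinator_levy_measure \<nu>"
  shows "sigma_finite_measure \<nu>"
proof (rule sigma_finite_measure.intro)
  have sets: "sets \<nu> = sets (restrict_space borel {0<..})" and int: "integrable \<nu> (\<lambda>z. min 1 z)"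
    using assms by (auto simp: subordinator_levy_measure_def)
  have sp: "space \<nu> = {0<..}" using sets_eq_imp_space_eq[OF sets] by (simp add: space_restrict_space)
  define S where "S n = {z \<in> space \<nu>. 1 / real (Suc n) \<le> min 1 z}" for n
  have [measurable]: "(\<lambda>z. min 1 z) \<in> borel_measurable \<nu>" using int by simp
  have Ss: "S n \<in> sets \<nu>" for n unfolding S_def by measurable
  have fin: "emeasure \<nu> (S n) < \<infinity>" for n
  proof -
    have "emeasure \<nu> (S n) = (\<integral>\<^sup>+z. indicator (S n) z \<partial>\<nu>)" using Ss by simp
    also have "\<dots> \<le> (\<integral>\<^sup>+z. ennreal (real (Suc n) * min 1 z) \<partial>\<nu>)"
    proof (rule nn_integral_mono)
      fix z assume "z \<in> space \<nu>"
      show "indicator (S n) z \<le> ennreal (real (Suc n) * min 1 z)"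
      proof (cases "z \<in> S n")
        case True
        then have "1 / real (Suc n) \<le> min 1 z" by (simp only: S_def mem_Collect_eq)
        then have "1 \<le> real (Suc n) * min 1 z"
          by (subst (asm) pos_divide_le_eq) (simp_all only: of_nat_0_less_iff zero_less_Suc mult.commute)
        with True show ?thesis by (simp add: ennreal_leI flip: ennreal_1)
      qed simp
    qed
    also have "\<dots> = ennreal (\<integral>z. real (Suc n) * min 1 z \<partial>\<nu>)"
      using int by (intro nn_integral_eq_integral integrable_mult_right AE_I2) (auto simp: sp)
    finally show ?thesis by (auto intro: le_less_trans)
  qed
  have "(\<Union>n. S n) = space \<nu>"
  proof (intro equalityI subsetI)
    fix z assume "z \<in> space \<nu>"
    then have "0 < min 1 z" by (simp add: sp)
    then obtain n where "1 / real (Suc n) < min 1 z" using nat_approx_posE by blast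
    then show "z \<in> (\<Union>n. S n)" using \<open>z \<in> space \<nu>\<close> by (auto simp: S_def intro!: exI[of _ n])
  qed (auto simp: S_def)
  then show "\<exists>A. countable A \<and> A \<subseteq> sets \<nu> \<and> \<Union>A = space \<nu> \<and> (\<forall>a\<in>A. emeasure \<nu> a \<noteq> \<infinity>)"
    using Ss fin by (intro exI[of _ "range S"]) (auto simp: less_top)
qed

locale supOU_model = prob_space M for M :: "'a measure" +
  fixes \<nu> \<pi> :: "real measure" and N :: "'a \<Rightarrow> (real \<times> real \<times> real) measure"
  assumes levy: "subordinator_levy_measure \<nu>"
    and levy_moments: "\<And>k::nat. k \<ge> 1 \<Longrightarrow> integrable \<nu> (\<lambda>z. z ^ k)"
    and pi: "prob_on_positive_reals \<pi>" and pi_inverse: "integrable \<pi> (\<lambda>r. 1 / r)"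
    and poisson: "poisson_random_measure M (jump_intensity \<nu> \<pi>) N"
begin

abbreviation "mN \<equiv> jump_intensity \<nu> \<pi>"

sublocale pi: prob_space \<pi>
  using pi by (simp add: prob_on_positive_reals_def)

sublocale nu: sigma_finite_measure \<nu>
  using levy by (rule sigma_finite_levy_measure)

sublocale nu_pi: pair_sigma_finite \<nu> \<pi> ..

sublocale marks: sigma_finite_measure "\<nu> \<Otimes>\<^sub>M \<pi>"
  by (rule nu_pi.sigma_finite_measure_axioms)

sublocale time_marks: pair_sigma_finite lborel "\<nu> \<Otimes>\<^sub>M \<pi>" ..

sublocale poisson_measure M mN N
proof (intro poisson_measure.intro prob_space_axioms poisson_measure_axioms.intro poisson)
  show "sigma_finite_measure mN"
    unfolding jump_intensity_def by (rule time_marks.sigma_finite_measure_axioms)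
qed

lemma sets_pi: "sets \<pi> = sets (restrict_space borel {0<..})" and space_pi: "space \<pi> = {0<..}"
  using pi sets_eq_imp_space_eq[of \<pi> "restrict_space borel {0<..}"]
  by (auto simp: prob_on_positive_reals_def space_restrict_space)

lemma sets_nu: "sets \<nu> = sets (restrict_space borel {0<..})" and space_nu: "space \<nu> = {0<..}"
  using levy sets_eq_imp_space_eq[of \<nu> "restrict_space borel {0<..}"]
  by (auto simp: subordinator_levy_measure_def space_restrict_space)

lemma ident_measurable [measurable]: "(\<lambda>r. r) \<in> borel_measurable \<pi>" "(\<lambda>z. z) \<in> borel_measurable \<nu>"
  unfolding measurable_cong_sets[OF sets_pi refl] measurable_cong_sets[OF sets_nu refl]
  by (auto intro: measurable_restrict_space1)

lemma jump_coordinates [measurable]: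
  "fst \<in> borel_measurable mN" "(\<lambda>x. fst (snd x)) \<in> borel_measurable mN" "(\<lambda>x. snd (snd x)) \<in> borel_measurable mN"
  "(\<lambda>x. (fst x, snd (snd x))) \<in> measurable mN (lborel \<Otimes>\<^sub>M \<pi>)"
  unfolding jump_intensity_def
  by (auto intro: measurable_compose[OF _ ident_measurable(1)] measurable_compose[OF _ ident_measurable(2)])

lemma space_mN: "space mN = UNIV \<times> {0<..} \<times> {0<..}"
  by (simp add: jump_intensity_def space_pair_measure space_pi space_nu)

definition "jump_moment k = (\<integral>z. z ^ k \<partial>\<nu>)"

lemma jump_moment_nonneg: "0 \<le> jump_moment k"
  unfolding jump_moment_def by (intro integral_nonneg_AE AE_I2) (simp add: space_nu)

text \<open>Jump sizes only enter through their moments; integrating over time before the reversion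
  rate is what makes every later integral explicit.\<close>

lemma nn_integral_jumps:
  assumes k: "k \<ge> 1" and [measurable]: "H \<in> borel_measurable (lborel \<Otimes>\<^sub>M \<pi>)"
  shows "(\<integral>\<^sup>+x. ennreal (fst (snd x) ^ k) * H (fst x, snd (snd x)) \<partial>mN) =
    ennreal (jump_moment k) * (\<integral>\<^sup>+r. \<integral>\<^sup>+u. H (u, r) \<partial>lborel \<partial>\<pi>)"
proof -
  have [measurable]: "(\<lambda>x. ennreal (fst (snd x) ^ k) * H (fst x, snd (snd x))) \<in> borel_measurable (lborel \<Otimes>\<^sub>M (\<nu> \<Otimes>\<^sub>M \<pi>))"
    unfolding jump_intensity_def[symmetric] by measurable
  have "(\<integral>\<^sup>+x. ennreal (fst (snd x) ^ k) * H (fst x, snd (snd x)) \<partial>mN) =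
    (\<integral>\<^sup>+y. \<integral>\<^sup>+u. ennreal (fst y ^ k) * H (u, snd y) \<partial>lborel \<partial>(\<nu> \<Otimes>\<^sub>M \<pi>))"
    unfolding jump_intensity_def by (subst time_marks.nn_integral_snd[symmetric]) auto
  also have "\<dots> = (\<integral>\<^sup>+y. ennreal (fst y ^ k) * (\<integral>\<^sup>+u. H (u, snd y) \<partial>lborel) \<partial>(\<nu> \<Otimes>\<^sub>M \<pi>))"
    by (intro nn_integral_cong nn_integral_cmult) (auto simp: space_pair_measure)
  also have "\<dots> = (\<integral>\<^sup>+z. \<integral>\<^sup>+r. ennreal (z ^ k) * (\<integral>\<^sup>+u. H (u, r) \<partial>lborel) \<partial>\<pi> \<partial>\<nu>)"
    by (subst pi.nn_integral_fst[symmetric]) auto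
  also have "\<dots> = (\<integral>\<^sup>+z. ennreal (z ^ k) * (\<integral>\<^sup>+r. \<integral>\<^sup>+u. H (u, r) \<partial>lborel \<partial>\<pi>) \<partial>\<nu>)"
    by (intro nn_integral_cong nn_integral_cmult) auto
  also have "\<dots> = (\<integral>\<^sup>+z. ennreal (z ^ k) \<partial>\<nu>) * (\<integral>\<^sup>+r. \<integral>\<^sup>+u. H (u, r) \<partial>lborel \<partial>\<pi>)"
    by (intro nn_integral_multc) auto
  also have "(\<integral>\<^sup>+z. ennreal (z ^ k) \<partial>\<nu>) = ennreal (jump_moment k)"
    unfolding jump_moment_def using levy_moments[OF k]
    by (intro nn_integral_eq_integral AE_I2) (auto simp: space_nu)
  finally show ?thesis .
qed

text \<open>The response at time \<open>s\<close> to a jump, so that the process at time \<open>s\<close> is its integral against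
  \<open>N\<close>.\<close>

definition ker :: "real \<Rightarrow> real \<times> real \<times> real \<Rightarrow> real" where
  "ker s x = indicator {..s} (fst x) * (fst (snd x) * exp (- snd (snd x) * (s - fst x)))"

lemma ker_measurable2 [measurable]: "(\<lambda>(s, x). ker s x) \<in> borel_measurable (borel \<Otimes>\<^sub>M mN)"
proof -
  have [measurable]: "Measurable.pred (borel \<Otimes>\<^sub>M mN) (\<lambda>p. fst (snd p) \<le> fst p)" by measurable
  have "(\<lambda>p. if fst (snd p) \<le> fst p then fst (snd (snd p)) * exp (- snd (snd (snd p)) * (fst p - fst (snd p))) else 0) \<in> borel_measurable (borel \<Otimes>\<^sub>M mN)"
    by measurable
  then show ?thesis
    by (rule measurable_cong[THEN iffD1, rotated]) (auto simp: ker_def indicator_def)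
qed

lemma ker_measurable [measurable]: "ker s \<in> borel_measurable mN"
  using measurable_Pair2[OF ker_measurable2, of s] by simp

lemma ker_nonneg: "x \<in> space mN \<Longrightarrow> 0 \<le> ker s x"
  by (auto simp: ker_def space_mN)

text \<open>The Bochner integral of a nonnegative function is \<open>0\<close> if the function is not integrable, and so is
  the real number assigned to an infinite integral; hence the identity holds at every sample point.\<close>

lemma supOU_eq:
  assumes "\<omega> \<in> space M"
  shows "supOU N s \<omega> = enn2real (\<integral>\<^sup>+x. ennreal (ker s x) \<partial>N \<omega>)"
proof -
  have "supOU N s \<omega> = (LINT x|N \<omega>. ker s x)"
    unfolding supOU_def ker_def by (simp add: case_prod_beta')
  also have "\<dots> = enn2real (\<integral>\<^sup>+x. ennreal (ker s x) \<partial>N \<omega>)"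
    using sets_eq_imp_space_eq[OF sets_N[OF assms]]
    by (intro integral_eq_nn_integral measurable_N assms ker_measurable AE_I2 ker_nonneg) auto
  finally show ?thesis .
qed

lemma supOU_nonneg: "\<omega> \<in> space M \<Longrightarrow> 0 \<le> supOU N s \<omega>"
  by (simp add: supOU_eq)

lemma supOU_measurable_on:
  assumes W: "space W = space M"
    "\<And>A. A \<in> sets mN \<Longrightarrow> A \<subseteq> {..s} \<times> UNIV \<Longrightarrow> (\<lambda>\<omega>. emeasure (N \<omega>) A) \<in> borel_measurable W"
  shows "supOU N s \<in> borel_measurable W"
proof -
  have "(\<lambda>\<omega>. \<integral>\<^sup>+x. ennreal (ker s x) \<partial>N \<omega>) \<in> borel_measurable W"
  proof (rule nn_integral_N_measurable_on)
    fix A assume "A \<in> sets mN" and *: "\<And>x. x \<in> A \<Longrightarrow> ennreal (ker s x) \<noteq> 0"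
    moreover have "A \<subseteq> {..s} \<times> UNIV"
    proof
      fix x assume "x \<in> A"
      have "fst x \<le> s"
      proof (rule ccontr)
        assume "\<not> fst x \<le> s"
        then have "ker s x = 0" by (simp add: ker_def)
        with *[OF \<open>x \<in> A\<close>] show False by simp
      qed
      then show "x \<in> {..s} \<times> UNIV" by (simp add: mem_Times_iff)
    qed
    ultimately show "(\<lambda>\<omega>. emeasure (N \<omega>) A) \<in> borel_measurable W" using W by blast
  qed (use W in auto)
  then have "(\<lambda>\<omega>. enn2real (\<integral>\<^sup>+x. ennreal (ker s x) \<partial>N \<omega>)) \<in> borel_measurable W" by simp
  then show ?thesis
    by (rule measurable_cong[THEN iffD1, rotated]) (simp add: W supOU_eq)
qed

lemma supOU_measurable [measurable]: "supOU N s \<in> borel_measurable M"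
  by (rule supOU_measurable_on) auto

definition "mean_memory = (\<integral>r. 1 / r \<partial>\<pi>)"

definition "supOU_cov h = jump_moment 2 * (\<integral>r. exp (- r * h) / (2 * r) \<partial>\<pi>)"

lemma integrable_exp_div: "0 \<le> h \<Longrightarrow> integrable \<pi> (\<lambda>r. exp (- r * h) / (2 * r))"
proof (rule Bochner_Integration.integrable_bound[OF pi_inverse])
  assume "0 \<le> h"
  then show "AE r in \<pi>. norm (exp (- r * h) / (2 * r)) \<le> norm (1 / r)"
    by (intro AE_I2) (auto simp: space_pi field_simps abs_mult intro: order_trans[of _ 1])
qed measurable

lemma mean_memory_pos: "0 < mean_memory"
proof -
  have "mean_memory \<noteq> 0"
  proof
    assume "mean_memory = 0"
    then have "AE r in \<pi>. 1 / r = 0"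
      unfolding mean_memory_def by (subst (asm) integral_nonneg_eq_0_iff_AE[OF pi_inverse]) (auto intro!: AE_I2 simp: space_pi)
    moreover have "AE r in \<pi>. 0 < r" by (intro AE_I2) (simp add: space_pi)
    ultimately have "AE r in \<pi>. False" by eventually_elim simp
    then show False by simp
  qed
  moreover have "0 \<le> mean_memory" unfolding mean_memory_def by (intro integral_nonneg_AE AE_I2) (simp add: space_pi)
  ultimately show ?thesis by simp
qed

lemma nn_mean: "(\<integral>\<^sup>+x. ennreal (ker s x) \<partial>mN) = ennreal (jump_moment 1 * mean_memory)"
proof -
  have [measurable]: "(\<lambda>p. ennreal (indicator {..s} (fst p) * exp (- snd p * (s - fst p)))) \<in> borel_measurable (lborel \<Otimes>\<^sub>M \<pi>)"
    by (measurable)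
  have "(\<integral>\<^sup>+x. ennreal (ker s x) \<partial>mN) =
    (\<integral>\<^sup>+x. ennreal (fst (snd x) ^ 1) * (\<lambda>p. ennreal (indicator {..s} (fst p) * exp (- snd p * (s - fst p)))) (fst x, snd (snd x)) \<partial>mN)"
    by (intro nn_integral_cong) (auto simp: ker_def space_mN mult_ac simp flip: ennreal_mult)
  also have "\<dots> = ennreal (jump_moment 1) * (\<integral>\<^sup>+r. \<integral>\<^sup>+u. ennreal (indicator {..s} u * exp (- r * (s - u))) \<partial>lborel \<partial>\<pi>)"
    by (subst nn_integral_jumps) auto
  also have "(\<integral>\<^sup>+r. \<integral>\<^sup>+u. ennreal (indicator {..s} u * exp (- r * (s - u))) \<partial>lborel \<partial>\<pi>) = (\<integral>\<^sup>+r. ennreal (1 / r) \<partial>\<pi>)"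
    by (intro nn_integral_cong nn_integral_exp_atMost) (simp add: space_pi)
  also have "\<dots> = ennreal mean_memory"
    unfolding mean_memory_def by (intro nn_integral_eq_integral pi_inverse AE_I2) (simp add: space_pi)
  finally show ?thesis using jump_moment_nonneg mean_memory_pos by (simp add: ennreal_mult)
qed

text \<open>With \<open>m = min s v\<close> the product of the two kernels is
  \<open>z\<^sup>2 exp (- r \<bar>s - v\<bar>) exp (- 2 r (m - u))\<close> on \<open>u \<le> m\<close>; the integral over \<open>u\<close> contributes
  \<open>1 / (2 r)\<close>.\<close>

lemma nn_cov: "(\<integral>\<^sup>+x. ennreal (ker s x) * ennreal (ker v x) \<partial>mN) = ennreal (supOU_cov \<bar>s - v\<bar>)"
proof -
  let ?h = "\<bar>s - v\<bar>" and ?m = "min s v"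
  let ?H = "\<lambda>p. ennreal (exp (- snd p * ?h)) * ennreal (indicator {..?m} (fst p) * exp (- (2 * snd p) * (?m - fst p)))"
  have [measurable]: "?H \<in> borel_measurable (lborel \<Otimes>\<^sub>M \<pi>)"
    by (measurable)
  have *: "ker s x * ker v x = fst (snd x) ^ 2 * (exp (- snd (snd x) * ?h) * (indicator {..?m} (fst x) * exp (- (2 * snd (snd x)) * (?m - fst x))))" for x
  proof -
    obtain u z r where x: "x = (u, z, r)" by (cases x) auto
    show ?thesis
    proof (cases "u \<le> s \<and> u \<le> v")
      case True
      have "- r * (s - u) + - r * (v - u) = - r * ?h + - (2 * r) * (?m - u)"
        by (auto simp: min_def abs_if algebra_simps)
      then have "exp (- r * (s - u)) * exp (- r * (v - u)) = exp (- r * ?h) * exp (- (2 * r) * (?m - u))"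
        by (simp only: exp_add[symmetric])
      with True show ?thesis by (simp add: ker_def x power2_eq_square mult_ac)
    qed (auto simp: ker_def x)
  qed
  have "(\<integral>\<^sup>+x. ennreal (ker s x) * ennreal (ker v x) \<partial>mN) =
    (\<integral>\<^sup>+x. ennreal (fst (snd x) ^ 2) * ?H (fst x, snd (snd x)) \<partial>mN)"
    by (intro nn_integral_cong) (simp add: ker_nonneg * flip: ennreal_mult)
  also have "\<dots> = ennreal (jump_moment 2) * (\<integral>\<^sup>+r. \<integral>\<^sup>+u. ?H (u, r) \<partial>lborel \<partial>\<pi>)"
    by (subst nn_integral_jumps[of 2 ?H]) auto
  also have "(\<integral>\<^sup>+r. \<integral>\<^sup>+u. ?H (u, r) \<partial>lborel \<partial>\<pi>) = (\<integral>\<^sup>+r. ennreal (exp (- r * ?h) / (2 * r)) \<partial>\<pi>)"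
  proof (rule nn_integral_cong)
    fix r assume "r \<in> space \<pi>"
    then have r: "0 < r" by (simp add: space_pi)
    have "(\<integral>\<^sup>+u. ?H (u, r) \<partial>lborel) = ennreal (exp (- r * ?h)) *
        (\<integral>\<^sup>+u. ennreal (indicator {..?m} u * exp (- (2 * r) * (?m - u))) \<partial>lborel)"
      supply [measurable del] = ident_measurable
      by (simp only: fst_conv snd_conv) (rule nn_integral_cmult, measurable)
    also have "\<dots> = ennreal (exp (- r * ?h)) * ennreal (1 / (2 * r))"
      using r by (subst nn_integral_exp_atMost) auto
    finally show "(\<integral>\<^sup>+u. ?H (u, r) \<partial>lborel) = ennreal (exp (- r * ?h) / (2 * r))"
      using r by (simp flip: ennreal_mult)
  qed
  also have "\<dots> = ennreal (\<integral>r. exp (- r * ?h) / (2 * r) \<partial>\<pi>)"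
    by (intro nn_integral_eq_integral integrable_exp_div AE_I2) (auto simp: space_pi)
  finally show ?thesis using jump_moment_nonneg by (simp add: supOU_cov_def ennreal_mult')
qed

lemma supOU_cov_nonneg: "0 \<le> supOU_cov h"
  unfolding supOU_cov_def using jump_moment_nonneg
  by (intro mult_nonneg_nonneg integral_nonneg_AE AE_I2) (auto simp: space_pi)

lemma supOU_finite: "AE \<omega> in M. (\<integral>\<^sup>+x. ennreal (ker s x) \<partial>N \<omega>) < \<infinity>"
proof -
  have "(\<integral>\<^sup>+\<omega>. (\<integral>\<^sup>+x. ennreal (ker s x) \<partial>N \<omega>) \<partial>M) \<noteq> \<infinity>"
    by (subst campbell_mean) (auto simp: nn_mean)
  then have "AE \<omega> in M. (\<integral>\<^sup>+x. ennreal (ker s x) \<partial>N \<omega>) \<noteq> \<infinity>"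
    by (intro nn_integral_PInf_AE) auto
  then show ?thesis by (simp add: less_top)
qed

lemma ennreal_supOU: "AE \<omega> in M. ennreal (supOU N s \<omega>) = (\<integral>\<^sup>+x. ennreal (ker s x) \<partial>N \<omega>)"
  using supOU_finite[of s] AE_space by eventually_elim (simp add: supOU_eq ennreal_enn2real)

definition "supOU_mean = jump_moment 1 * mean_memory"

lemma supOU_mean_nonneg: "0 \<le> supOU_mean"
  unfolding supOU_mean_def using jump_moment_nonneg mean_memory_pos by simp

lemma nn_integral_supOU: "(\<integral>\<^sup>+\<omega>. ennreal (supOU N s \<omega>) \<partial>M) = ennreal supOU_mean"
  using nn_integral_cong_AE[OF ennreal_supOU[of s]] by (simp add: campbell_mean nn_mean supOU_mean_def)

lemma nn_integral_supOU_mult: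
  "(\<integral>\<^sup>+\<omega>. ennreal (supOU N s \<omega>) * ennreal (supOU N v \<omega>) \<partial>M) = ennreal (supOU_mean\<^sup>2 + supOU_cov \<bar>s - v\<bar>)"
proof -
  have "(\<integral>\<^sup>+\<omega>. ennreal (supOU N s \<omega>) * ennreal (supOU N v \<omega>) \<partial>M) =
    (\<integral>\<^sup>+\<omega>. (\<integral>\<^sup>+x. ennreal (ker s x) \<partial>N \<omega>) * (\<integral>\<^sup>+x. ennreal (ker v x) \<partial>N \<omega>) \<partial>M)"
  proof (rule nn_integral_cong_AE)
    show "AE \<omega> in M. ennreal (supOU N s \<omega>) * ennreal (supOU N v \<omega>) =
        (\<integral>\<^sup>+x. ennreal (ker s x) \<partial>N \<omega>) * (\<integral>\<^sup>+x. ennreal (ker v x) \<partial>N \<omega>)"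
      using ennreal_supOU[of s] ennreal_supOU[of v] by eventually_elim simp
  qed
  also have "\<dots> = ennreal supOU_mean * ennreal supOU_mean + ennreal (supOU_cov \<bar>s - v\<bar>)"
    by (subst campbell_second) (auto simp: nn_mean nn_cov supOU_mean_def)
  finally show ?thesis
    using supOU_mean_nonneg supOU_cov_nonneg by (simp add: power2_eq_square ennreal_mult)
qed

lemma supOU_integrable: "integrable M (supOU N s)" and supOU_expectation: "expectation (supOU N s) = supOU_mean"
proof -
  have "has_bochner_integral M (supOU N s) supOU_mean"
    using nn_integral_supOU supOU_nonneg supOU_mean_nonneg by (intro has_bochner_integral_nn_integral AE_I2) auto
  then show "integrable M (supOU N s)" "expectation (supOU N s) = supOU_mean"
    by (auto simp: has_bochner_integral_iff)
qed

lemma supOU_mult_integrable: "integrable M (\<lambda>\<omega>. supOU N s \<omega> * supOU N v \<omega>)"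
  and supOU_mult_expectation: "expectation (\<lambda>\<omega>. supOU N s \<omega> * supOU N v \<omega>) = supOU_mean\<^sup>2 + supOU_cov \<bar>s - v\<bar>"
proof -
  have "has_bochner_integral M (\<lambda>\<omega>. supOU N s \<omega> * supOU N v \<omega>) (supOU_mean\<^sup>2 + supOU_cov \<bar>s - v\<bar>)"
    using nn_integral_supOU_mult[of s v] supOU_nonneg supOU_cov_nonneg
    by (intro has_bochner_integral_nn_integral AE_I2) (auto simp: ennreal_mult cong: nn_integral_cong)
  then show "integrable M (\<lambda>\<omega>. supOU N s \<omega> * supOU N v \<omega>)" "expectation (\<lambda>\<omega>. supOU N s \<omega> * supOU N v \<omega>) = supOU_mean\<^sup>2 + supOU_cov \<bar>s - v\<bar>"
    by (auto simp: has_bochner_integral_iff)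
qed

lemma supOU_variance: "variance (supOU N s) = supOU_cov 0"
proof -
  have "variance (supOU N s) = expectation (\<lambda>\<omega>. (supOU N s \<omega>)\<^sup>2) - (expectation (supOU N s))\<^sup>2"
    using supOU_mult_integrable[of s s] supOU_integrable by (intro variance_eq) (auto simp: power2_eq_square)
  then show ?thesis using supOU_mult_expectation[of s s] by (simp add: supOU_expectation power2_eq_square)
qed

lemma supOU_cov_0: "supOU_cov 0 = jump_moment 2 / 2 * mean_memory"
proof -
  have "(\<integral>r. exp (- r * 0) / (2 * r) \<partial>\<pi>) = (\<integral>r. 1 / 2 * (1 / r) \<partial>\<pi>)"
    by (intro Bochner_Integration.integral_cong refl) simp
  also have "\<dots> = 1 / 2 * mean_memory"
    unfolding mean_memory_def by (rule integral_mult_right_zero)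
  finally show ?thesis by (simp add: supOU_cov_def)
qed

text \<open>From \<open>1 - exp (- r h) \<le> r h\<close>; the factor \<open>r\<close> cancels against \<open>1 / (2 r)\<close>.\<close>

lemma supOU_cov_continuity:
  assumes "0 \<le> h" shows "supOU_cov 0 - supOU_cov h \<le> jump_moment 2 / 2 * h"
proof -
  have "(\<integral>r. exp (- r * 0) / (2 * r) \<partial>\<pi>) - (\<integral>r. exp (- r * h) / (2 * r) \<partial>\<pi>) =
     (\<integral>r. exp (- r * 0) / (2 * r) - exp (- r * h) / (2 * r) \<partial>\<pi>)"
    using assms by (intro Bochner_Integration.integral_diff[symmetric] integrable_exp_div) auto
  also have "\<dots> \<le> (\<integral>r. h / 2 \<partial>\<pi>)"
  proof (rule integral_mono_AE)
    show "AE r in \<pi>. exp (- r * 0) / (2 * r) - exp (- r * h) / (2 * r) \<le> h / 2"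
    proof (rule AE_I2)
      fix r assume "r \<in> space \<pi>"
      then have r: "0 < r" by (simp add: space_pi)
      have "1 - r * h \<le> exp (- r * h)" using exp_ge_add_one_self[of "- r * h"] by simp
      then have "(1 - exp (- r * h)) / (2 * r) \<le> (r * h) / (2 * r)" using r by (intro divide_right_mono) auto
      then show "exp (- r * 0) / (2 * r) - exp (- r * h) / (2 * r) \<le> h / 2" using r by (simp add: diff_divide_distrib)
    qed
  qed (intro Bochner_Integration.integrable_diff integrable_exp_div assms order_refl, simp)
  finally have "jump_moment 2 * ((\<integral>r. exp (- r * 0) / (2 * r) \<partial>\<pi>) - (\<integral>r. exp (- r * h) / (2 * r) \<partial>\<pi>)) \<le> jump_moment 2 * (h / 2)"
    using jump_moment_nonneg by (intro mult_left_mono) (auto simp: pi.prob_space)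
  then show ?thesis by (simp add: supOU_cov_def right_diff_distrib)
qed

lemma supOU_increment_square: "expectation (\<lambda>\<omega>. (supOU N s \<omega> - supOU N v \<omega>)\<^sup>2) \<le> jump_moment 2 * \<bar>s - v\<bar>"
  and supOU_increment_square_integrable: "integrable M (\<lambda>\<omega>. (supOU N s \<omega> - supOU N v \<omega>)\<^sup>2)"
proof -
  have *: "(supOU N s \<omega> - supOU N v \<omega>)\<^sup>2 = supOU N s \<omega> * supOU N s \<omega> + supOU N v \<omega> * supOU N v \<omega> - 2 * (supOU N s \<omega> * supOU N v \<omega>)" for \<omega>
    by (simp add: power2_eq_square algebra_simps)
  show "integrable M (\<lambda>\<omega>. (supOU N s \<omega> - supOU N v \<omega>)\<^sup>2)"
    unfolding * by (intro Bochner_Integration.integrable_diff Bochner_Integration.integrable_add integrable_mult_right supOU_mult_integrable)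
  have "expectation (\<lambda>\<omega>. (supOU N s \<omega> - supOU N v \<omega>)\<^sup>2) = 2 * (supOU_cov 0 - supOU_cov \<bar>s - v\<bar>)"
    unfolding * by (simp add: supOU_mult_integrable supOU_mult_expectation)
  also have "\<dots> \<le> 2 * (jump_moment 2 / 2 * \<bar>s - v\<bar>)"
    by (intro mult_left_mono supOU_cov_continuity) auto
  finally show "expectation (\<lambda>\<omega>. (supOU N s \<omega> - supOU N v \<omega>)\<^sup>2) \<le> jump_moment 2 * \<bar>s - v\<bar>" by simp
qed

end

section \<open>The algebra of the jumps and a jointly measurable version\<close>

lemma (in complete_measure) borel_measurable_AE_cong:
  assumes f: "f \<in> borel_measurable M" and AE: "AE x in M. f x = g x"
  shows "g \<in> borel_measurable M"
proof (rule measurableI)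
  fix S :: "'b set" assume S: "S \<in> sets borel"
  show "g -` S \<inter> space M \<in> sets M"
  proof (rule in_sets_AE)
    show "f -` S \<inter> space M \<in> sets M" using f S by (rule measurable_sets)
    show "AE x in M. (x \<in> f -` S \<inter> space M) = (x \<in> g -` S \<inter> space M)"
      using AE by eventually_elim simp
  qed simp
qed simp

locale supOUSV_model = supOU_model M \<nu> \<pi> N + ito_noise M \<rho> B F
  for M :: "'a measure" and \<nu> \<pi> :: "real measure" and N :: "'a \<Rightarrow> (real \<times> real \<times> real) measure"
    and \<rho> :: "real measure" and B :: "(real \<times> real) set \<Rightarrow> 'a \<Rightarrow> real" and F :: "real \<Rightarrow> 'a measure" +
  assumes noises_indep: "indep_set (gen_events M (\<lambda>A \<omega>. emeasure (N \<omega>) A) (sets (jump_intensity \<nu> \<pi>)))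
           (gen_events M B (finite_sets (control_measure \<rho>)))"
    and adapted: "\<And>t A. A \<in> sets (jump_intensity \<nu> \<pi>) \<Longrightarrow> A \<subseteq> {..t} \<times> UNIV \<Longrightarrow>
        (\<lambda>\<omega>. emeasure (N \<omega>) A) \<in> borel_measurable (F t)"
begin

declare ident_measurable [measurable del]

definition "jump_algebra = sigma (space M) (gen_events M (\<lambda>A \<omega>. emeasure (N \<omega>) A) (sets mN))"

lemma space_jump_algebra [simp]: "space jump_algebra = space M"
  by (simp add: jump_algebra_def space_measure_of_conv)

lemma sets_jump_algebra: "sets jump_algebra = gen_events M (\<lambda>A \<omega>. emeasure (N \<omega>) A) (sets mN)"
  using sigma_algebra_gen_events[of M "\<lambda>A \<omega>. emeasure (N \<omega>) A" "sets mN"]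
  by (simp add: jump_algebra_def sigma_algebra.sets_measure_of_eq)

lemma count_measurable_jump [measurable]: "A \<in> sets mN \<Longrightarrow> (\<lambda>\<omega>. emeasure (N \<omega>) A) \<in> borel_measurable jump_algebra"
  by (rule measurableI)
    (simp_all add: sets_jump_algebra gen_eventsI[where Z = "\<lambda>A \<omega>. emeasure (N \<omega>) A"])

lemma measurable_jumpD:
  assumes f: "f \<in> borel_measurable jump_algebra"
  shows "f \<in> borel_measurable M"
proof (rule measurableI)
  fix S :: "'b set" assume "S \<in> sets borel"
  from measurable_sets[OF f this] have "f -` S \<inter> space M \<in> gen_events M (\<lambda>A \<omega>. emeasure (N \<omega>) A) (sets mN)"
    by (simp add: sets_jump_algebra)
  also have "\<dots> \<subseteq> events" using noises_indep unfolding indep_sets2_eq by (rule conjunct1)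
  finally show "f -` S \<inter> space M \<in> events" .
qed simp

lemma supOU_adapted: "supOU N s \<in> borel_measurable (F s)"
  by (rule supOU_measurable_on[OF space_F adapted])

lemma supOU_measurable_jump [measurable]: "supOU N s \<in> borel_measurable jump_algebra"
  by (rule supOU_measurable_on[OF space_jump_algebra count_measurable_jump])

text \<open>This is the source of every vanishing mixed moment: the noise is centered and independent
  of the jumps.\<close>

lemma jump_orthogonal_noise:
  assumes G: "G \<in> borel_measurable jump_algebra" "integrable M G" and D: "D \<in> finite_sets ctrl"
  shows "integrable M (\<lambda>\<omega>. G \<omega> * B D \<omega>)" "expectation (\<lambda>\<omega>. G \<omega> * B D \<omega>) = 0"
proof -
  have 1: "G -` S \<inter> space M \<in> gen_events M (\<lambda>A \<omega>. emeasure (N \<omega>) A) (sets mN)" if "S \<in> sets borel" for S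
    using measurable_sets[OF G(1) that] by (simp add: sets_jump_algebra)
  have 2: "B D -` S \<inter> space M \<in> gen_events M B (finite_sets ctrl)" if "S \<in> sets borel" for S
    using D that by (rule gen_eventsI)
  show "integrable M (\<lambda>\<omega>. G \<omega> * B D \<omega>)"
    by (rule indep_set_expectation_mult(1)[OF noises_indep sigma_algebra_gen_events 1 sigma_algebra_gen_events 2 G(2) noise_moments(2)[OF D]])
  have "expectation (\<lambda>\<omega>. G \<omega> * B D \<omega>) = expectation G * expectation (B D)"
    by (rule indep_set_expectation_mult(2)[OF noises_indep sigma_algebra_gen_events 1 sigma_algebra_gen_events 2 G(2) noise_moments(2)[OF D]])
  then show "expectation (\<lambda>\<omega>. G \<omega> * B D \<omega>) = 0"
    by (simp add: noise_moments(4)[OF D])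
qed

text \<open>Off a null set that does not depend on \<open>s\<close> every piece of a countable partition carries finitely
  many jumps. There the process is left unchanged, on the null set it is replaced by zero.\<close>

lemma supOU_joint_version:
  obtains Y where "(\<lambda>(s, \<omega>). Y s \<omega>) \<in> borel_measurable (borel \<Otimes>\<^sub>M jump_algebra)"
    "\<And>s \<omega>. 0 \<le> Y s \<omega>" "AE \<omega> in M. \<forall>s. Y s \<omega> = supOU N s \<omega>"
proof -
  obtain S :: "nat \<Rightarrow> (real \<times> real \<times> real) set" where S: "range S \<subseteq> sets mN" "(\<Union>i. S i) = space mN"
      "\<And>i. emeasure mN (S i) \<noteq> \<infinity>" "disjoint_family S"
    using intensity.sigma_finite_disjoint by blast
  have fin: "AE \<omega> in M. \<forall>i. emeasure (N \<omega>) (S i) < \<infinity>"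
    unfolding AE_all_countable
  proof
    fix i
    have "(\<integral>\<^sup>+\<omega>. emeasure (N \<omega>) (S i) \<partial>M) \<noteq> \<infinity>" using S(1,3) by (subst count_moments) (auto simp: less_top)
    then have "AE \<omega> in M. emeasure (N \<omega>) (S i) \<noteq> \<infinity>" using S(1) by (intro nn_integral_PInf_AE) auto
    then show "AE \<omega> in M. emeasure (N \<omega>) (S i) < \<infinity>" by (simp add: less_top)
  qed
  define Y where "Y s \<omega> = enn2real (if \<forall>i. emeasure (N \<omega>) (S i) < \<infinity> then \<integral>\<^sup>+x. ennreal (ker s x) \<partial>N \<omega> else 0)" for s \<omega>
  have "(\<lambda>(s, \<omega>). if \<forall>i. emeasure (N \<omega>) (S i) < \<infinity> then \<integral>\<^sup>+x. ennreal (ker s x) \<partial>N \<omega> else 0)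
      \<in> borel_measurable (borel \<Otimes>\<^sub>M jump_algebra)"
  proof (rule measurable_nn_integral_random_measure[OF _ _ S(1,2,4)])
    show "space mN \<noteq> {}" by (auto simp: space_mN)
    show "(\<lambda>(s, x). ennreal (ker s x)) \<in> borel_measurable (borel \<Otimes>\<^sub>M mN)"
      using ker_measurable2 by (simp add: case_prod_beta')
  qed auto
  then have "(\<lambda>(s, \<omega>). Y s \<omega>) \<in> borel_measurable (borel \<Otimes>\<^sub>M jump_algebra)"
    unfolding Y_def by (simp add: case_prod_beta')
  moreover have "AE \<omega> in M. \<forall>s. Y s \<omega> = supOU N s \<omega>"
    using fin AE_space by eventually_elim (simp add: Y_def supOU_eq)
  ultimately show thesis using that[of Y] by (simp add: Y_def)
qed

lemma AE_product_snd:
  assumes "AE \<omega> in M. P \<omega>"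
  shows "AE p in ctrl \<Otimes>\<^sub>M M. P (snd p)"
proof -
  from AE_E[OF assms] obtain Z where Z: "{\<omega> \<in> space M. \<not> P \<omega>} \<subseteq> Z" "emeasure M Z = 0" "Z \<in> sets M" .
  show ?thesis
  proof (rule AE_I)
    show "{p \<in> space (ctrl \<Otimes>\<^sub>M M). \<not> P (snd p)} \<subseteq> space ctrl \<times> Z"
      using Z(1) by (auto simp: space_pair_measure)
    show "emeasure (ctrl \<Otimes>\<^sub>M M) (space ctrl \<times> Z) = 0"
      using Z by (simp add: emeasure_pair_measure_Times)
  qed (use Z in auto)
qed

lemma sets_rho: "sets \<rho> = sets (restrict_space borel {0<..})" and space_rho: "space \<rho> = {0<..}"
  using rho sets_eq_imp_space_eq[of \<rho> "restrict_space borel {0<..}"]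
  by (auto simp: prob_on_positive_reals_def space_restrict_space)

lemma space_ctrl: "space ctrl = {0<..} \<times> UNIV"
  by (simp add: control_measure_def space_pair_measure space_rho)

lemma borel_measurable_rho: "f \<in> borel_measurable borel \<Longrightarrow> f \<in> borel_measurable \<rho>"
  unfolding measurable_cong_sets[OF sets_rho refl] by (rule measurable_restrict_space1)

lemma ctrl_coordinates [measurable]: "fst \<in> borel_measurable ctrl" "snd \<in> borel_measurable ctrl"
proof -
  have id: "(\<lambda>x. x) \<in> borel_measurable \<rho>" by (rule borel_measurable_rho) simp
  show "fst \<in> borel_measurable ctrl"
    unfolding control_measure_def by (rule measurable_compose[OF measurable_fst id])
  show "snd \<in> borel_measurable ctrl"
    unfolding control_measure_def by (rule measurable_compose[OF measurable_snd]) simp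
qed

lemma nn_integral_ctrl:
  assumes "f \<in> borel_measurable ctrl"
  shows "(\<integral>\<^sup>+x. f x \<partial>ctrl) = (\<integral>\<^sup>+R. \<integral>\<^sup>+s. f (R, s) \<partial>lborel \<partial>\<rho>)"
  using assms unfolding control_measure_def by (intro lborel.nn_integral_fst[symmetric])

text \<open>The deterministic factor of the volatility integrand.\<close>

definition vol_kernel :: "real \<Rightarrow> real \<Rightarrow> real \<times> real \<Rightarrow> real" where
  "vol_kernel \<sigma> t x = indicator {..t} (snd x) * (exp (- fst x * (t - snd x)) * (\<sigma> * sqrt (fst x)))"

lemma vol_kernel_measurable [measurable]: "vol_kernel \<sigma> t \<in> borel_measurable ctrl"
  unfolding vol_kernel_def by measurable

lemma nn_integral_vol_kernel_square: "(\<integral>\<^sup>+x. ennreal ((vol_kernel \<sigma> t x)\<^sup>2) \<partial>ctrl) = ennreal (\<sigma>\<^sup>2 / 2)"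
proof -
  have "(\<integral>\<^sup>+x. ennreal ((vol_kernel \<sigma> t x)\<^sup>2) \<partial>ctrl) = (\<integral>\<^sup>+R. \<integral>\<^sup>+s. ennreal ((vol_kernel \<sigma> t (R, s))\<^sup>2) \<partial>lborel \<partial>\<rho>)"
    by (rule nn_integral_ctrl) measurable
  also have "\<dots> = (\<integral>\<^sup>+R. ennreal (\<sigma>\<^sup>2 / 2) \<partial>\<rho>)"
  proof (rule nn_integral_cong)
    fix R assume "R \<in> space \<rho>"
    then have R: "0 < R" by (simp add: space_rho)
    have "(\<integral>\<^sup>+s. ennreal ((vol_kernel \<sigma> t (R, s))\<^sup>2) \<partial>lborel) =
      (\<integral>\<^sup>+s. ennreal (\<sigma>\<^sup>2 * R) * ennreal (indicator {..t} s * exp (- (2 * R) * (t - s))) \<partial>lborel)"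
    proof (rule nn_integral_cong)
      fix s
      have "(exp (- R * (t - s)))\<^sup>2 = exp (- (2 * R) * (t - s))"
        by (simp add: power2_eq_square flip: exp_add)
      then have "(vol_kernel \<sigma> t (R, s))\<^sup>2 = (\<sigma>\<^sup>2 * R) * (indicator {..t} s * exp (- (2 * R) * (t - s)))"
        using R by (simp add: vol_kernel_def power_mult_distrib indicator_def)
      then show "ennreal ((vol_kernel \<sigma> t (R, s))\<^sup>2) = ennreal (\<sigma>\<^sup>2 * R) * ennreal (indicator {..t} s * exp (- (2 * R) * (t - s)))"
        using R by (simp add: ennreal_mult)
    qed
    also have "\<dots> = ennreal (\<sigma>\<^sup>2 * R) * (\<integral>\<^sup>+s. ennreal (indicator {..t} s * exp (- (2 * R) * (t - s))) \<partial>lborel)"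
      by (rule nn_integral_cmult) simp
    also have "\<dots> = ennreal (\<sigma>\<^sup>2 * R) * ennreal (1 / (2 * R))"
      using R by (subst nn_integral_exp_atMost) auto
    finally show "(\<integral>\<^sup>+s. ennreal ((vol_kernel \<sigma> t (R, s))\<^sup>2) \<partial>lborel) = ennreal (\<sigma>\<^sup>2 / 2)"
      using R by (simp flip: ennreal_mult)
  qed
  finally show ?thesis by (simp add: rho.emeasure_space_1)
qed

end

section \<open>Step approximation of the volatility integrand\<close>

text \<open>The coefficient on the cell with rate in \<open>]i/k, (i+1)/k]\<close> and age \<open>t - s\<close> in \<open>[j/k, (j+1)/k[\<close>.
  The square root is taken at the lower end of the rate cell, but the exponential at the upper
  ends of both cells. So the step function stays below the kernel
  it approximates, and the kernel itself is a dominating function.\<close>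

definition grid_coef :: "real \<Rightarrow> nat \<Rightarrow> nat \<Rightarrow> nat \<Rightarrow> real" where
  "grid_coef \<sigma> k i j = exp (- (real (i + 1) / real k) * (real (j + 1) / real k)) * (\<sigma> * sqrt (real i / real k))"

definition rate_cell :: "nat \<Rightarrow> nat \<Rightarrow> real set" where
  "rate_cell k i = {real i / real k<..real (i + 1) / real k}"

text \<open>Time cells are counted backwards from \<open>t\<close> and are closed on the right, as the
  simple integrands require; their left endpoint is where the random coefficient is evaluated.\<close>

definition cell_start :: "real \<Rightarrow> nat \<Rightarrow> nat \<Rightarrow> real" where
  "cell_start t k j = t - real (j + 1) / real k"

definition time_cell :: "real \<Rightarrow> nat \<Rightarrow> nat \<Rightarrow> real set" where
  "time_cell t k j = {cell_start t k j<..t - real j / real k}"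

definition grid_kernel :: "real \<Rightarrow> real \<Rightarrow> nat \<Rightarrow> real \<times> real \<Rightarrow> real" where
  "grid_kernel \<sigma> t k x = (\<Sum>i<k\<^sup>2. \<Sum>j<k\<^sup>2. grid_coef \<sigma> k i j * indicator (rate_cell k i) (fst x) * indicator (time_cell t k j) (snd x))"

lemma sqrt_diff_square_le:
  fixes a b :: real
  assumes "0 \<le> a" "0 \<le> b"
  shows "(sqrt a - sqrt b)\<^sup>2 \<le> \<bar>a - b\<bar>"
proof -
  have "\<bar>sqrt a - sqrt b\<bar> \<le> sqrt a + sqrt b" using assms by (simp add: abs_le_iff)
  then have "\<bar>sqrt a - sqrt b\<bar> * \<bar>sqrt a - sqrt b\<bar> \<le> \<bar>sqrt a - sqrt b\<bar> * (sqrt a + sqrt b)"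
    by (intro mult_left_mono) auto
  also have "\<dots> = \<bar>(sqrt a - sqrt b) * (sqrt a + sqrt b)\<bar>"
    using assms by (simp add: abs_mult)
  also have "(sqrt a - sqrt b) * (sqrt a + sqrt b) = a - b"
    using assms by (simp add: algebra_simps)
  finally show ?thesis by (simp add: power2_eq_square)
qed

lemma sqrt_truncation_square_le:
  fixes y c :: real
  assumes "0 \<le> y" "0 < c"
  shows "(min (sqrt y) (sqrt c) - sqrt y)\<^sup>2 \<le> y\<^sup>2 / c"
proof (cases "y \<le> c")
  case True
  then show ?thesis using assms by (simp add: min_absorb1)
next
  case False
  then have "(min (sqrt y) (sqrt c) - sqrt y)\<^sup>2 = (sqrt c - sqrt y)\<^sup>2" by (simp add: min_absorb2)
  also have "\<dots> \<le> \<bar>c - y\<bar>" using assms by (intro sqrt_diff_square_le) auto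
  also have "\<dots> \<le> y" using False assms by simp
  also have "\<dots> \<le> y\<^sup>2 / c" using False assms by (simp add: field_simps power2_eq_square mult_mono)
  finally show ?thesis .
qed

lemma rate_cell_iff:
  assumes "0 < k" "0 < R"
  shows "R \<in> rate_cell k i \<longleftrightarrow> i = nat (\<lceil>R * real k\<rceil> - 1)"
proof -
  have "R \<in> rate_cell k i \<longleftrightarrow> real i < R * real k \<and> R * real k \<le> real i + 1"
    using assms(1) by (simp add: rate_cell_def field_simps)
  also have "\<dots> \<longleftrightarrow> \<lceil>R * real k\<rceil> = int i + 1"
    by (simp add: ceiling_eq_iff)
  also have "\<dots> \<longleftrightarrow> i = nat (\<lceil>R * real k\<rceil> - 1)"
    using assms by (auto simp: ceiling_le_iff less_ceiling_iff)
  finally show ?thesis .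
qed

lemma time_cell_iff:
  assumes "0 < k"
  shows "s \<in> time_cell t k j \<longleftrightarrow> s \<le> t \<and> j = nat \<lfloor>(t - s) * real k\<rfloor>"
proof -
  have "s \<in> time_cell t k j \<longleftrightarrow> real j \<le> (t - s) * real k \<and> (t - s) * real k < real j + 1"
    using assms by (auto simp add: time_cell_def cell_start_def field_simps)
  also have "\<dots> \<longleftrightarrow> \<lfloor>(t - s) * real k\<rfloor> = int j"
    by (simp add: floor_eq_iff)
  also have "\<dots> \<longleftrightarrow> s \<le> t \<and> j = nat \<lfloor>(t - s) * real k\<rfloor>"
  proof -
    have "s \<le> t \<longleftrightarrow> 0 \<le> \<lfloor>(t - s) * real k\<rfloor>"
      using assms by (simp add: zero_le_mult_iff)
    moreover have "f = int j \<longleftrightarrow> 0 \<le> f \<and> j = nat f" for f by auto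
    ultimately show ?thesis by blast
  qed
  finally show ?thesis .
qed

lemma grid_kernel_eq:
  assumes k: "0 < k" and R: "0 < R" and s: "s \<le> t"
  defines "i \<equiv> nat (\<lceil>R * real k\<rceil> - 1)" and "j \<equiv> nat \<lfloor>(t - s) * real k\<rfloor>"
  shows "grid_kernel \<sigma> t k (R, s) = (if i < k\<^sup>2 \<and> j < k\<^sup>2 then grid_coef \<sigma> k i j else 0)"
proof -
  have "grid_kernel \<sigma> t k (R, s) = (\<Sum>i'<k\<^sup>2. \<Sum>j'<k\<^sup>2. if i' = i then (if j' = j then grid_coef \<sigma> k i j else 0) else 0)"
    unfolding grid_kernel_def using s
    by (intro sum.cong refl) (auto simp: indicator_def rate_cell_iff[OF k R] time_cell_iff[OF k] i_def j_def)
  also have "\<dots> = (\<Sum>i'<k\<^sup>2. if i' = i then (\<Sum>j'<k\<^sup>2. if j' = j then grid_coef \<sigma> k i j else 0) else 0)"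
    by (intro sum.cong refl) auto
  finally show ?thesis by simp
qed

lemma grid_kernel_future:
  assumes "0 < k" "t < s" shows "grid_kernel \<sigma> t k (R, s) = 0"
  unfolding grid_kernel_def using assms by (intro sum.neutral ballI) (simp add: time_cell_iff)

text \<open>At a given time at most one time cell is hit, so the random coefficient can be pulled out
  of the sum.\<close>

lemma grid_kernel_factor:
  assumes k: "0 < k"
  shows "(\<Sum>i<k\<^sup>2. \<Sum>j<k\<^sup>2. (grid_coef \<sigma> k i j * v (cell_start t k j)) * indicator (rate_cell k i) R * indicator (time_cell t k j) s) =
     grid_kernel \<sigma> t k (R, s) * v (cell_start t k (nat \<lfloor>(t - s) * real k\<rfloor>))"
  unfolding grid_kernel_def sum_distrib_right
  by (intro sum.cong refl) (auto simp: indicator_def time_cell_iff[OF k])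

lemma cell_start_near:
  assumes k: "0 < k" and s: "s \<le> t"
  shows "\<bar>cell_start t k (nat \<lfloor>(t - s) * real k\<rfloor>) - s\<bar> \<le> 1 / real k"
proof -
  have "s \<in> time_cell t k (nat \<lfloor>(t - s) * real k\<rfloor>)" using s by (simp add: time_cell_iff[OF k])
  then show ?thesis by (simp add: time_cell_def cell_start_def add_divide_distrib abs_le_iff)
qed

lemma grid_rate_bounds:
  fixes R :: real
  assumes k: "0 < k" and R: "0 < R"
  defines "i \<equiv> nat (\<lceil>R * real k\<rceil> - 1)"
  shows "real i / real k < R" "R \<le> real (i + 1) / real k"
  using rate_cell_iff[OF k R, of i] unfolding i_def by (auto simp: rate_cell_def)

lemma grid_time_bounds:
  fixes s t :: real
  assumes k: "0 < k" and s: "s \<le> t"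
  defines "j \<equiv> nat \<lfloor>(t - s) * real k\<rfloor>"
  shows "real j / real k \<le> t - s" "t - s < real (j + 1) / real k"
  using time_cell_iff[OF k, of s t j] s unfolding j_def by (auto simp: time_cell_def cell_start_def)

context supOUSV_model
begin

lemma grid_kernel_bounds:
  assumes k: "0 < k" and R: "0 < R" and sg: "0 \<le> \<sigma>"
  shows "0 \<le> grid_kernel \<sigma> t k (R, s)" "grid_kernel \<sigma> t k (R, s) \<le> vol_kernel \<sigma> t (R, s)"
proof -
  have "0 \<le> grid_kernel \<sigma> t k (R, s) \<and> grid_kernel \<sigma> t k (R, s) \<le> vol_kernel \<sigma> t (R, s)"
  proof (cases "s \<le> t")
    case True
    note i = grid_rate_bounds[OF k R] and j = grid_time_bounds[OF k True]
    let ?i = "nat (\<lceil>R * real k\<rceil> - 1)" and ?j = "nat \<lfloor>(t - s) * real k\<rfloor>"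
    have "R * (t - s) \<le> real (?i + 1) / real k * (real (?j + 1) / real k)"
      using i(2) j(2) R True by (intro mult_mono) auto
    then have "grid_coef \<sigma> k ?i ?j \<le> exp (- R * (t - s)) * (\<sigma> * sqrt R)"
      unfolding grid_coef_def using i(1) sg by (intro mult_mono) auto
    moreover have "0 \<le> grid_coef \<sigma> k ?i ?j" using sg by (simp add: grid_coef_def)
    ultimately show ?thesis using True R sg
      by (auto simp: grid_kernel_eq[OF k R True] vol_kernel_def)
  next
    case False
    then show ?thesis using k by (simp add: grid_kernel_future vol_kernel_def)
  qed
  then show "0 \<le> grid_kernel \<sigma> t k (R, s)" "grid_kernel \<sigma> t k (R, s) \<le> vol_kernel \<sigma> t (R, s)" by auto
qed

text \<open>The \<open>k\<^sup>2\<close> cells of width \<open>1/k\<close> cover rates and ages up to \<open>k\<close>, hence every point lies in the grid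
  from some index on.\<close>

lemma grid_kernel_tendsto:
  assumes R: "0 < R"
  shows "(\<lambda>n. grid_kernel \<sigma> t (Suc n) (R, s)) \<longlonglongrightarrow> vol_kernel \<sigma> t (R, s)"
proof (cases "s \<le> t")
  case True
  let ?i = "\<lambda>n. nat (\<lceil>R * real (Suc n)\<rceil> - 1)" and ?j = "\<lambda>n. nat \<lfloor>(t - s) * real (Suc n)\<rfloor>"
  note i = grid_rate_bounds[OF zero_less_Suc R] and j = grid_time_bounds[OF zero_less_Suc True]
  have inv: "(\<lambda>n. 1 / real (Suc n)) \<longlonglongrightarrow> 0" by (rule LIMSEQ_inverse_real_of_nat[unfolded inverse_eq_divide])
  have Suc: "real (m + 1) / real (Suc n) = real m / real (Suc n) + 1 / real (Suc n)" for m n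
    by (simp only: of_nat_add of_nat_1 add_divide_distrib)
  have i_lim: "(\<lambda>n. real (?i n) / real (Suc n)) \<longlonglongrightarrow> R"
  proof (rule tendsto_sandwich[OF always_eventually always_eventually _ tendsto_const])
    show "(\<lambda>n. R - 1 / real (Suc n)) \<longlonglongrightarrow> R" using tendsto_diff[OF tendsto_const inv, of R] by simp
    show "\<forall>n. R - 1 / real (Suc n) \<le> real (?i n) / real (Suc n)"
    proof
      fix n show "R - 1 / real (Suc n) \<le> real (?i n) / real (Suc n)" using i(2)[of n] unfolding Suc by linarith
    qed
    show "\<forall>n. real (?i n) / real (Suc n) \<le> R" using i(1) less_imp_le by blast
  qed
  have i1_lim: "(\<lambda>n. real (?i n + 1) / real (Suc n)) \<longlonglongrightarrow> R"
    unfolding Suc using tendsto_add[OF i_lim inv] by simp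
  have j_lim: "(\<lambda>n. real (?j n) / real (Suc n)) \<longlonglongrightarrow> t - s"
  proof (rule tendsto_sandwich[OF always_eventually always_eventually _ tendsto_const])
    show "(\<lambda>n. (t - s) - 1 / real (Suc n)) \<longlonglongrightarrow> t - s" using tendsto_diff[OF tendsto_const inv, of "t - s"] by simp
    show "\<forall>n. (t - s) - 1 / real (Suc n) \<le> real (?j n) / real (Suc n)"
    proof
      fix n show "(t - s) - 1 / real (Suc n) \<le> real (?j n) / real (Suc n)" using j(2)[of n] unfolding Suc by linarith
    qed
    show "\<forall>n. real (?j n) / real (Suc n) \<le> t - s" using j(1) by blast
  qed
  have j1_lim: "(\<lambda>n. real (?j n + 1) / real (Suc n)) \<longlonglongrightarrow> t - s"
    unfolding Suc using tendsto_add[OF j_lim inv] by simp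
  have "(\<lambda>n. grid_coef \<sigma> (Suc n) (?i n) (?j n)) \<longlonglongrightarrow> exp (- R * (t - s)) * (\<sigma> * sqrt R)"
    unfolding grid_coef_def by (intro tendsto_intros i_lim i1_lim j1_lim)
  moreover have "eventually (\<lambda>n. grid_kernel \<sigma> t (Suc n) (R, s) = grid_coef \<sigma> (Suc n) (?i n) (?j n)) sequentially"
  proof -
    \<comment> \<open>then both cell numbers are at most \<open>n (n + 1)\<close>, below the number of cells\<close>
    have "eventually (\<lambda>n. n \<ge> nat \<lceil>R\<rceil> \<and> n \<ge> nat \<lceil>t - s\<rceil>) sequentially"
      by (intro eventually_conj eventually_ge_at_top)
    then show ?thesis
    proof eventually_elim
      case (elim n)
      then have "R \<le> real n" "t - s \<le> real n" by linarith+
      have lt: "m < (Suc n)\<^sup>2" if "real m / real (Suc n) \<le> c" "c \<le> real n" for m c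
      proof -
        have "real m \<le> c * real (Suc n)" using that(1) by (subst (asm) pos_divide_le_eq) auto
        also have "\<dots> \<le> real n * real (Suc n)" using that(2) by (intro mult_right_mono) auto
        also have "\<dots> < real (Suc n) * real (Suc n)" by (intro mult_strict_right_mono) auto
        finally have "real m < real ((Suc n)\<^sup>2)" by (simp only: power2_eq_square of_nat_mult)
        then show ?thesis by (simp only: of_nat_less_iff)
      qed
      have "?i n < (Suc n)\<^sup>2" by (rule lt[OF less_imp_le[OF i(1)] \<open>R \<le> real n\<close>])
      moreover have "?j n < (Suc n)\<^sup>2" by (rule lt[OF j(1) \<open>t - s \<le> real n\<close>])
      ultimately show ?case by (simp only: grid_kernel_eq[OF zero_less_Suc R True] if_True simp_thms)
    qed
  qed
  ultimately show ?thesis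
    using True by (simp add: vol_kernel_def tendsto_cong)
next
  case False
  then show ?thesis by (simp add: grid_kernel_future vol_kernel_def)
qed

lemma grid_kernel_measurable [measurable]: "grid_kernel \<sigma> t k \<in> borel_measurable ctrl"
proof -
  have [measurable]: "rate_cell k i \<in> sets borel" "time_cell t k j \<in> sets borel" for i j
    by (auto simp: rate_cell_def time_cell_def)
  show ?thesis unfolding grid_kernel_def by measurable
qed

lemma grid_kernel_l2_limit:
  assumes sg: "0 \<le> \<sigma>"
  shows "(\<lambda>n. \<integral>\<^sup>+x. ennreal ((grid_kernel \<sigma> t (Suc n) x - vol_kernel \<sigma> t x)\<^sup>2) \<partial>ctrl) \<longlonglongrightarrow> 0"
proof -
  have "(\<lambda>n. \<integral>\<^sup>+x. ennreal ((grid_kernel \<sigma> t (Suc n) x - vol_kernel \<sigma> t x)\<^sup>2) \<partial>ctrl) \<longlonglongrightarrow> (\<integral>\<^sup>+x. 0 \<partial>ctrl)"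
  proof (rule nn_integral_dominated_convergence[where w = "\<lambda>x. ennreal ((vol_kernel \<sigma> t x)\<^sup>2)"])
    show "(\<integral>\<^sup>+x. ennreal ((vol_kernel \<sigma> t x)\<^sup>2) \<partial>ctrl) < \<infinity>"
      by (simp add: nn_integral_vol_kernel_square)
    show "AE x in ctrl. ennreal ((grid_kernel \<sigma> t (Suc n) x - vol_kernel \<sigma> t x)\<^sup>2) \<le> ennreal ((vol_kernel \<sigma> t x)\<^sup>2)" for n
    proof (intro AE_I2 ennreal_leI)
      fix x assume "x \<in> space ctrl"
      then obtain R s where x: "x = (R, s)" and R: "0 < R" by (auto simp: space_ctrl)
      show "(grid_kernel \<sigma> t (Suc n) x - vol_kernel \<sigma> t x)\<^sup>2 \<le> (vol_kernel \<sigma> t x)\<^sup>2"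
        using grid_kernel_bounds[OF zero_less_Suc R sg, of t n s] unfolding x
        by (intro abs_le_square_iff[THEN iffD1]) auto
    qed
    show "AE x in ctrl. (\<lambda>n. ennreal ((grid_kernel \<sigma> t (Suc n) x - vol_kernel \<sigma> t x)\<^sup>2)) \<longlonglongrightarrow> 0"
    proof (rule AE_I2)
      fix x assume "x \<in> space ctrl"
      then obtain R s where x: "x = (R, s)" and R: "0 < R" by (auto simp: space_ctrl)
      have "(\<lambda>n. ennreal ((grid_kernel \<sigma> t (Suc n) (R, s) - vol_kernel \<sigma> t (R, s))\<^sup>2)) \<longlonglongrightarrow>
         ennreal ((vol_kernel \<sigma> t (R, s) - vol_kernel \<sigma> t (R, s))\<^sup>2)"
        by (intro tendsto_intros grid_kernel_tendsto R)
      then show "(\<lambda>n. ennreal ((grid_kernel \<sigma> t (Suc n) x - vol_kernel \<sigma> t x)\<^sup>2)) \<longlonglongrightarrow> 0" by (simp add: x)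
    qed
  qed measurable
  then show ?thesis by simp
qed

text \<open>Coefficients of simple integrands have to be bounded, which forces a truncation.\<close>

definition trunc_vol :: "nat \<Rightarrow> real \<Rightarrow> 'a \<Rightarrow> real" where
  "trunc_vol k s \<omega> = min (sqrt (supOU N s \<omega>)) (sqrt (real k))"

definition vol_error :: "nat \<Rightarrow> real" where
  "vol_error k = 2 * ((supOU_mean\<^sup>2 + supOU_cov 0) / real k) + 2 * ((1 + jump_moment 2) / sqrt (real k))"

text \<open>The truncation error of \<open>sqrt y\<close> at \<open>sqrt k\<close> is at most \<open>y\<^sup>2 / k\<close> in square. The shift in time costs
  \<open>E \<bar>Y\<^sub>a - Y\<^sub>s\<bar>\<close>, which is bounded through \<open>\<bar>x\<bar> \<le> 1 / sqrt k + sqrt k x\<^sup>2\<close> by the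
  second moment of the increment; the weights balance because that moment is of order \<open>1/k\<close>.\<close>

lemma trunc_vol_error:
  assumes k: "0 < k" and a: "\<bar>a - s\<bar> \<le> 1 / real k"
  shows "(\<integral>\<^sup>+\<omega>. ennreal ((trunc_vol k a \<omega> - sqrt (supOU N s \<omega>))\<^sup>2) \<partial>M) \<le> ennreal (vol_error k)"
proof -
  let ?e = "1 / sqrt (real k)"
  let ?b = "\<lambda>\<omega>. 2 * (supOU N a \<omega> * supOU N a \<omega> / real k) + 2 * (?e + sqrt (real k) * (supOU N a \<omega> - supOU N s \<omega>)\<^sup>2)"
  have e: "0 < ?e" using k by simp
  have le: "(trunc_vol k a \<omega> - sqrt (supOU N s \<omega>))\<^sup>2 \<le> ?b \<omega>" if "\<omega> \<in> space M" for \<omega>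
  proof -
    note nn = supOU_nonneg[OF that, of a] supOU_nonneg[OF that, of s]
    have "(trunc_vol k a \<omega> - sqrt (supOU N s \<omega>))\<^sup>2 =
      ((trunc_vol k a \<omega> - sqrt (supOU N a \<omega>)) + (sqrt (supOU N a \<omega>) - sqrt (supOU N s \<omega>)))\<^sup>2" by simp
    also have "\<dots> \<le> 2 * (trunc_vol k a \<omega> - sqrt (supOU N a \<omega>))\<^sup>2 + 2 * (sqrt (supOU N a \<omega>) - sqrt (supOU N s \<omega>))\<^sup>2"
      by (rule order_trans[OF square_sum_weighted[OF zero_less_one]]) simp
    also have "(trunc_vol k a \<omega> - sqrt (supOU N a \<omega>))\<^sup>2 \<le> (supOU N a \<omega>)\<^sup>2 / real k"
      unfolding trunc_vol_def using nn k by (intro sqrt_truncation_square_le) auto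
    also have "(sqrt (supOU N a \<omega>) - sqrt (supOU N s \<omega>))\<^sup>2 \<le> \<bar>supOU N a \<omega> - supOU N s \<omega>\<bar>"
      using nn by (rule sqrt_diff_square_le)
    also have "\<dots> \<le> ?e + sqrt (real k) * (supOU N a \<omega> - supOU N s \<omega>)\<^sup>2"
    proof -
      have "x \<le> ?e + sqrt (real k) * x\<^sup>2" if "0 \<le> x" for x
      proof (cases "x \<le> ?e")
        case True
        moreover have "0 \<le> sqrt (real k) * x\<^sup>2" by simp
        ultimately show ?thesis by linarith
      next
        case False
        then have "1 \<le> sqrt (real k) * x" using k by (simp add: field_simps)
        then have "1 * x \<le> (sqrt (real k) * x) * x" using that by (rule mult_right_mono)
        then have "x \<le> sqrt (real k) * x\<^sup>2" by (simp add: power2_eq_square mult.assoc)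
        then show ?thesis using e by linarith
      qed
      from this[of "\<bar>supOU N a \<omega> - supOU N s \<omega>\<bar>"] show ?thesis by simp
    qed
    finally show ?thesis by (simp add: power2_eq_square)
  qed
  have int: "integrable M ?b"
    by (intro Bochner_Integration.integrable_add integrable_mult_right integrable_divide supOU_mult_integrable
      supOU_increment_square_integrable integrable_const)
  have "(\<integral>\<^sup>+\<omega>. ennreal ((trunc_vol k a \<omega> - sqrt (supOU N s \<omega>))\<^sup>2) \<partial>M) \<le> (\<integral>\<^sup>+\<omega>. ennreal (?b \<omega>) \<partial>M)"
    using le by (intro nn_integral_mono ennreal_leI)
  also have "\<dots> = ennreal (expectation ?b)"
  proof (rule nn_integral_eq_integral[OF int])
    show "AE \<omega> in M. 0 \<le> ?b \<omega>" using le by (intro AE_I2) (rule order_trans[OF zero_le_power2])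
  qed
  also have "expectation ?b = 2 * ((supOU_mean\<^sup>2 + supOU_cov 0) / real k)
      + 2 * (?e + sqrt (real k) * expectation (\<lambda>\<omega>. (supOU N a \<omega> - supOU N s \<omega>)\<^sup>2))"
    using supOU_mult_expectation[of a a] supOU_mult_integrable[of a a] supOU_increment_square_integrable[of a s]
    by (simp add: prob_space)
  also have "\<dots> \<le> vol_error k"
  proof -
    have "sqrt (real k) * expectation (\<lambda>\<omega>. (supOU N a \<omega> - supOU N s \<omega>)\<^sup>2) \<le> sqrt (real k) * (jump_moment 2 * (1 / real k))"
      using jump_moment_nonneg a
      by (intro mult_left_mono order_trans[OF supOU_increment_square]) auto
    also have "\<dots> = jump_moment 2 / sqrt (real k)"
      using k by (simp add: field_simps)
    finally show ?thesis unfolding vol_error_def by (simp add: add_divide_distrib)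
  qed
  finally show ?thesis by (simp add: ennreal_leI)
qed

lemma vol_error_tendsto: "(\<lambda>n. vol_error (Suc n)) \<longlonglongrightarrow> 0"
proof -
  have "(\<lambda>n. 2 * ((supOU_mean\<^sup>2 + supOU_cov 0) / real (Suc n)) + 2 * ((1 + jump_moment 2) / sqrt (real (Suc n)))) \<longlonglongrightarrow> 0"
    by real_asymp
  then show ?thesis by (simp add: vol_error_def)
qed


lemma measurable_to_jump_algebra: "(\<lambda>\<omega>. \<omega>) \<in> measurable M jump_algebra"
proof (rule measurableI)
  fix A assume "A \<in> sets jump_algebra"
  moreover have "sets jump_algebra \<subseteq> events"
    unfolding sets_jump_algebra using noises_indep unfolding indep_sets2_eq by (rule conjunct1)
  ultimately show "(\<lambda>\<omega>. \<omega>) -` A \<inter> space M \<in> events"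
    using sets.sets_into_space[of A M] by (auto simp: Int_absorb2)
qed simp

lemma joint_version_measurable:
  assumes "(\<lambda>(s, \<omega>). Y s \<omega>) \<in> borel_measurable (borel \<Otimes>\<^sub>M jump_algebra)"
  shows "(\<lambda>p. Y (snd (fst p)) (snd p)) \<in> borel_measurable (ctrl \<Otimes>\<^sub>M M)"
    "(\<lambda>p. Y (snd (fst p)) (snd p)) \<in> borel_measurable (ctrl \<Otimes>\<^sub>M jump_algebra)"
proof -
  have 1: "(\<lambda>p. (snd (fst p), snd p)) \<in> measurable (ctrl \<Otimes>\<^sub>M M) (borel \<Otimes>\<^sub>M jump_algebra)"
    by (intro measurable_Pair measurable_compose[OF measurable_fst ctrl_coordinates(2)]
        measurable_compose[OF measurable_snd measurable_to_jump_algebra])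
  show "(\<lambda>p. Y (snd (fst p)) (snd p)) \<in> borel_measurable (ctrl \<Otimes>\<^sub>M M)"
    using measurable_compose[OF 1 assms] by simp
  have 2: "(\<lambda>p. (snd (fst p), snd p)) \<in> measurable (ctrl \<Otimes>\<^sub>M jump_algebra) (borel \<Otimes>\<^sub>M jump_algebra)"
    by (intro measurable_Pair measurable_compose[OF measurable_fst ctrl_coordinates(2)] measurable_snd)
  show "(\<lambda>p. Y (snd (fst p)) (snd p)) \<in> borel_measurable (ctrl \<Otimes>\<^sub>M jump_algebra)"
    using measurable_compose[OF 2 assms] by simp
qed

lemma trunc_vol_bounds: "\<omega> \<in> space M \<Longrightarrow> 0 \<le> trunc_vol k s \<omega>" "trunc_vol k s \<omega> \<le> sqrt (real k)"
  using supOU_nonneg by (auto simp: trunc_vol_def)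

lemma trunc_vol_measurable [measurable]:
  "trunc_vol k s \<in> borel_measurable (F s)" "trunc_vol k s \<in> borel_measurable jump_algebra" "trunc_vol k s \<in> borel_measurable M"
  using supOU_adapted unfolding trunc_vol_def by measurable

definition grid_integrand :: "real \<Rightarrow> real \<Rightarrow> nat \<Rightarrow> real \<times> real \<Rightarrow> 'a \<Rightarrow> real" where
  "grid_integrand \<sigma> t k x \<omega> = (\<Sum>i<k\<^sup>2. \<Sum>j<k\<^sup>2.
     (\<lambda>(R, s) \<omega>. (grid_coef \<sigma> k i j * trunc_vol k (cell_start t k j) \<omega>) * indicator (rate_cell k i) R *
        indicator {cell_start t k j<..t - real j / real k} s) x \<omega>)"

definition grid_integral :: "real \<Rightarrow> real \<Rightarrow> nat \<Rightarrow> 'a \<Rightarrow> real" where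
  "grid_integral \<sigma> t k \<omega> = (\<Sum>i<k\<^sup>2. \<Sum>j<k\<^sup>2.
     (grid_coef \<sigma> k i j * trunc_vol k (cell_start t k j) \<omega>) * B (rate_cell k i \<times> {cell_start t k j<..t - real j / real k}) \<omega>)"

lemma rate_cell_sets: "rate_cell k i \<in> sets \<rho>"
proof -
  have "rate_cell k i \<subseteq> {0<..}"
  proof
    fix R assume "R \<in> rate_cell k i"
    moreover have "0 \<le> real i / real k" by simp
    ultimately show "R \<in> {0<..}" unfolding rate_cell_def by (simp del: divide_nonneg_nonneg)
  qed
  then show ?thesis
    unfolding sets_rho by (subst sets_restrict_space_iff) (auto simp: rate_cell_def)
qed

lemma grid_weight_bound:
  assumes "\<omega> \<in> space M"
  shows "\<bar>grid_coef \<sigma> k i j * trunc_vol k s \<omega>\<bar> \<le> \<bar>grid_coef \<sigma> k i j\<bar> * sqrt (real k)"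
  unfolding abs_mult using trunc_vol_bounds(1)[OF assms, of k s] trunc_vol_bounds(2)[of k s \<omega>]
  by (intro mult_left_mono) auto

lemma grid_simple: "simple_ito_integral M F \<rho> B (grid_integrand \<sigma> t k) (grid_integral \<sigma> t k)"
  unfolding grid_integrand_def[abs_def] grid_integral_def[abs_def]
proof (intro simple_sum finite_lessThan)
  fix i j :: nat
  show "simple_ito_integral M F \<rho> B
     (\<lambda>(R, s) \<omega>. grid_coef \<sigma> k i j * trunc_vol k (cell_start t k j) \<omega> * indicator (rate_cell k i) R *
        indicator {cell_start t k j<..t - real j / real k} s)
     (\<lambda>\<omega>. grid_coef \<sigma> k i j * trunc_vol k (cell_start t k j) \<omega> * B (rate_cell k i \<times> {cell_start t k j<..t - real j / real k}) \<omega>)"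
  proof (rule simple_cell)
    show "(\<lambda>\<omega>. grid_coef \<sigma> k i j * trunc_vol k (cell_start t k j) \<omega>) \<in> borel_measurable (F (cell_start t k j))"
      by (intro borel_measurable_times borel_measurable_const trunc_vol_measurable)
    show "cell_start t k j \<le> t - real j / real k"
      by (simp add: cell_start_def divide_right_mono)
  qed (use grid_weight_bound rate_cell_sets in auto)
qed

text \<open>The coefficients are functions of the jumps, so multiplying them by \<^term>\<open>G\<close> stays within the
  algebra of the jumps.\<close>

lemma grid_integral_orthogonal:
  assumes G: "G \<in> borel_measurable jump_algebra" "integrable M (\<lambda>\<omega>. (G \<omega>)\<^sup>2)"
  shows "expectation (\<lambda>\<omega>. G \<omega> * grid_integral \<sigma> t k \<omega>) = 0"
proof -
  let ?w = "\<lambda>i j \<omega>. grid_coef \<sigma> k i j * trunc_vol k (cell_start t k j) \<omega>"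
  let ?C = "\<lambda>i j. rate_cell k i \<times> {cell_start t k j<..t - real j / real k}"
  have GM: "G \<in> borel_measurable M" using G(1) by (rule measurable_jumpD)
  have Gi: "integrable M G" using GM G(2) by (rule square_integrable_imp_integrable)
  have w: "(\<lambda>\<omega>. ?w i j \<omega> * G \<omega>) \<in> borel_measurable jump_algebra" "integrable M (\<lambda>\<omega>. ?w i j \<omega> * G \<omega>)" for i j
  proof -
    show "(\<lambda>\<omega>. ?w i j \<omega> * G \<omega>) \<in> borel_measurable jump_algebra"
      by (intro borel_measurable_times borel_measurable_const trunc_vol_measurable G)
    show "integrable M (\<lambda>\<omega>. ?w i j \<omega> * G \<omega>)"
      using grid_weight_bound[of _ \<sigma> k i j "cell_start t k j"]
      by (intro integrable_bounded_mult Gi borel_measurable_times borel_measurable_const trunc_vol_measurable) auto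
  qed
  note orth = jump_orthogonal_noise[OF w cell_finite[OF rate_cell_sets]]
  have "expectation (\<lambda>\<omega>. G \<omega> * grid_integral \<sigma> t k \<omega>) =
    expectation (\<lambda>\<omega>. \<Sum>i<k\<^sup>2. \<Sum>j<k\<^sup>2. (?w i j \<omega> * G \<omega>) * B (?C i j) \<omega>)"
    unfolding grid_integral_def sum_distrib_left by (simp only: mult_ac)
  also have "\<dots> = (\<Sum>i<k\<^sup>2. expectation (\<lambda>\<omega>. \<Sum>j<k\<^sup>2. (?w i j \<omega> * G \<omega>) * B (?C i j) \<omega>))"
    by (intro Bochner_Integration.integral_sum Bochner_Integration.integrable_sum orth)
  also have "\<dots> = (\<Sum>i<k\<^sup>2. \<Sum>j<k\<^sup>2. expectation (\<lambda>\<omega>. (?w i j \<omega> * G \<omega>) * B (?C i j) \<omega>))"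
    by (intro sum.cong refl Bochner_Integration.integral_sum orth)
  also have "\<dots> = 0" by (intro sum.neutral ballI orth)
  finally show ?thesis .
qed

lemma grid_integrand_eq:
  assumes "0 < k"
  shows "grid_integrand \<sigma> t k (R, s) \<omega> = grid_kernel \<sigma> t k (R, s) * trunc_vol k (cell_start t k (nat \<lfloor>(t - s) * real k\<rfloor>)) \<omega>"
  unfolding grid_kernel_factor[OF assms, where v = "\<lambda>a. trunc_vol k a \<omega>", symmetric]
  by (simp only: grid_integrand_def split_conv time_cell_def)

text \<open>The error is split into \<open>g (V - sqrt Y)\<close> and \<open>(g - v) sqrt Y\<close>, where \<open>g \<le> v\<close> are the step kernel and the kernel
  and \<open>V\<close> is the truncated coefficient. The first part is small because of \<open>trunc_vol_error\<close>, the second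
  because \<open>g\<close> is close to \<open>v\<close>.\<close>

lemma grid_integrand_error:
  assumes k: "0 < k" and R: "0 < R" and sg: "0 \<le> \<sigma>"
  shows "(\<integral>\<^sup>+\<omega>. ennreal ((grid_integrand \<sigma> t k (R, s) \<omega> - vol_kernel \<sigma> t (R, s) * sqrt (supOU N s \<omega>))\<^sup>2) \<partial>M)
    \<le> ennreal ((vol_kernel \<sigma> t (R, s))\<^sup>2) * ennreal (2 * vol_error k) +
      ennreal ((grid_kernel \<sigma> t k (R, s) - vol_kernel \<sigma> t (R, s))\<^sup>2) * ennreal (2 * supOU_mean)"
proof (cases "s \<le> t")
  case True
  let ?g = "grid_kernel \<sigma> t k (R, s)" and ?v = "vol_kernel \<sigma> t (R, s)"
  let ?a = "cell_start t k (nat \<lfloor>(t - s) * real k\<rfloor>)"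
  note b = grid_kernel_bounds[OF k R sg, of t s]
  have "(\<integral>\<^sup>+\<omega>. ennreal ((grid_integrand \<sigma> t k (R, s) \<omega> - ?v * sqrt (supOU N s \<omega>))\<^sup>2) \<partial>M) \<le>
    (\<integral>\<^sup>+\<omega>. ennreal (2 * ?v\<^sup>2) * ennreal ((trunc_vol k ?a \<omega> - sqrt (supOU N s \<omega>))\<^sup>2) +
      ennreal (2 * (?g - ?v)\<^sup>2) * ennreal (supOU N s \<omega>) \<partial>M)"
  proof (rule nn_integral_mono)
    fix \<omega> assume \<omega>: "\<omega> \<in> space M"
    let ?y = "supOU N s \<omega>" and ?V = "trunc_vol k ?a \<omega>"
    have "(grid_integrand \<sigma> t k (R, s) \<omega> - ?v * sqrt ?y)\<^sup>2 = (?g * (?V - sqrt ?y) + (?g - ?v) * sqrt ?y)\<^sup>2"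
      by (simp add: grid_integrand_eq[OF k] algebra_simps)
    also have "\<dots> \<le> 2 * (?g * (?V - sqrt ?y))\<^sup>2 + 2 * ((?g - ?v) * sqrt ?y)\<^sup>2"
      by (rule order_trans[OF square_sum_weighted[OF zero_less_one]]) simp
    also have "\<dots> = 2 * ?g\<^sup>2 * (?V - sqrt ?y)\<^sup>2 + 2 * (?g - ?v)\<^sup>2 * ?y"
      using supOU_nonneg[OF \<omega>, of s] by (simp add: power_mult_distrib)
    also have "\<dots> \<le> 2 * ?v\<^sup>2 * (?V - sqrt ?y)\<^sup>2 + 2 * (?g - ?v)\<^sup>2 * ?y"
      using b by (intro add_right_mono mult_right_mono mult_left_mono power_mono) auto
    finally have "ennreal ((grid_integrand \<sigma> t k (R, s) \<omega> - ?v * sqrt ?y)\<^sup>2) \<le>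
       ennreal (2 * ?v\<^sup>2 * (?V - sqrt ?y)\<^sup>2 + 2 * (?g - ?v)\<^sup>2 * ?y)" by (rule ennreal_leI)
    also have "\<dots> = ennreal (2 * ?v\<^sup>2) * ennreal ((?V - sqrt ?y)\<^sup>2) + ennreal (2 * (?g - ?v)\<^sup>2) * ennreal ?y"
      using supOU_nonneg[OF \<omega>, of s] by (simp only: ennreal_plus[symmetric] ennreal_mult[symmetric] zero_le_power2
        mult_nonneg_nonneg zero_le_numeral)
    finally show "ennreal ((grid_integrand \<sigma> t k (R, s) \<omega> - ?v * sqrt ?y)\<^sup>2) \<le>
      ennreal (2 * ?v\<^sup>2) * ennreal ((?V - sqrt ?y)\<^sup>2) + ennreal (2 * (?g - ?v)\<^sup>2) * ennreal ?y" .
  qed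
  also have "\<dots> = ennreal (2 * ?v\<^sup>2) * (\<integral>\<^sup>+\<omega>. ennreal ((trunc_vol k ?a \<omega> - sqrt (supOU N s \<omega>))\<^sup>2) \<partial>M) +
      ennreal (2 * (?g - ?v)\<^sup>2) * ennreal supOU_mean"
    by (subst nn_integral_add) (auto simp: nn_integral_cmult nn_integral_supOU)
  also have "\<dots> \<le> ennreal (2 * ?v\<^sup>2) * ennreal (vol_error k) + ennreal (2 * (?g - ?v)\<^sup>2) * ennreal supOU_mean"
    using trunc_vol_error[OF k cell_start_near[OF k True]] by (intro add_right_mono mult_left_mono) auto
  also have "\<dots> = ennreal (?v\<^sup>2) * ennreal (2 * vol_error k) + ennreal ((?g - ?v)\<^sup>2) * ennreal (2 * supOU_mean)"
    by (simp add: ennreal_mult'[of 2]) (simp add: mult_ac)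
  finally show ?thesis .
next
  case False
  then show ?thesis using k by (simp add: grid_integrand_eq grid_kernel_future vol_kernel_def)
qed

section \<open>The volatility integral\<close>

text \<open>The integrand agrees with a jointly measurable function outside a null set, hence it is
  measurable for the completed product. The constant comes from
  \<open>\<integral> R exp (- 2 R (t - s)) ds = 1 / 2\<close> for every rate \<open>R\<close>.\<close>

lemma vol_integral_moments:
  fixes \<sigma> t :: real
  assumes sg: "0 \<le> \<sigma>"
  defines "J \<equiv> ito_integral M F \<rho> B (\<lambda>(R, s) \<omega>. indicator {..t} s * (exp (- R * (t - s)) * (\<sigma> * sqrt (R * supOU N s \<omega>))))"
  shows "J \<in> borel_measurable M" "integrable M (\<lambda>\<omega>. (J \<omega>)\<^sup>2)" "expectation (\<lambda>\<omega>. (J \<omega>)\<^sup>2) = 1 / 2 * \<sigma>\<^sup>2 * supOU_mean"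
    and "\<And>G. G \<in> borel_measurable jump_algebra \<Longrightarrow> integrable M (\<lambda>\<omega>. (G \<omega>)\<^sup>2) \<Longrightarrow> expectation (\<lambda>\<omega>. G \<omega> * J \<omega>) = 0"
proof -
  let ?\<phi> = "\<lambda>(R, s) \<omega>. indicator {..t} s * (exp (- R * (t - s)) * (\<sigma> * sqrt (R * supOU N s \<omega>)))"
  obtain Y where Yj: "(\<lambda>(s, \<omega>). Y s \<omega>) \<in> borel_measurable (borel \<Otimes>\<^sub>M jump_algebra)"
    and Y0: "\<And>s \<omega>. 0 \<le> Y s \<omega>" and Yeq: "AE \<omega> in M. \<forall>s. Y s \<omega> = supOU N s \<omega>"
    using supOU_joint_version by blast
  note [measurable] = joint_version_measurable(1)[OF Yj]
  let ?\<psi> = "\<lambda>p. vol_kernel \<sigma> t (fst p) * sqrt (Y (snd (fst p)) (snd p))"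
  have psi: "?\<psi> \<in> borel_measurable (ctrl \<Otimes>\<^sub>M M)" by measurable
  have AE: "AE p in ctrl \<Otimes>\<^sub>M M. ?\<psi> p = case_prod ?\<phi> p"
    using AE_product_snd[OF Yeq] by eventually_elim (simp add: case_prod_beta' vol_kernel_def real_sqrt_mult)
  have phiQ: "case_prod ?\<phi> \<in> borel_measurable Q"
    using completion.borel_measurable_AE_cong[OF measurable_completion[OF psi] AE_completion[OF AE]] .
  have inner: "(\<integral>\<^sup>+\<omega>. h (Y s \<omega>) \<omega> \<partial>M) = (\<integral>\<^sup>+\<omega>. h (supOU N s \<omega>) \<omega> \<partial>M)" for h :: "real \<Rightarrow> 'a \<Rightarrow> ennreal" and s
    using Yeq by (intro nn_integral_cong_AE) auto
  have lim: "(\<lambda>n. l2 Q (\<lambda>p. case_prod (grid_integrand \<sigma> t (Suc n)) p - case_prod ?\<phi> p)) \<longlonglongrightarrow> 0"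
  proof (rule tendsto_sandwich[OF always_eventually always_eventually tendsto_const])
    let ?b = "\<lambda>n. ennreal (\<sigma>\<^sup>2 / 2) * ennreal (2 * vol_error (Suc n)) +
      (\<integral>\<^sup>+x. ennreal ((grid_kernel \<sigma> t (Suc n) x - vol_kernel \<sigma> t x)\<^sup>2) \<partial>ctrl) * ennreal (2 * supOU_mean)"
    have "(\<lambda>n. ennreal (2 * vol_error (Suc n))) \<longlonglongrightarrow> ennreal (2 * 0)"
      by (intro tendsto_ennrealI tendsto_mult tendsto_const vol_error_tendsto)
    then have e0: "(\<lambda>n. ennreal (2 * vol_error (Suc n))) \<longlonglongrightarrow> 0" by simp
    have "?b \<longlonglongrightarrow> ennreal (\<sigma>\<^sup>2 / 2) * 0 + 0 * ennreal (2 * supOU_mean)"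
      by (intro tendsto_add ennreal_tendsto_cmult e0 tendsto_mult_ennreal tendsto_const grid_kernel_l2_limit sg) auto
    then show "?b \<longlonglongrightarrow> 0" by simp
    show "\<forall>n. l2 Q (\<lambda>p. case_prod (grid_integrand \<sigma> t (Suc n)) p - case_prod ?\<phi> p) \<le> ?b n"
    proof
      fix n
      let ?k = "Suc n"
      have gm[measurable]: "case_prod (grid_integrand \<sigma> t ?k) \<in> borel_measurable (ctrl \<Otimes>\<^sub>M M)"
        by (rule simple_isometry(3)[OF grid_simple])
      have "l2 Q (\<lambda>p. case_prod (grid_integrand \<sigma> t ?k) p - case_prod ?\<phi> p) =
        (\<integral>\<^sup>+p. ennreal ((case_prod (grid_integrand \<sigma> t ?k) p - ?\<psi> p)\<^sup>2) \<partial>(ctrl \<Otimes>\<^sub>M M))"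
        unfolding l2_def nn_integral_completion
      proof (rule nn_integral_cong_AE)
        show "AE p in ctrl \<Otimes>\<^sub>M M. ennreal ((case_prod (grid_integrand \<sigma> t ?k) p - case_prod ?\<phi> p)\<^sup>2) =
           ennreal ((case_prod (grid_integrand \<sigma> t ?k) p - ?\<psi> p)\<^sup>2)"
          using AE by eventually_elim simp
      qed
      also have "\<dots> = (\<integral>\<^sup>+x. \<integral>\<^sup>+\<omega>. ennreal ((grid_integrand \<sigma> t ?k x \<omega> - vol_kernel \<sigma> t x * sqrt (Y (snd x) \<omega>))\<^sup>2) \<partial>M \<partial>ctrl)"
        by (subst nn_integral_fst[symmetric]) auto
      also have "\<dots> = (\<integral>\<^sup>+x. \<integral>\<^sup>+\<omega>. ennreal ((grid_integrand \<sigma> t ?k x \<omega> - vol_kernel \<sigma> t x * sqrt (supOU N (snd x) \<omega>))\<^sup>2) \<partial>M \<partial>ctrl)"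
      proof (rule nn_integral_cong)
        fix x
        show "(\<integral>\<^sup>+\<omega>. ennreal ((grid_integrand \<sigma> t ?k x \<omega> - vol_kernel \<sigma> t x * sqrt (Y (snd x) \<omega>))\<^sup>2) \<partial>M) =
          (\<integral>\<^sup>+\<omega>. ennreal ((grid_integrand \<sigma> t ?k x \<omega> - vol_kernel \<sigma> t x * sqrt (supOU N (snd x) \<omega>))\<^sup>2) \<partial>M)"
          by (rule inner[of "\<lambda>y \<omega>. ennreal ((grid_integrand \<sigma> t ?k x \<omega> - vol_kernel \<sigma> t x * sqrt y)\<^sup>2)"])
      qed
      also have "\<dots> \<le> (\<integral>\<^sup>+x. ennreal ((vol_kernel \<sigma> t x)\<^sup>2) * ennreal (2 * vol_error ?k) +
          ennreal ((grid_kernel \<sigma> t ?k x - vol_kernel \<sigma> t x)\<^sup>2) * ennreal (2 * supOU_mean) \<partial>ctrl)"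
      proof (rule nn_integral_mono)
        fix x assume "x \<in> space ctrl"
        then obtain R s where x: "x = (R, s)" and R: "0 < R" by (auto simp: space_ctrl)
        show "(\<integral>\<^sup>+\<omega>. ennreal ((grid_integrand \<sigma> t ?k x \<omega> - vol_kernel \<sigma> t x * sqrt (supOU N (snd x) \<omega>))\<^sup>2) \<partial>M)
          \<le> ennreal ((vol_kernel \<sigma> t x)\<^sup>2) * ennreal (2 * vol_error ?k) +
          ennreal ((grid_kernel \<sigma> t ?k x - vol_kernel \<sigma> t x)\<^sup>2) * ennreal (2 * supOU_mean)"
          using grid_integrand_error[OF zero_less_Suc R sg, of t n s] by (simp only: x snd_conv)
      qed
      also have "\<dots> = ?b n"
        by (subst nn_integral_add) (auto simp: nn_integral_multc nn_integral_vol_kernel_square)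
      finally show "l2 Q (\<lambda>p. case_prod (grid_integrand \<sigma> t ?k) p - case_prod ?\<phi> p) \<le> ?b n" .
    qed
  qed simp
  note ito = ito_integral_of_approximation[OF phiQ grid_simple lim, folded J_def]
  show JM: "J \<in> borel_measurable M" by (rule ito)
  have "l2 M J = l2 Q (case_prod ?\<phi>)" by (rule ito)
  also have "\<dots> = (\<integral>\<^sup>+p. ennreal ((?\<psi> p)\<^sup>2) \<partial>(ctrl \<Otimes>\<^sub>M M))"
    unfolding l2_def nn_integral_completion
  proof (rule nn_integral_cong_AE)
    show "AE p in ctrl \<Otimes>\<^sub>M M. ennreal ((case_prod ?\<phi> p)\<^sup>2) = ennreal ((?\<psi> p)\<^sup>2)"
      using AE by eventually_elim simp
  qed
  also have "\<dots> = (\<integral>\<^sup>+x. \<integral>\<^sup>+\<omega>. ennreal ((vol_kernel \<sigma> t x * sqrt (Y (snd x) \<omega>))\<^sup>2) \<partial>M \<partial>ctrl)"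
    by (subst nn_integral_fst[symmetric]) auto
  also have "\<dots> = (\<integral>\<^sup>+x. ennreal ((vol_kernel \<sigma> t x)\<^sup>2) * ennreal supOU_mean \<partial>ctrl)"
  proof (rule nn_integral_cong)
    fix x
    have "(\<integral>\<^sup>+\<omega>. ennreal ((vol_kernel \<sigma> t x * sqrt (Y (snd x) \<omega>))\<^sup>2) \<partial>M) =
      (\<integral>\<^sup>+\<omega>. ennreal ((vol_kernel \<sigma> t x * sqrt (supOU N (snd x) \<omega>))\<^sup>2) \<partial>M)"
      by (rule inner[of "\<lambda>y \<omega>. ennreal ((vol_kernel \<sigma> t x * sqrt y)\<^sup>2)"])
    also have "\<dots> = (\<integral>\<^sup>+\<omega>. ennreal ((vol_kernel \<sigma> t x)\<^sup>2) * ennreal (supOU N (snd x) \<omega>) \<partial>M)"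
      using supOU_nonneg by (intro nn_integral_cong) (simp add: power_mult_distrib ennreal_mult)
    finally show "(\<integral>\<^sup>+\<omega>. ennreal ((vol_kernel \<sigma> t x * sqrt (Y (snd x) \<omega>))\<^sup>2) \<partial>M) = ennreal ((vol_kernel \<sigma> t x)\<^sup>2) * ennreal supOU_mean"
      by (simp add: nn_integral_cmult nn_integral_supOU)
  qed
  also have "\<dots> = ennreal (1 / 2 * \<sigma>\<^sup>2 * supOU_mean)"
    using supOU_mean_nonneg
    by (subst nn_integral_multc) (auto simp: nn_integral_vol_kernel_square ennreal_mult[symmetric])
  finally have L: "l2 M J = ennreal (1 / 2 * \<sigma>\<^sup>2 * supOU_mean)" .
  show J2: "integrable M (\<lambda>\<omega>. (J \<omega>)\<^sup>2)"
    using JM L by (intro integrable_of_l2_finite) simp_all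
  have "0 \<le> 1 / 2 * \<sigma>\<^sup>2 * supOU_mean" using supOU_mean_nonneg by simp
  moreover have "ennreal (expectation (\<lambda>\<omega>. (J \<omega>)\<^sup>2)) = ennreal (1 / 2 * \<sigma>\<^sup>2 * supOU_mean)"
    using L l2_eq_integral[OF J2] by simp
  ultimately show "expectation (\<lambda>\<omega>. (J \<omega>)\<^sup>2) = 1 / 2 * \<sigma>\<^sup>2 * supOU_mean"
    by (subst (asm) ennreal_inj) (auto intro!: integral_nonneg_AE)
  fix G :: "'a \<Rightarrow> real" assume G: "G \<in> borel_measurable jump_algebra" "integrable M (\<lambda>\<omega>. (G \<omega>)\<^sup>2)"
  show "expectation (\<lambda>\<omega>. G \<omega> * J \<omega>) = 0"
    by (rule orthogonal_l2_limit[OF measurable_jumpD[OF G(1)] JM simple_isometry(1)[OF grid_simple] G(2) J2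
        simple_isometry(2)[OF grid_simple] grid_integral_orthogonal[OF G] ito(2)])
qed

end

section \<open>Time integrals of the drift\<close>

lemma nn_integral_exp_pair_ordered:
  fixes a b r t :: real
  assumes "0 < a" "0 < b" "0 < r"
  shows "(\<integral>\<^sup>+s. \<integral>\<^sup>+u. ennreal (indicator {..t} s * exp (- a * (t - s))) *
      (ennreal (indicator {..s} u * exp (- b * (t - u))) * ennreal (exp (- r * (s - u)))) \<partial>lborel \<partial>lborel)
    = ennreal (1 / ((a + b) * (b + r)))"
proof -
  let ?f = "\<lambda>s u. ennreal (indicator {..t} s * exp (- a * (t - s))) *
      (ennreal (indicator {..s} u * exp (- b * (t - u))) * ennreal (exp (- r * (s - u))))"
  let ?p = "\<lambda>s. ennreal (indicator {..t} s * exp (- (a + b) * (t - s)))"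
    and ?q = "\<lambda>s u. ennreal (indicator {..s} u * exp (- (b + r) * (s - u)))"
  have "(\<integral>\<^sup>+u. ?f s u \<partial>lborel) =
      ennreal (1 / (b + r)) * ?p s" for s
  proof -
    have "(\<integral>\<^sup>+u. ?f s u \<partial>lborel) =
      (\<integral>\<^sup>+u. ?p s * ?q s u \<partial>lborel)"
    proof (rule nn_integral_cong)
      fix u
      have "- a * (t - s) + (- b * (t - u) + - r * (s - u)) = - (a + b) * (t - s) + - (b + r) * (s - u)"
        by (simp add: algebra_simps)
      then have "exp (- a * (t - s)) * (exp (- b * (t - u)) * exp (- r * (s - u))) = exp (- (a + b) * (t - s)) * exp (- (b + r) * (s - u))"
        by (simp only: exp_add[symmetric])
      then show "?f s u =
         ?p s * ?q s u"
        by (auto simp: indicator_def simp flip: ennreal_mult)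
    qed
    also have "\<dots> = ?p s * (\<integral>\<^sup>+u. ?q s u \<partial>lborel)"
      by (rule nn_integral_cmult) simp
    also have "\<dots> = ?p s * ennreal (1 / (b + r))"
      using assms by (subst nn_integral_exp_atMost) auto
    finally show ?thesis by (simp add: mult.commute)
  qed
  then have "(\<integral>\<^sup>+s. \<integral>\<^sup>+u. ?f s u \<partial>lborel \<partial>lborel) =
      (\<integral>\<^sup>+s. ennreal (1 / (b + r)) * ?p s \<partial>lborel)" by simp
  also have "\<dots> = ennreal (1 / (b + r)) * (\<integral>\<^sup>+s. ?p s \<partial>lborel)"
    by (rule nn_integral_cmult) simp
  also have "\<dots> = ennreal (1 / (b + r)) * ennreal (1 / (a + b))"
    using assms by (subst nn_integral_exp_atMost) auto
  also have "\<dots> = ennreal (1 / ((a + b) * (b + r)))"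
    using assms by (simp add: mult.commute flip: ennreal_mult)
  finally show ?thesis .
qed

text \<open>The half plane \<open>u < s\<close> is the ordered case, the other half is the ordered case with exchanged roles,
  and the diagonal is a null set.\<close>

lemma nn_integral_exp_pair:
  fixes a b r t :: real
  assumes pos: "0 < a" "0 < b" "0 < r"
  shows "(\<integral>\<^sup>+s. \<integral>\<^sup>+u. ennreal (indicator {..t} s * exp (- a * (t - s))) *
      (ennreal (indicator {..t} u * exp (- b * (t - u))) * ennreal (exp (- r * \<bar>s - u\<bar>))) \<partial>lborel \<partial>lborel)
    = ennreal (1 / (a + b) * (1 / (b + r) + 1 / (a + r)))"
proof -
  let ?g = "\<lambda>s u. ennreal (indicator {..t} s * exp (- a * (t - s))) *
      (ennreal (indicator {..t} u * exp (- b * (t - u))) * ennreal (exp (- r * \<bar>s - u\<bar>)))"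
  let ?f = "\<lambda>a b s u. ennreal (indicator {..t} s * exp (- a * (t - s))) *
      (ennreal (indicator {..s} u * exp (- b * (t - u))) * ennreal (exp (- r * (s - u))))"
  have [measurable]: "(\<lambda>p::real \<times> real. indicator {..fst p} (snd p) :: real) \<in> borel_measurable (borel \<Otimes>\<^sub>M borel)"
  proof -
    have "(\<lambda>p::real \<times> real. if snd p \<le> fst p then 1 else 0 :: real) \<in> borel_measurable (borel \<Otimes>\<^sub>M borel)" by measurable
    then show ?thesis by (rule measurable_cong[THEN iffD1, rotated]) (simp add: indicator_def)
  qed
  have slices [measurable]: "(\<lambda>p. ?f a b (fst p) (snd p)) \<in> borel_measurable (borel \<Otimes>\<^sub>M borel)"
    "(\<lambda>p. ?f b a (snd p) (fst p)) \<in> borel_measurable (borel \<Otimes>\<^sub>M borel)"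
  proof -
    have m: "(\<lambda>p. ?f a b (fst p) (snd p)) \<in> borel_measurable (borel \<Otimes>\<^sub>M borel)" for a b by measurable
    show "(\<lambda>p. ?f a b (fst p) (snd p)) \<in> borel_measurable (borel \<Otimes>\<^sub>M borel)" by (rule m)
    show "(\<lambda>p. ?f b a (snd p) (fst p)) \<in> borel_measurable (borel \<Otimes>\<^sub>M borel)"
      using measurable_compose[OF measurable_Pair[OF measurable_snd measurable_fst] m[of b a]] by simp
  qed
  have slices_l: "(\<lambda>(s, u). ?f b a u s) \<in> borel_measurable (lborel \<Otimes>\<^sub>M lborel)"
    unfolding measurable_cong_sets[OF sets_pair_measure_cong[OF sets_lborel sets_lborel] refl]
    using slices(2) by (simp add: case_prod_beta')
  have split: "(\<integral>\<^sup>+u. ?g s u \<partial>lborel) =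
      (\<integral>\<^sup>+u. ?f a b s u + ?f b a u s \<partial>lborel)" for s
  proof (rule nn_integral_cong_AE)
    show "AE u in lborel. ?g s u = ?f a b s u + ?f b a u s"
      using AE_lborel_singleton[of s]
    proof eventually_elim
      case (elim u)
      then consider "u < s" | "s < u" by linarith
      then show ?case
      proof cases
        case 1
        then show ?thesis by (cases "s \<le> t") (auto simp: indicator_def)
      next
        case 2
        then show ?thesis by (cases "u \<le> t") (auto simp: indicator_def mult_ac)
      qed
    qed
  qed
  have "(\<integral>\<^sup>+s. \<integral>\<^sup>+u. ?g s u \<partial>lborel \<partial>lborel) =
      (\<integral>\<^sup>+s. \<integral>\<^sup>+u. ?f a b s u + ?f b a u s \<partial>lborel \<partial>lborel)" by (simp only: split)
  also have "\<dots> = (\<integral>\<^sup>+s. (\<integral>\<^sup>+u. ?f a b s u \<partial>lborel) + (\<integral>\<^sup>+u. ?f b a u s \<partial>lborel) \<partial>lborel)"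
  proof (rule nn_integral_cong)
    fix s :: real
    have "(\<lambda>u. (s, u)) \<in> measurable borel (borel \<Otimes>\<^sub>M borel)" by simp
    from measurable_compose[OF this slices(1)] measurable_compose[OF this slices(2)]
    show "(\<integral>\<^sup>+u. ?f a b s u + ?f b a u s \<partial>lborel) = (\<integral>\<^sup>+u. ?f a b s u \<partial>lborel) + (\<integral>\<^sup>+u. ?f b a u s \<partial>lborel)"
      by (intro nn_integral_add) simp_all
  qed
  also have "\<dots> = (\<integral>\<^sup>+s. \<integral>\<^sup>+u. ?f a b s u \<partial>lborel \<partial>lborel) + (\<integral>\<^sup>+s. \<integral>\<^sup>+u. ?f b a u s \<partial>lborel \<partial>lborel)"
    by (intro nn_integral_add lborel.borel_measurable_nn_integral) (use slices_l in \<open>simp_all add: case_prod_beta'\<close>)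
  also have "(\<integral>\<^sup>+s. \<integral>\<^sup>+u. ?f b a u s \<partial>lborel \<partial>lborel) = (\<integral>\<^sup>+u. \<integral>\<^sup>+s. ?f b a u s \<partial>lborel \<partial>lborel)"
    by (rule lborel_pair.Fubini'[symmetric]) (rule slices_l)
  also have "(\<integral>\<^sup>+s. \<integral>\<^sup>+u. ?f a b s u \<partial>lborel \<partial>lborel) + (\<integral>\<^sup>+u. \<integral>\<^sup>+s. ?f b a u s \<partial>lborel \<partial>lborel) =
     ennreal (1 / ((a + b) * (b + r))) + ennreal (1 / ((b + a) * (a + r)))"
    by (simp only: nn_integral_exp_pair_ordered pos)
  also have "\<dots> = ennreal (1 / (a + b) * (1 / (b + r) + 1 / (a + r)))"
    using pos by (simp add: distrib_left add.commute flip: ennreal_plus)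
  finally show ?thesis .
qed

lemma (in prob_space) nn_integral_bounded:
  fixes f :: "'a \<Rightarrow> real"
  assumes [measurable]: "f \<in> borel_measurable M" and b: "AE x in M. 0 \<le> f x \<and> f x \<le> C"
  shows "(\<integral>\<^sup>+x. ennreal (f x) \<partial>M) = ennreal (\<integral>x. f x \<partial>M)" "0 \<le> (\<integral>x. f x \<partial>M)" "(\<integral>x. f x \<partial>M) \<le> C"
proof -
  have i: "integrable M f"
    using b by (intro integrable_const_bound[of _ C]) auto
  show "(\<integral>\<^sup>+x. ennreal (f x) \<partial>M) = ennreal (\<integral>x. f x \<partial>M)"
    using i b by (intro nn_integral_eq_integral) auto
  show "0 \<le> (\<integral>x. f x \<partial>M)" using b by (intro integral_nonneg_AE) auto
  have "(\<integral>x. f x \<partial>M) \<le> (\<integral>x. C \<partial>M)" using i b by (intro integral_mono_AE) auto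
  then show "(\<integral>x. f x \<partial>M) \<le> C" by (simp add: prob_space)
qed

context supOUSV_model
begin

text \<open>The rate measures live on the positive half line only. Their images on the whole line
  allow the repeated integrals below to be treated as parameter integrals over Borel sets; they
  change no integral.\<close>

definition "pib = distr \<pi> borel (\<lambda>r. r)"
definition "rhob = distr \<rho> borel (\<lambda>R. R)"

lemma rho_ident: "(\<lambda>R. R) \<in> borel_measurable \<rho>"
  by (rule borel_measurable_rho) simp

lemma sets_pib [simp, measurable_cong]: "sets pib = sets borel"
  and sets_rhob [simp, measurable_cong]: "sets rhob = sets borel"
  by (simp_all add: pib_def rhob_def)

sublocale pib: prob_space pib
  unfolding pib_def by (rule pi.prob_space_distr[OF ident_measurable(1)])

sublocale rhob: prob_space rhob
  unfolding rhob_def by (rule rho.prob_space_distr[OF rho_ident])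

sublocale lborel_rhob: pair_sigma_finite lborel rhob ..
sublocale lborel_pib: pair_sigma_finite lborel pib ..

lemma nn_integral_pib: "f \<in> borel_measurable borel \<Longrightarrow> (\<integral>\<^sup>+r. f r \<partial>pib) = (\<integral>\<^sup>+r. f r \<partial>\<pi>)"
  by (simp add: pib_def nn_integral_distr[OF ident_measurable(1)])

lemma nn_integral_rhob: "f \<in> borel_measurable borel \<Longrightarrow> (\<integral>\<^sup>+r. f r \<partial>rhob) = (\<integral>\<^sup>+r. f r \<partial>\<rho>)"
  by (simp add: rhob_def nn_integral_distr[OF rho_ident])

lemma integral_pib: "f \<in> borel_measurable borel \<Longrightarrow> (\<integral>r. f r \<partial>pib) = (\<integral>r. f r \<partial>\<pi>)" for f :: "real \<Rightarrow> real"
  unfolding pib_def by (rule integral_distr[OF ident_measurable(1)])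

lemma integral_rhob: "f \<in> borel_measurable borel \<Longrightarrow> (\<integral>r. f r \<partial>rhob) = (\<integral>r. f r \<partial>\<rho>)" for f :: "real \<Rightarrow> real"
  unfolding rhob_def by (rule integral_distr[OF rho_ident])

lemma AE_pib_pos: "AE r in pib. 0 < r"
  unfolding pib_def by (subst AE_distr_iff[OF ident_measurable(1)]) (auto intro!: AE_I2 simp: space_pi)

lemma AE_rhob_pos: "AE R in rhob. 0 < R"
  unfolding rhob_def by (subst AE_distr_iff[OF rho_ident]) (auto intro!: AE_I2 simp: space_rho)

lemma integrable_pib_inverse: "integrable pib (\<lambda>r. 1 / r)"
  unfolding pib_def by (subst integrable_distr_eq[OF ident_measurable(1)]) (auto intro: pi_inverse)

definition drift_kernel :: "real \<Rightarrow> real \<times> real \<Rightarrow> real" where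
  "drift_kernel t x = indicator {..t} (snd x) * (fst x * exp (- fst x * (t - snd x)))"

lemma drift_kernel_measurable [measurable]:
  "drift_kernel t \<in> borel_measurable ctrl" "drift_kernel t \<in> borel_measurable (borel \<Otimes>\<^sub>M borel)"
  unfolding drift_kernel_def by measurable

lemma drift_kernel_nonneg: "x \<in> space ctrl \<Longrightarrow> 0 \<le> drift_kernel t x"
  by (auto simp: drift_kernel_def space_ctrl)

lemma nn_integral_ctrl_rhob:
  assumes f: "f \<in> borel_measurable ctrl" "f \<in> borel_measurable (borel \<Otimes>\<^sub>M borel)"
  shows "(\<integral>\<^sup>+x. f x \<partial>ctrl) = (\<integral>\<^sup>+R. \<integral>\<^sup>+s. f (R, s) \<partial>lborel \<partial>rhob)"
proof -
  note [measurable] = f(2)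
  have "(\<lambda>R. \<integral>\<^sup>+s. f (R, s) \<partial>lborel) \<in> borel_measurable borel"
    by (rule lborel.borel_measurable_nn_integral) simp
  then show ?thesis by (simp add: nn_integral_ctrl[OF f(1)] nn_integral_rhob)
qed

lemma nn_integral_drift_kernel_exp:
  assumes "0 < R" "0 \<le> r"
  shows "(\<integral>\<^sup>+s. ennreal (drift_kernel t (R, s)) * ennreal (exp (- r * \<bar>t - s\<bar>)) \<partial>lborel) = ennreal (R / (R + r))"
proof -
  have "(\<integral>\<^sup>+s. ennreal (drift_kernel t (R, s)) * ennreal (exp (- r * \<bar>t - s\<bar>)) \<partial>lborel) =
    (\<integral>\<^sup>+s. ennreal R * ennreal (indicator {..t} s * exp (- (R + r) * (t - s))) \<partial>lborel)"
  proof (rule nn_integral_cong)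
    fix s
    have "exp (- R * (t - s)) * exp (- r * (t - s)) = exp (- (R + r) * (t - s))"
      by (simp add: algebra_simps flip: exp_add)
    then show "ennreal (drift_kernel t (R, s)) * ennreal (exp (- r * \<bar>t - s\<bar>)) = ennreal R * ennreal (indicator {..t} s * exp (- (R + r) * (t - s)))"
      using assms by (cases "s \<le> t") (simp_all add: drift_kernel_def mult.assoc flip: ennreal_mult)
  qed
  also have "\<dots> = ennreal R * (\<integral>\<^sup>+s. ennreal (indicator {..t} s * exp (- (R + r) * (t - s))) \<partial>lborel)"
    by (rule nn_integral_cmult) simp
  also have "\<dots> = ennreal R * ennreal (1 / (R + r))"
    using assms by (subst nn_integral_exp_atMost) auto
  finally show ?thesis using assms by (simp flip: ennreal_mult)
qed

text \<open>Total mass one: this makes the drift part an average.\<close>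

lemma nn_integral_drift_kernel: "(\<integral>\<^sup>+x. ennreal (drift_kernel t x) \<partial>ctrl) = 1"
proof -
  have "(\<integral>\<^sup>+x. ennreal (drift_kernel t x) \<partial>ctrl) = (\<integral>\<^sup>+R. \<integral>\<^sup>+s. ennreal (drift_kernel t (R, s)) \<partial>lborel \<partial>\<rho>)"
    by (rule nn_integral_ctrl) measurable
  also have "\<dots> = (\<integral>\<^sup>+R. 1 \<partial>\<rho>)"
    using nn_integral_drift_kernel_exp[of _ 0 t] by (intro nn_integral_cong) (simp add: space_rho)
  finally show ?thesis by (simp add: rho.emeasure_space_1)
qed

lemma ennreal_cov:
  assumes "0 \<le> h"
  shows "ennreal (supOU_cov h) = (\<integral>\<^sup>+r. ennreal (jump_moment 2 / 2) * ennreal (1 / r) * ennreal (exp (- r * h)) \<partial>pib)"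
proof -
  have "ennreal (supOU_cov h) = ennreal (jump_moment 2) * ennreal (\<integral>r. exp (- r * h) / (2 * r) \<partial>\<pi>)"
    unfolding supOU_cov_def using jump_moment_nonneg by (rule ennreal_mult')
  also have "ennreal (\<integral>r. exp (- r * h) / (2 * r) \<partial>\<pi>) = (\<integral>\<^sup>+r. ennreal (exp (- r * h) / (2 * r)) \<partial>\<pi>)"
    using assms by (intro nn_integral_eq_integral[symmetric] integrable_exp_div AE_I2) (auto simp: space_pi)
  also have "\<dots> = (\<integral>\<^sup>+r. ennreal (exp (- r * h) / (2 * r)) \<partial>pib)"
    by (rule nn_integral_pib[symmetric]) measurable
  also have "ennreal (jump_moment 2) * \<dots> = (\<integral>\<^sup>+r. ennreal (jump_moment 2) * ennreal (exp (- r * h) / (2 * r)) \<partial>pib)"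
    by (rule nn_integral_cmult[symmetric]) measurable
  also have "\<dots> = (\<integral>\<^sup>+r. ennreal (jump_moment 2 / 2) * ennreal (1 / r) * ennreal (exp (- r * h)) \<partial>pib)"
  proof (rule nn_integral_cong_AE)
    show "AE r in pib. ennreal (jump_moment 2) * ennreal (exp (- r * h) / (2 * r)) =
        ennreal (jump_moment 2 / 2) * ennreal (1 / r) * ennreal (exp (- r * h))"
      using AE_pib_pos by eventually_elim (use jump_moment_nonneg in \<open>simp flip: ennreal_mult\<close>)
  qed
  finally show ?thesis .
qed

lemma cov_measurable [measurable]: "(\<lambda>h. supOU_cov h) \<in> borel_measurable borel"
proof -
  have "(\<lambda>h. jump_moment 2 * (\<integral>r. exp (- r * h) / (2 * r) \<partial>pib)) \<in> borel_measurable borel" by measurable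
  also have "(\<lambda>h. jump_moment 2 * (\<integral>r. exp (- r * h) / (2 * r) \<partial>pib)) = (\<lambda>h. supOU_cov h)"
    unfolding supOU_cov_def by (subst integral_pib) auto
  finally show ?thesis .
qed

text \<open>After exchanging the integrals over \<open>s\<close> and \<open>r\<close> the time integral is \<open>R / (R + r)\<close>, and the covariance
  contributes \<open>1 / r\<close>. The result is bounded by \<open>1 / r\<close>, so all integrals are finite.\<close>

lemma cross_kernel_cov:
  "(\<integral>\<^sup>+x. ennreal (drift_kernel t x) * ennreal (supOU_cov \<bar>t - snd x\<bar>) \<partial>ctrl) =
    ennreal (jump_moment 2 / 2 * (\<integral>R. \<integral>r. R / (r * (R + r)) \<partial>\<pi> \<partial>\<rho>))"
proof -
  let ?f = "\<lambda>R s r. ennreal (drift_kernel t (R, s)) * (ennreal (jump_moment 2 / 2) * ennreal (1 / r) * ennreal (exp (- r * \<bar>t - s\<bar>)))"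
  let ?c = "ennreal (jump_moment 2 / 2)"
  have "(\<integral>\<^sup>+x. ennreal (drift_kernel t x) * ennreal (supOU_cov \<bar>t - snd x\<bar>) \<partial>ctrl) =
    (\<integral>\<^sup>+R. \<integral>\<^sup>+s. ennreal (drift_kernel t (R, s)) * ennreal (supOU_cov \<bar>t - s\<bar>) \<partial>lborel \<partial>rhob)"
    by (subst nn_integral_ctrl_rhob) auto
  also have "\<dots> = (\<integral>\<^sup>+R. \<integral>\<^sup>+s. \<integral>\<^sup>+r. ?f R s r \<partial>pib \<partial>lborel \<partial>rhob)"
    by (simp add: ennreal_cov nn_integral_cmult)
  also have "\<dots> = (\<integral>\<^sup>+R. \<integral>\<^sup>+r. \<integral>\<^sup>+s. ?f R s r \<partial>lborel \<partial>pib \<partial>rhob)"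
    by (intro nn_integral_cong lborel_pib.Fubini'[symmetric]) measurable
  also have "\<dots> = (\<integral>\<^sup>+R. \<integral>\<^sup>+r. ?c * ennreal (R / (r * (R + r))) \<partial>pib \<partial>rhob)"
  proof (rule nn_integral_cong_AE)
    show "AE R in rhob. (\<integral>\<^sup>+r. \<integral>\<^sup>+s. ?f R s r \<partial>lborel \<partial>pib) =
       (\<integral>\<^sup>+r. ?c * ennreal (R / (r * (R + r))) \<partial>pib)"
      using AE_rhob_pos
    proof eventually_elim
      case (elim R)
      show ?case
      proof (rule nn_integral_cong_AE)
        show "AE r in pib. (\<integral>\<^sup>+s. ?f R s r \<partial>lborel) =
            ?c * ennreal (R / (r * (R + r)))"
          using AE_pib_pos
        proof eventually_elim
          case (elim r)
          have "(\<integral>\<^sup>+s. ?f R s r \<partial>lborel) =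
            (\<integral>\<^sup>+s. (?c * ennreal (1 / r)) * (ennreal (drift_kernel t (R, s)) * ennreal (exp (- r * \<bar>t - s\<bar>))) \<partial>lborel)"
            by (simp only: mult_ac)
          also have "\<dots> = (?c * ennreal (1 / r)) * (\<integral>\<^sup>+s. ennreal (drift_kernel t (R, s)) * ennreal (exp (- r * \<bar>t - s\<bar>)) \<partial>lborel)"
            by (rule nn_integral_cmult) measurable
          also have "\<dots> = (?c * ennreal (1 / r)) * ennreal (R / (R + r))"
            using \<open>0 < R\<close> \<open>0 < r\<close> by (simp only: nn_integral_drift_kernel_exp less_imp_le)
          also have "\<dots> = ?c * ennreal (R / (r * (R + r)))"
            using \<open>0 < R\<close> \<open>0 < r\<close> by (simp add: mult.assoc flip: ennreal_mult)
          finally show ?case .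
        qed
      qed
    qed
  qed
  also have "\<dots> = ?c * (\<integral>\<^sup>+R. \<integral>\<^sup>+r. ennreal (R / (r * (R + r))) \<partial>pib \<partial>rhob)"
    by (simp add: nn_integral_cmult)
  also have "(\<integral>\<^sup>+R. \<integral>\<^sup>+r. ennreal (R / (r * (R + r))) \<partial>pib \<partial>rhob) = ennreal (\<integral>R. \<integral>r. R / (r * (R + r)) \<partial>pib \<partial>rhob)"
  proof -
    let ?K = "\<integral>r. 1 / r \<partial>pib"
    have 1: "(\<integral>\<^sup>+r. ennreal (R / (r * (R + r))) \<partial>pib) = ennreal (\<integral>r. R / (r * (R + r)) \<partial>pib) \<and>
      0 \<le> (\<integral>r. R / (r * (R + r)) \<partial>pib) \<and> (\<integral>r. R / (r * (R + r)) \<partial>pib) \<le> ?K" if "0 < R" for R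
    proof -
      have b: "AE r in pib. 0 \<le> R / (r * (R + r)) \<and> R / (r * (R + r)) \<le> 1 / r"
        using AE_pib_pos
      proof eventually_elim
        case (elim r)
        have "R / (r * (R + r)) \<le> (R + r) / (r * (R + r))" using that elim by (intro divide_right_mono) auto
        also have "\<dots> = 1 / r" using that elim by simp
        finally show ?case using that elim by simp
      qed
      have i: "integrable pib (\<lambda>r. R / (r * (R + r)))"
      proof (rule Bochner_Integration.integrable_bound[OF integrable_pib_inverse])
        show "AE r in pib. norm (R / (r * (R + r))) \<le> norm (1 / r)"
          using b by eventually_elim (simp only: real_norm_def, linarith)
      qed measurable
      show ?thesis
        using b i by (auto intro!: nn_integral_eq_integral integral_nonneg_AE integral_mono_AE integrable_pib_inverse)
    qed
    have "(\<integral>\<^sup>+R. \<integral>\<^sup>+r. ennreal (R / (r * (R + r))) \<partial>pib \<partial>rhob) = (\<integral>\<^sup>+R. ennreal (\<integral>r. R / (r * (R + r)) \<partial>pib) \<partial>rhob)"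
      using AE_rhob_pos 1 by (intro nn_integral_cong_AE) auto
    also have "\<dots> = ennreal (\<integral>R. \<integral>r. R / (r * (R + r)) \<partial>pib \<partial>rhob)"
      using AE_rhob_pos 1 by (intro rhob.nn_integral_bounded(1)[of _ ?K]) auto
    finally show ?thesis .
  qed
  also have "(\<integral>R. \<integral>r. R / (r * (R + r)) \<partial>pib \<partial>rhob) = (\<integral>R. \<integral>r. R / (r * (R + r)) \<partial>\<pi> \<partial>\<rho>)"
  proof -
    have "(\<integral>R. \<integral>r. R / (r * (R + r)) \<partial>pib \<partial>rhob) = (\<integral>R. \<integral>r. R / (r * (R + r)) \<partial>pib \<partial>\<rho>)"
      by (rule integral_rhob) measurable
    also have "\<dots> = (\<integral>R. \<integral>r. R / (r * (R + r)) \<partial>\<pi> \<partial>\<rho>)" by (simp add: integral_pib)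
    finally show ?thesis .
  qed
  finally show ?thesis by (subst ennreal_mult') (auto simp: jump_moment_nonneg)
qed


definition drift_weight :: "real \<Rightarrow> real \<Rightarrow> real \<Rightarrow> real" where
  "drift_weight P R r = 1 / r * (P * R / (P + R)) * (1 / (P + r) + 1 / (R + r))"

lemma drift_weight_bounds:
  assumes "0 < P" "0 < R" "0 < r"
  shows "0 \<le> drift_weight P R r" "drift_weight P R r \<le> 2 * (1 / r)"
proof -
  show "0 \<le> drift_weight P R r" using assms by (simp add: drift_weight_def)
  have 1: "P * R / (P + R) * (1 / (P + r)) \<le> 1"
  proof -
    have "P * R \<le> (P + R) * (P + r)" using assms by (simp add: algebra_simps)
    then show ?thesis using assms by simp
  qed
  have 2: "P * R / (P + R) * (1 / (R + r)) \<le> 1"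
  proof -
    have "P * R \<le> (P + R) * (R + r)" using assms by (simp add: algebra_simps)
    then show ?thesis using assms by simp
  qed
  have "drift_weight P R r = 1 / r * (P * R / (P + R) * (1 / (P + r)) + P * R / (P + R) * (1 / (R + r)))"
    by (simp only: drift_weight_def mult.assoc distrib_left)
  also have "\<dots> \<le> 1 / r * 2"
  proof (rule mult_left_mono)
    show "P * R / (P + R) * (1 / (P + r)) + P * R / (P + R) * (1 / (R + r)) \<le> 2" using 1 2 by linarith
  qed (use assms in simp)
  finally show "drift_weight P R r \<le> 2 * (1 / r)" by simp
qed

lemma nn_integral_drift_weight:
  "(\<integral>\<^sup>+P. \<integral>\<^sup>+R. \<integral>\<^sup>+r. ennreal (drift_weight P R r) \<partial>pib \<partial>rhob \<partial>rhob) =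
    ennreal (\<integral>P. \<integral>R. \<integral>r. drift_weight P R r \<partial>\<pi> \<partial>\<rho> \<partial>\<rho>)"
proof -
  let ?K = "\<integral>r. 2 * (1 / r) \<partial>pib"
  have [measurable]: "(\<lambda>p. drift_weight (fst p) (fst (snd p)) (snd (snd p))) \<in> borel_measurable (borel \<Otimes>\<^sub>M (borel \<Otimes>\<^sub>M borel))"
    "(\<lambda>p. drift_weight P (fst p) (snd p)) \<in> borel_measurable (borel \<Otimes>\<^sub>M borel)"
    "(\<lambda>r. drift_weight P R r) \<in> borel_measurable borel" for P R
    unfolding drift_weight_def by measurable
  have [measurable]: "(\<lambda>R. \<integral>r. drift_weight P R r \<partial>pib) \<in> borel_measurable borel"
      "(\<lambda>P. \<integral>R. \<integral>r. drift_weight P R r \<partial>pib \<partial>rhob) \<in> borel_measurable borel" for P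
    unfolding drift_weight_def by measurable
  have 1: "(\<integral>\<^sup>+r. ennreal (drift_weight P R r) \<partial>pib) = ennreal (\<integral>r. drift_weight P R r \<partial>pib)"
     "0 \<le> (\<integral>r. drift_weight P R r \<partial>pib)" "(\<integral>r. drift_weight P R r \<partial>pib) \<le> ?K" if "0 < P" "0 < R" for P R
  proof -
    have b: "AE r in pib. 0 \<le> drift_weight P R r \<and> drift_weight P R r \<le> 2 * (1 / r)"
      using AE_pib_pos by eventually_elim (use drift_weight_bounds[OF that] in auto)
    have i: "integrable pib (\<lambda>r. drift_weight P R r)"
    proof (rule Bochner_Integration.integrable_bound[OF integrable_mult_right[OF integrable_pib_inverse, of 2]])
      show "AE r in pib. norm (drift_weight P R r) \<le> norm (2 * (1 / r))"
        using b by eventually_elim (simp only: real_norm_def, linarith)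
    qed measurable
    show "(\<integral>\<^sup>+r. ennreal (drift_weight P R r) \<partial>pib) = ennreal (\<integral>r. drift_weight P R r \<partial>pib)"
      using i b by (intro nn_integral_eq_integral) auto
    show "0 \<le> (\<integral>r. drift_weight P R r \<partial>pib)"
      using b by (intro integral_nonneg_AE) auto
    show "(\<integral>r. drift_weight P R r \<partial>pib) \<le> ?K"
      using b i by (intro integral_mono_AE integrable_mult_right integrable_pib_inverse) auto
  qed
  have 2: "(\<integral>\<^sup>+R. \<integral>\<^sup>+r. ennreal (drift_weight P R r) \<partial>pib \<partial>rhob) = ennreal (\<integral>R. \<integral>r. drift_weight P R r \<partial>pib \<partial>rhob)"
     "0 \<le> (\<integral>R. \<integral>r. drift_weight P R r \<partial>pib \<partial>rhob)" "(\<integral>R. \<integral>r. drift_weight P R r \<partial>pib \<partial>rhob) \<le> ?K" if P: "0 < P" for P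
  proof -
    have b: "AE R in rhob. 0 \<le> (\<integral>r. drift_weight P R r \<partial>pib) \<and> (\<integral>r. drift_weight P R r \<partial>pib) \<le> ?K"
      using AE_rhob_pos by eventually_elim (use 1[OF P] in auto)
    have "(\<integral>\<^sup>+R. \<integral>\<^sup>+r. ennreal (drift_weight P R r) \<partial>pib \<partial>rhob) = (\<integral>\<^sup>+R. ennreal (\<integral>r. drift_weight P R r \<partial>pib) \<partial>rhob)"
      using AE_rhob_pos 1[OF P] by (intro nn_integral_cong_AE) auto
    then show "(\<integral>\<^sup>+R. \<integral>\<^sup>+r. ennreal (drift_weight P R r) \<partial>pib \<partial>rhob) = ennreal (\<integral>R. \<integral>r. drift_weight P R r \<partial>pib \<partial>rhob)"
      using b by (simp add: rhob.nn_integral_bounded(1)[of _ ?K])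
    show "0 \<le> (\<integral>R. \<integral>r. drift_weight P R r \<partial>pib \<partial>rhob)" "(\<integral>R. \<integral>r. drift_weight P R r \<partial>pib \<partial>rhob) \<le> ?K"
      by (rule rhob.nn_integral_bounded(2)[OF _ b] rhob.nn_integral_bounded(3)[OF _ b], measurable)+
  qed
  have b: "AE P in rhob. 0 \<le> (\<integral>R. \<integral>r. drift_weight P R r \<partial>pib \<partial>rhob) \<and> (\<integral>R. \<integral>r. drift_weight P R r \<partial>pib \<partial>rhob) \<le> ?K"
    using AE_rhob_pos by eventually_elim (use 2 in auto)
  have "(\<integral>\<^sup>+P. \<integral>\<^sup>+R. \<integral>\<^sup>+r. ennreal (drift_weight P R r) \<partial>pib \<partial>rhob \<partial>rhob) =
    (\<integral>\<^sup>+P. ennreal (\<integral>R. \<integral>r. drift_weight P R r \<partial>pib \<partial>rhob) \<partial>rhob)"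
    using AE_rhob_pos 2 by (intro nn_integral_cong_AE) auto
  also have "\<dots> = ennreal (\<integral>P. \<integral>R. \<integral>r. drift_weight P R r \<partial>pib \<partial>rhob \<partial>rhob)"
    using b by (intro rhob.nn_integral_bounded(1)[of _ ?K]) measurable
  also have "(\<integral>P. \<integral>R. \<integral>r. drift_weight P R r \<partial>pib \<partial>rhob \<partial>rhob) = (\<integral>P. \<integral>R. \<integral>r. drift_weight P R r \<partial>pib \<partial>rhob \<partial>\<rho>)"
    by (rule integral_rhob) measurable
  also have "\<dots> = (\<integral>P. \<integral>R. \<integral>r. drift_weight P R r \<partial>pib \<partial>\<rho> \<partial>\<rho>)"
    by (intro Bochner_Integration.integral_cong refl integral_rhob) measurable
  also have "\<dots> = (\<integral>P. \<integral>R. \<integral>r. drift_weight P R r \<partial>\<pi> \<partial>\<rho> \<partial>\<rho>)"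
    by (intro Bochner_Integration.integral_cong refl integral_pib) measurable
  finally show ?thesis .
qed

lemma nn_integral_cong_rates:
  assumes "\<And>P R r. 0 < P \<Longrightarrow> 0 < R \<Longrightarrow> 0 < r \<Longrightarrow> f P R r = g P R r"
  shows "(\<integral>\<^sup>+P. \<integral>\<^sup>+R. \<integral>\<^sup>+r. f P R r \<partial>pib \<partial>rhob \<partial>rhob) = (\<integral>\<^sup>+P. \<integral>\<^sup>+R. \<integral>\<^sup>+r. g P R r \<partial>pib \<partial>rhob \<partial>rhob)"
  by (intro nn_integral_cong_AE eventually_mono[OF AE_rhob_pos] nn_integral_cong_AE[OF eventually_mono[OF AE_rhob_pos]]
      nn_integral_cong_AE[OF eventually_mono[OF AE_pib_pos]] assms)

text \<open>Three exchanges of integrals move both time integrals to the inside, where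
  \<open>nn_integral_exp_pair\<close> evaluates them.\<close>

lemma double_kernel_cov:
  "(\<integral>\<^sup>+x. ennreal (drift_kernel t x) * (\<integral>\<^sup>+y. ennreal (drift_kernel t y) * ennreal (supOU_cov \<bar>snd x - snd y\<bar>) \<partial>ctrl) \<partial>ctrl) =
    ennreal (jump_moment 2 / 2 * (\<integral>P. \<integral>R. \<integral>r. drift_weight P R r \<partial>\<pi> \<partial>\<rho> \<partial>\<rho>))"
proof -
  let ?c = "ennreal (jump_moment 2 / 2)"
  let ?k = "\<lambda>R s. ennreal (drift_kernel t (R, s))"
  let ?e = "\<lambda>r s u. ?c * ennreal (1 / r) * ennreal (exp (- r * \<bar>s - u\<bar>))"
  have inner: "(\<integral>\<^sup>+y. ennreal (drift_kernel t y) * ennreal (supOU_cov \<bar>s - snd y\<bar>) \<partial>ctrl) =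
    (\<integral>\<^sup>+R. \<integral>\<^sup>+u. \<integral>\<^sup>+r. ?k R u * ?e r s u \<partial>pib \<partial>lborel \<partial>rhob)" for s
  proof -
    have "(\<integral>\<^sup>+y. ennreal (drift_kernel t y) * ennreal (supOU_cov \<bar>s - snd y\<bar>) \<partial>ctrl) =
      (\<integral>\<^sup>+R. \<integral>\<^sup>+u. ?k R u * ennreal (supOU_cov \<bar>s - u\<bar>) \<partial>lborel \<partial>rhob)"
      by (subst nn_integral_ctrl_rhob) auto
    then show ?thesis by (simp add: ennreal_cov nn_integral_cmult)
  qed
  have "(\<integral>\<^sup>+x. ennreal (drift_kernel t x) * (\<integral>\<^sup>+y. ennreal (drift_kernel t y) * ennreal (supOU_cov \<bar>snd x - snd y\<bar>) \<partial>ctrl) \<partial>ctrl) =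
    (\<integral>\<^sup>+x. ennreal (drift_kernel t x) * (\<integral>\<^sup>+R. \<integral>\<^sup>+u. \<integral>\<^sup>+r. ?k R u * ?e r (snd x) u \<partial>pib \<partial>lborel \<partial>rhob) \<partial>ctrl)"
    by (simp only: inner)
  also have "\<dots> = (\<integral>\<^sup>+P. \<integral>\<^sup>+s. ?k P s * (\<integral>\<^sup>+R. \<integral>\<^sup>+u. \<integral>\<^sup>+r. ?k R u * ?e r s u \<partial>pib \<partial>lborel \<partial>rhob) \<partial>lborel \<partial>rhob)"
    by (subst nn_integral_ctrl_rhob) auto
  also have "\<dots> = (\<integral>\<^sup>+P. \<integral>\<^sup>+s. \<integral>\<^sup>+R. \<integral>\<^sup>+u. \<integral>\<^sup>+r. ?k P s * (?k R u * ?e r s u) \<partial>pib \<partial>lborel \<partial>rhob \<partial>lborel \<partial>rhob)"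
    by (simp add: nn_integral_cmult)
  also have "\<dots> = (\<integral>\<^sup>+P. \<integral>\<^sup>+R. \<integral>\<^sup>+s. \<integral>\<^sup>+u. \<integral>\<^sup>+r. ?k P s * (?k R u * ?e r s u) \<partial>pib \<partial>lborel \<partial>lborel \<partial>rhob \<partial>rhob)"
    by (intro nn_integral_cong lborel_rhob.Fubini'[symmetric]) measurable
  also have "\<dots> = (\<integral>\<^sup>+P. \<integral>\<^sup>+R. \<integral>\<^sup>+s. \<integral>\<^sup>+r. \<integral>\<^sup>+u. ?k P s * (?k R u * ?e r s u) \<partial>lborel \<partial>pib \<partial>lborel \<partial>rhob \<partial>rhob)"
    by (intro nn_integral_cong lborel_pib.Fubini'[symmetric]) measurable
  also have "\<dots> = (\<integral>\<^sup>+P. \<integral>\<^sup>+R. \<integral>\<^sup>+r. \<integral>\<^sup>+s. \<integral>\<^sup>+u. ?k P s * (?k R u * ?e r s u) \<partial>lborel \<partial>lborel \<partial>pib \<partial>rhob \<partial>rhob)"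
    by (intro nn_integral_cong lborel_pib.Fubini'[symmetric]) measurable
  also have "\<dots> = (\<integral>\<^sup>+P. \<integral>\<^sup>+R. \<integral>\<^sup>+r. ?c * ennreal (drift_weight P R r) \<partial>pib \<partial>rhob \<partial>rhob)"
  proof -
    have "(\<integral>\<^sup>+s. \<integral>\<^sup>+u. ?k P s * (?k R u * ?e r s u) \<partial>lborel \<partial>lborel) = ?c * ennreal (drift_weight P R r)"
      if pos: "0 < P" "0 < R" "0 < r" for P R r
    proof -
      let ?E = "\<lambda>a s. ennreal (indicator {..t} s * exp (- a * (t - s)))"
      let ?x = "?c * ennreal (1 / r) * ennreal P * ennreal R"
      have k: "?k a s = ennreal a * ?E a s" if "0 < a" for a s
        using that by (simp add: drift_kernel_def mult_ac flip: ennreal_mult)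
      have "(\<integral>\<^sup>+s. \<integral>\<^sup>+u. ?k P s * (?k R u * ?e r s u) \<partial>lborel \<partial>lborel) =
        (\<integral>\<^sup>+s. \<integral>\<^sup>+u. ?x * (?E P s * (?E R u * ennreal (exp (- r * \<bar>s - u\<bar>)))) \<partial>lborel \<partial>lborel)"
        by (simp only: k pos mult_ac)
      also have "\<dots> = (\<integral>\<^sup>+s. ?x * (\<integral>\<^sup>+u. ?E P s * (?E R u * ennreal (exp (- r * \<bar>s - u\<bar>))) \<partial>lborel) \<partial>lborel)"
        by (intro nn_integral_cong nn_integral_cmult) measurable
      also have "\<dots> = ?x * (\<integral>\<^sup>+s. \<integral>\<^sup>+u. ?E P s * (?E R u * ennreal (exp (- r * \<bar>s - u\<bar>))) \<partial>lborel \<partial>lborel)"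
        by (intro nn_integral_cmult) measurable
      also have "\<dots> = ?x * ennreal (1 / (P + R) * (1 / (R + r) + 1 / (P + r)))"
        by (simp only: nn_integral_exp_pair pos)
      also have "\<dots> = ?c * (ennreal (1 / r) * (ennreal P * (ennreal R * ennreal (1 / (P + R) * (1 / (R + r) + 1 / (P + r))))))"
        by (simp only: mult.assoc)
      also have "ennreal (1 / r) * (ennreal P * (ennreal R * ennreal (1 / (P + R) * (1 / (R + r) + 1 / (P + r))))) =
          ennreal (1 / r * (P * (R * (1 / (P + R) * (1 / (R + r) + 1 / (P + r))))))"
      proof -
        have mult4: "ennreal a * (ennreal b * (ennreal c * ennreal d)) = ennreal (a * (b * (c * d)))"
          if "0 \<le> a" "0 \<le> b" "0 \<le> c" "0 \<le> d" for a b c d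
          using that by (simp add: ennreal_mult)
        show ?thesis using pos by (intro mult4) auto
      qed
      also have "1 / r * (P * (R * (1 / (P + R) * (1 / (R + r) + 1 / (P + r))))) = drift_weight P R r"
        unfolding drift_weight_def by (simp add: mult_ac add.commute)
      finally show ?thesis .
    qed
    then show ?thesis by (rule nn_integral_cong_rates)
  qed
  also have "\<dots> = ?c * (\<integral>\<^sup>+P. \<integral>\<^sup>+R. \<integral>\<^sup>+r. ennreal (drift_weight P R r) \<partial>pib \<partial>rhob \<partial>rhob)"
    unfolding drift_weight_def by (simp add: nn_integral_cmult)
  also have "\<dots> = ?c * ennreal (\<integral>P. \<integral>R. \<integral>r. drift_weight P R r \<partial>\<pi> \<partial>\<rho> \<partial>\<rho>)"
    by (simp only: nn_integral_drift_weight)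
  finally show ?thesis by (subst ennreal_mult') (auto simp: jump_moment_nonneg)
qed


section \<open>Moments of the drift and of the whole process\<close>

text \<open>Here \<open>G\<close> is the average of the process under the drift kernel. All its moments come from the one identity
  \<open>E (Z G) = \<integral> k(R, s) E (Z Y\<^sub>s) \<rho>(dR) ds\<close>, with \<open>Z\<close> equal to \<open>1\<close>, to a value of the process, and to \<open>G\<close> itself.\<close>

lemma drift_moments:
  fixes t :: real
  obtains G where "G \<in> borel_measurable jump_algebra"
    "integrable M (\<lambda>\<omega>. (G \<omega>)\<^sup>2)" "expectation G = supOU_mean"
    "expectation (\<lambda>\<omega>. (G \<omega>)\<^sup>2) = supOU_mean\<^sup>2 + jump_moment 2 / 2 * (\<integral>P. \<integral>R. \<integral>r. drift_weight P R r \<partial>\<pi> \<partial>\<rho> \<partial>\<rho>)"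
    "expectation (\<lambda>\<omega>. G \<omega> * supOU N t \<omega>) = supOU_mean\<^sup>2 + jump_moment 2 / 2 * (\<integral>R. \<integral>r. R / (r * (R + r)) \<partial>\<pi> \<partial>\<rho>)"
    "\<And>\<mu> c. AE \<omega> in M. (\<integral>(R, s). indicator {..t} s * (exp (- R * (t - s)) * (R * \<mu> * (supOU N s \<omega> - c))) \<partial>ctrl) = \<mu> * (G \<omega> - c)"
proof -
  obtain Y where Yj: "(\<lambda>(s, \<omega>). Y s \<omega>) \<in> borel_measurable (borel \<Otimes>\<^sub>M jump_algebra)"
    and Y0: "\<And>s \<omega>. 0 \<le> Y s \<omega>" and Yeq: "AE \<omega> in M. \<forall>s. Y s \<omega> = supOU N s \<omega>"
    using supOU_joint_version by blast
  let ?k = "\<lambda>x. ennreal (drift_kernel t x)"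
  let ?C = "\<integral>R. \<integral>r. R / (r * (R + r)) \<partial>\<pi> \<partial>\<rho>" and ?D = "\<integral>P. \<integral>R. \<integral>r. drift_weight P R r \<partial>\<pi> \<partial>\<rho> \<partial>\<rho>"
  define H where "H \<omega> = (\<integral>\<^sup>+x. ?k x * ennreal (Y (snd x) \<omega>) \<partial>ctrl)" for \<omega>
  define G where "G \<omega> = enn2real (H \<omega>)" for \<omega>
  have HJ: "H \<in> borel_measurable jump_algebra"
    unfolding H_def
  proof (rule ctrl.borel_measurable_nn_integral)
    note [measurable] = joint_version_measurable(2)[OF Yj]
    have [measurable]: "(\<lambda>p. Y (snd (snd p)) (fst p)) \<in> borel_measurable (jump_algebra \<Otimes>\<^sub>M ctrl)"
      using measurable_compose[OF measurable_Pair[OF measurable_snd measurable_fst] joint_version_measurable(2)[OF Yj]] by simp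
    show "(\<lambda>(\<omega>, x). ?k x * ennreal (Y (snd x) \<omega>)) \<in> borel_measurable (jump_algebra \<Otimes>\<^sub>M ctrl)"
      unfolding case_prod_beta' by measurable
  qed
  then have GJ: "G \<in> borel_measurable jump_algebra" unfolding G_def by simp
  have [measurable]: "H \<in> borel_measurable M" using HJ by (rule measurable_jumpD)
  have [measurable]: "G \<in> borel_measurable M" using GJ by (rule measurable_jumpD)
  note [measurable] = joint_version_measurable(1)[OF Yj]
  have slice: "(\<lambda>x. Y (snd x) \<omega>) \<in> borel_measurable ctrl" if "\<omega> \<in> space M" for \<omega>
    using measurable_compose[OF measurable_Pair2'[OF that] joint_version_measurable(1)[OF Yj]] by simp
  have tonelli: "(\<integral>\<^sup>+\<omega>. Z \<omega> * H \<omega> \<partial>M) = (\<integral>\<^sup>+x. ?k x * (\<integral>\<^sup>+\<omega>. Z \<omega> * ennreal (supOU N (snd x) \<omega>) \<partial>M) \<partial>ctrl)"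
    if [measurable]: "Z \<in> borel_measurable M" for Z
  proof -
    have "(\<integral>\<^sup>+\<omega>. Z \<omega> * H \<omega> \<partial>M) = (\<integral>\<^sup>+\<omega>. \<integral>\<^sup>+x. Z \<omega> * (?k x * ennreal (Y (snd x) \<omega>)) \<partial>ctrl \<partial>M)"
      unfolding H_def using slice by (intro nn_integral_cong nn_integral_cmult[symmetric]) simp
    also have "\<dots> = (\<integral>\<^sup>+x. \<integral>\<^sup>+\<omega>. Z \<omega> * (?k x * ennreal (Y (snd x) \<omega>)) \<partial>M \<partial>ctrl)"
      by (rule ctrl_M.Fubini') (simp add: case_prod_beta')
    also have "\<dots> = (\<integral>\<^sup>+x. \<integral>\<^sup>+\<omega>. ?k x * (Z \<omega> * ennreal (supOU N (snd x) \<omega>)) \<partial>M \<partial>ctrl)"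
      using Yeq by (intro nn_integral_cong nn_integral_cong_AE) (auto simp: mult_ac)
    also have "\<dots> = (\<integral>\<^sup>+x. ?k x * (\<integral>\<^sup>+\<omega>. Z \<omega> * ennreal (supOU N (snd x) \<omega>) \<partial>M) \<partial>ctrl)"
      by (intro nn_integral_cong nn_integral_cmult) measurable
    finally show ?thesis .
  qed
  have EH: "(\<integral>\<^sup>+\<omega>. H \<omega> \<partial>M) = ennreal supOU_mean"
    using tonelli[of "\<lambda>_. 1"] by (simp add: nn_integral_supOU nn_integral_multc nn_integral_drift_kernel)
  have EHY: "(\<integral>\<^sup>+\<omega>. ennreal (supOU N s \<omega>) * H \<omega> \<partial>M) =
     ennreal (supOU_mean\<^sup>2) + (\<integral>\<^sup>+y. ?k y * ennreal (supOU_cov \<bar>s - snd y\<bar>) \<partial>ctrl)" for s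
  proof -
    have "(\<integral>\<^sup>+\<omega>. ennreal (supOU N s \<omega>) * H \<omega> \<partial>M) = (\<integral>\<^sup>+y. ?k y * ennreal (supOU_mean\<^sup>2) + ?k y * ennreal (supOU_cov \<bar>s - snd y\<bar>) \<partial>ctrl)"
      using supOU_cov_nonneg by (simp add: tonelli nn_integral_supOU_mult distrib_left)
    then show ?thesis
      by (simp add: nn_integral_add nn_integral_multc nn_integral_drift_kernel)
  qed
  have EHH: "(\<integral>\<^sup>+\<omega>. H \<omega> * H \<omega> \<partial>M) = ennreal (supOU_mean\<^sup>2) + ennreal (jump_moment 2 / 2 * ?D)"
  proof -
    have "(\<integral>\<^sup>+\<omega>. H \<omega> * H \<omega> \<partial>M) = (\<integral>\<^sup>+x. ?k x * (\<integral>\<^sup>+\<omega>. H \<omega> * ennreal (supOU N (snd x) \<omega>) \<partial>M) \<partial>ctrl)"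
      by (rule tonelli) measurable
    also have "\<dots> = (\<integral>\<^sup>+x. ?k x * (ennreal (supOU_mean\<^sup>2) + (\<integral>\<^sup>+y. ?k y * ennreal (supOU_cov \<bar>snd x - snd y\<bar>) \<partial>ctrl)) \<partial>ctrl)"
      by (simp only: mult.commute[of "H _"] EHY)
    also have "\<dots> = (\<integral>\<^sup>+x. ?k x * ennreal (supOU_mean\<^sup>2) \<partial>ctrl) +
      (\<integral>\<^sup>+x. ?k x * (\<integral>\<^sup>+y. ?k y * ennreal (supOU_cov \<bar>snd x - snd y\<bar>) \<partial>ctrl) \<partial>ctrl)"
      unfolding distrib_left by (rule nn_integral_add) measurable
    finally show ?thesis by (simp add: double_kernel_cov nn_integral_multc nn_integral_drift_kernel)
  qed
  have fin: "AE \<omega> in M. H \<omega> \<noteq> \<infinity>"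
    by (rule nn_integral_PInf_AE) (simp_all add: EH)
  then have GH: "AE \<omega> in M. ennreal (G \<omega>) = H \<omega>"
    by eventually_elim (simp add: G_def less_top)
  have G0: "0 \<le> G \<omega>" for \<omega> by (simp add: G_def)
  have pos: "0 \<le> jump_moment 2 / 2 * ?D" "0 \<le> jump_moment 2 / 2 * ?C"
    using jump_moment_nonneg
    by (auto intro!: mult_nonneg_nonneg integral_nonneg_AE AE_I2 simp: space_pi space_rho drift_weight_def)
  have G1: "has_bochner_integral M G supOU_mean"
    using EH nn_integral_cong_AE[OF GH] G0 supOU_mean_nonneg
    by (intro has_bochner_integral_nn_integral AE_I2) auto
  have G2: "has_bochner_integral M (\<lambda>\<omega>. (G \<omega>)\<^sup>2) (supOU_mean\<^sup>2 + jump_moment 2 / 2 * ?D)"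
  proof (rule has_bochner_integral_nn_integral)
    have "(\<integral>\<^sup>+\<omega>. ennreal ((G \<omega>)\<^sup>2) \<partial>M) = (\<integral>\<^sup>+\<omega>. H \<omega> * H \<omega> \<partial>M)"
    proof (rule nn_integral_cong_AE)
      show "AE \<omega> in M. ennreal ((G \<omega>)\<^sup>2) = H \<omega> * H \<omega>"
        using GH by eventually_elim (simp add: power2_eq_square ennreal_mult G0)
    qed
    then show "(\<integral>\<^sup>+\<omega>. ennreal ((G \<omega>)\<^sup>2) \<partial>M) = ennreal (supOU_mean\<^sup>2 + jump_moment 2 / 2 * ?D)"
      using pos(1) by (simp add: EHH)
  qed (use pos(1) in auto)
  have GY: "has_bochner_integral M (\<lambda>\<omega>. G \<omega> * supOU N t \<omega>) (supOU_mean\<^sup>2 + jump_moment 2 / 2 * ?C)"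
  proof (rule has_bochner_integral_nn_integral)
    have "(\<integral>\<^sup>+\<omega>. ennreal (G \<omega> * supOU N t \<omega>) \<partial>M) = (\<integral>\<^sup>+\<omega>. ennreal (supOU N t \<omega>) * H \<omega> \<partial>M)"
    proof (rule nn_integral_cong_AE)
      show "AE \<omega> in M. ennreal (G \<omega> * supOU N t \<omega>) = ennreal (supOU N t \<omega>) * H \<omega>"
        using GH AE_space by eventually_elim (simp add: ennreal_mult G0 supOU_nonneg mult.commute)
    qed
    then show "(\<integral>\<^sup>+\<omega>. ennreal (G \<omega> * supOU N t \<omega>) \<partial>M) = ennreal (supOU_mean\<^sup>2 + jump_moment 2 / 2 * ?C)"
      using pos(2) by (simp add: EHY cross_kernel_cov)
    show "AE \<omega> in M. 0 \<le> G \<omega> * supOU N t \<omega>" using G0 supOU_nonneg by (intro AE_I2) simp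
  qed (use pos(2) in auto)
  have drift: "AE \<omega> in M. (\<integral>(R, s). indicator {..t} s * (exp (- R * (t - s)) * (R * \<mu> * (supOU N s \<omega> - c))) \<partial>ctrl) = \<mu> * (G \<omega> - c)" for \<mu> c
    using fin Yeq AE_space
  proof eventually_elim
    case (elim \<omega>)
    note [measurable] = slice[OF elim(3)]
    have 1: "has_bochner_integral ctrl (\<lambda>x. drift_kernel t x * Y (snd x) \<omega>) (G \<omega>)"
    proof (rule has_bochner_integral_nn_integral)
      have "(\<integral>\<^sup>+x. ennreal (drift_kernel t x * Y (snd x) \<omega>) \<partial>ctrl) = H \<omega>"
        unfolding H_def by (intro nn_integral_cong) (simp add: ennreal_mult drift_kernel_nonneg Y0)
      then show "(\<integral>\<^sup>+x. ennreal (drift_kernel t x * Y (snd x) \<omega>) \<partial>ctrl) = ennreal (G \<omega>)"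
        using elim(1) by (simp add: G_def less_top)
    qed (use Y0 drift_kernel_nonneg G0 in auto)
    have 2: "has_bochner_integral ctrl (drift_kernel t) 1"
      using nn_integral_drift_kernel[of t] drift_kernel_nonneg
      by (intro has_bochner_integral_nn_integral AE_I2) auto
    have "has_bochner_integral ctrl (\<lambda>x. \<mu> * (drift_kernel t x * Y (snd x) \<omega>) - \<mu> * c * drift_kernel t x) (\<mu> * G \<omega> - \<mu> * c * 1)"
      by (intro has_bochner_integral_diff has_bochner_integral_mult_right 1 2)
    moreover have "(\<lambda>(R, s). indicator {..t} s * (exp (- R * (t - s)) * (R * \<mu> * (supOU N s \<omega> - c)))) =
      (\<lambda>x. \<mu> * (drift_kernel t x * Y (snd x) \<omega>) - \<mu> * c * drift_kernel t x)"
      using elim(2) by (auto simp: fun_eq_iff drift_kernel_def algebra_simps)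
    ultimately show ?case by (simp add: has_bochner_integral_iff right_diff_distrib)
  qed
  show thesis
    using that[of G, OF GJ _ _ _ _ drift] G1 G2 GY by (simp add: has_bochner_integral_iff)
qed

end

text \<open>The variable \<open>X\<^sub>t\<close> is almost surely \<open>Z = \<mu> (G - E Y) + J\<close>. Since \<open>J\<close> is orthogonal to \<open>1\<close>, \<open>G\<close> and
  \<open>Y\<^sub>t\<close>, the moments of \<open>Z\<close> are sums of those of the two parts.\<close>

theorem proposition1:
  fixes M :: "'a measure" and F :: "real \<Rightarrow> 'a measure"
    and \<nu> \<pi> \<rho> :: "real measure" and \<mu> \<sigma> Ybar Vbar :: real
    and N :: "'a \<Rightarrow> (real \<times> real \<times> real) measure"
    and B :: "(real \<times> real) set \<Rightarrow> 'a \<Rightarrow> real"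
    and X Y :: "real \<Rightarrow> 'a \<Rightarrow> real" and t t0 :: real
  assumes "prob_space M" and "complete_measure M"
    and "subordinator_levy_measure \<nu>"
    and "\<And>k::nat. k \<ge> 1 \<Longrightarrow> integrable \<nu> (\<lambda>z. z ^ k)"
    and "prob_on_positive_reals \<pi>" and "integrable \<pi> (\<lambda>r. 1 / r)"
    and "prob_on_positive_reals \<rho>"
    and "\<sigma> > 0"
    and "poisson_random_measure M (jump_intensity \<nu> \<pi>) N"
    and "gaussian_white_noise M (control_measure \<rho>) B"
    and "prob_space.indep_set M
           (gen_events M (\<lambda>A \<omega>. emeasure (N \<omega>) A) (sets (jump_intensity \<nu> \<pi>)))
           (gen_events M B (finite_sets (control_measure \<rho>)))"
    and "noise_filtration M F (jump_intensity \<nu> \<pi>) N (control_measure \<rho>) B"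
    and "Y = supOU N"
    and "Ybar = prob_space.expectation M (Y t0)"
    and "Vbar = prob_space.variance M (Y t0)"
    and "X = supOUSV M F \<rho> B \<mu> \<sigma> Ybar Y"
  shows "integrable M (X t) \<and> integrable M (\<lambda>\<omega>. (X t \<omega>)\<^sup>2) \<and> integrable M (\<lambda>\<omega>. X t \<omega> * Y t \<omega>) \<and>
    prob_space.expectation M (X t) = 0 \<and>
    prob_space.variance M (X t) =
      1 / 2 * \<sigma>\<^sup>2 * Ybar +
      \<mu>\<^sup>2 * Vbar * inverse (LINT r|\<pi>. 1 / r) *
        (LINT P|\<rho>. LINT R|\<rho>. LINT r|\<pi>.
           1 / r * (P * R / (P + R)) * (1 / (P + r) + 1 / (R + r))) \<and>
    prob_space.expectation M (\<lambda>\<omega>. X t \<omega> * Y t \<omega>) =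
      \<mu> * Vbar * inverse (LINT r|\<pi>. 1 / r) *
        (LINT R|\<rho>. LINT r|\<pi>. R / (r * (R + r)))"
proof -
  interpret prob_space M by fact
  interpret complete_measure M by fact
  have noise: "complete_filtration M F"
    "\<And>t A. A \<in> sets (jump_intensity \<nu> \<pi>) \<Longrightarrow> A \<subseteq> {..t} \<times> UNIV \<Longrightarrow> (\<lambda>\<omega>. emeasure (N \<omega>) A) \<in> borel_measurable (F t)"
    "\<And>t A. A \<in> finite_sets (control_measure \<rho>) \<Longrightarrow> A \<subseteq> UNIV \<times> {..t} \<Longrightarrow> B A \<in> borel_measurable (F t)"
    using \<open>noise_filtration M F _ N _ B\<close> unfolding noise_filtration_def by blast+
  have future: "indep_set (sets (F t)) (gen_events M B {A \<in> finite_sets (control_measure \<rho>). A \<subseteq> UNIV \<times> {t<..}})" for t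
  proof -
    let ?U = "gen_events M (\<lambda>A \<omega>. emeasure (N \<omega>) A) {A \<in> sets (jump_intensity \<nu> \<pi>). A \<subseteq> {t<..} \<times> UNIV} \<union>
           gen_events M B {A \<in> finite_sets (control_measure \<rho>). A \<subseteq> UNIV \<times> {t<..}}"
    have "indep_set (sets (F t)) (sigma_sets (space M) ?U)"
      using \<open>noise_filtration M F _ N _ B\<close> unfolding noise_filtration_def by blast
    moreover have "gen_events M B {A \<in> finite_sets (control_measure \<rho>). A \<subseteq> UNIV \<times> {t<..}} \<subseteq> sigma_sets (space M) ?U"
      by (auto intro: sigma_sets.Basic)
    ultimately show ?thesis unfolding indep_sets2_eq by (meson order_trans subsetD)
  qed
  interpret supOUSV_model M \<nu> \<pi> N \<rho> B F
    by unfold_locales (use assms noise future in blast)+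
  have Y: "Y = supOU N" by fact
  have Ybar: "Ybar = supOU_mean" using assms by (simp add: supOU_expectation)
  \<comment> \<open>the prefactor of both formulas only depends on the second moment of the jumps\<close>
  have Vbar: "Vbar * inverse (\<integral>r. 1 / r \<partial>\<pi>) = jump_moment 2 / 2"
  proof -
    have "Vbar = jump_moment 2 / 2 * mean_memory"
      using assms(13,15) by (simp only: supOU_variance supOU_cov_0)
    then show ?thesis using mean_memory_pos by (simp only: mean_memory_def[symmetric]) simp
  qed
  let ?C = "\<integral>R. \<integral>r. R / (r * (R + r)) \<partial>\<pi> \<partial>\<rho>" and ?D = "\<integral>P. \<integral>R. \<integral>r. drift_weight P R r \<partial>\<pi> \<partial>\<rho> \<partial>\<rho>"
  define J where "J = ito_integral M F \<rho> B (\<lambda>(R, s) \<omega>. indicator {..t} s * (exp (- R * (t - s)) * (\<sigma> * sqrt (R * supOU N s \<omega>))))"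
  note J = vol_integral_moments[OF less_imp_le[OF \<open>\<sigma> > 0\<close>], where t = t, folded J_def]
  obtain G where G: "G \<in> borel_measurable jump_algebra"
    "integrable M (\<lambda>\<omega>. (G \<omega>)\<^sup>2)" "expectation G = supOU_mean"
    "expectation (\<lambda>\<omega>. (G \<omega>)\<^sup>2) = supOU_mean\<^sup>2 + jump_moment 2 / 2 * ?D"
    "expectation (\<lambda>\<omega>. G \<omega> * supOU N t \<omega>) = supOU_mean\<^sup>2 + jump_moment 2 / 2 * ?C"
    and drift: "\<And>\<mu> c. AE \<omega> in M. (\<integral>(R, s). indicator {..t} s * (exp (- R * (t - s)) * (R * \<mu> * (supOU N s \<omega> - c))) \<partial>ctrl) = \<mu> * (G \<omega> - c)"
    using drift_moments[of t] by blast
  note GM[measurable] = measurable_jumpD[OF G(1)] and JM[measurable] = J(1)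
  have Gi: "integrable M G" by (rule square_integrable_imp_integrable[OF GM G(2)])
  have Ji: "integrable M J" by (rule square_integrable_imp_integrable[OF JM J(2)])
  have Y2: "integrable M (\<lambda>\<omega>. (supOU N t \<omega>)\<^sup>2)" using supOU_mult_integrable[of t t] by (simp add: power2_eq_square)
  define Z where "Z \<omega> = \<mu> * (G \<omega> - supOU_mean) + J \<omega>" for \<omega>
  have XZ: "AE \<omega> in M. Z \<omega> = X t \<omega>"
    using drift[of \<mu> supOU_mean]
  proof eventually_elim
    case (elim \<omega>)
    then show ?case using assms(16) by (simp add: supOUSV_def Y Ybar Z_def J_def)
  qed
  have ZM[measurable]: "Z \<in> borel_measurable M" unfolding Z_def by measurable
  have XM[measurable]: "X t \<in> borel_measurable M" by (rule borel_measurable_AE_cong[OF ZM XZ])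
  have sq: "AE \<omega> in M. (Z \<omega>)\<^sup>2 = (X t \<omega>)\<^sup>2" "AE \<omega> in M. Z \<omega> * Y t \<omega> = X t \<omega> * Y t \<omega>"
    using XZ by (eventually_elim, simp)+
  have [measurable]: "Y t \<in> borel_measurable M" by (simp add: Y)
  have GJ: "integrable M (\<lambda>\<omega>. G \<omega> * J \<omega>)" "integrable M (\<lambda>\<omega>. G \<omega> * supOU N t \<omega>)" "integrable M (\<lambda>\<omega>. supOU N t \<omega> * J \<omega>)"
    by (intro integrable_mult_of_squares G J Y2 GM JM supOU_measurable)+
  have EJ: "expectation J = 0"
    using J(4)[of "\<lambda>_. 1"] by simp
  have EGJ: "expectation (\<lambda>\<omega>. G \<omega> * J \<omega>) = 0" by (rule J(4)[OF G(1,2)])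
  have EYJ: "expectation (\<lambda>\<omega>. supOU N t \<omega> * J \<omega>) = 0" by (rule J(4)[OF supOU_measurable_jump Y2])
  have Z1: "has_bochner_integral M Z (\<mu> * (supOU_mean - supOU_mean) + 0)"
    unfolding Z_def using Gi Ji EJ G(3)
    by (intro has_bochner_integral_add has_bochner_integral_mult_right has_bochner_integral_diff)
      (auto simp: has_bochner_integral_iff prob_space)
  have Zsq: "(Z \<omega>)\<^sup>2 = \<mu>\<^sup>2 * (G \<omega>)\<^sup>2 - 2 * \<mu>\<^sup>2 * supOU_mean * G \<omega> + \<mu>\<^sup>2 * supOU_mean\<^sup>2
      + 2 * \<mu> * (G \<omega> * J \<omega>) - 2 * \<mu> * supOU_mean * J \<omega> + (J \<omega>)\<^sup>2" for \<omega>
    by (simp add: Z_def power2_eq_square algebra_simps)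
  have Z2i: "integrable M (\<lambda>\<omega>. (Z \<omega>)\<^sup>2)"
    unfolding Zsq using G J Gi Ji GJ by simp
  have EZ2: "expectation (\<lambda>\<omega>. (Z \<omega>)\<^sup>2) = \<mu>\<^sup>2 * (jump_moment 2 / 2) * ?D + 1 / 2 * \<sigma>\<^sup>2 * supOU_mean"
  proof -
    have "expectation (\<lambda>\<omega>. (Z \<omega>)\<^sup>2) = \<mu>\<^sup>2 * expectation (\<lambda>\<omega>. (G \<omega>)\<^sup>2) - 2 * \<mu>\<^sup>2 * supOU_mean * expectation G + \<mu>\<^sup>2 * supOU_mean\<^sup>2
      + 2 * \<mu> * expectation (\<lambda>\<omega>. G \<omega> * J \<omega>) - 2 * \<mu> * supOU_mean * expectation J + expectation (\<lambda>\<omega>. (J \<omega>)\<^sup>2)"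
      unfolding Zsq using G(2) J(2) Gi Ji GJ(1) by (simp add: prob_space)
    also have "\<dots> = \<mu>\<^sup>2 * (jump_moment 2 / 2) * ?D + 1 / 2 * \<sigma>\<^sup>2 * supOU_mean"
      unfolding G(3,4) EJ EGJ J(3) by (simp add: power2_eq_square algebra_simps)
    finally show ?thesis .
  qed
  have ZYeq: "Z \<omega> * Y t \<omega> = \<mu> * (G \<omega> * supOU N t \<omega>) - \<mu> * supOU_mean * supOU N t \<omega> + supOU N t \<omega> * J \<omega>" for \<omega>
    by (simp add: Z_def Y algebra_simps)
  have ZYi: "integrable M (\<lambda>\<omega>. Z \<omega> * Y t \<omega>)"
    unfolding ZYeq using GJ supOU_integrable by simp
  have EZY: "expectation (\<lambda>\<omega>. Z \<omega> * Y t \<omega>) = \<mu> * (jump_moment 2 / 2) * ?C"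
  proof -
    have "expectation (\<lambda>\<omega>. Z \<omega> * Y t \<omega>) = \<mu> * expectation (\<lambda>\<omega>. G \<omega> * supOU N t \<omega>) - \<mu> * supOU_mean * expectation (supOU N t)
        + expectation (\<lambda>\<omega>. supOU N t \<omega> * J \<omega>)"
      unfolding ZYeq using GJ supOU_integrable by simp
    also have "\<dots> = \<mu> * (jump_moment 2 / 2) * ?C"
      unfolding G(5) EYJ supOU_expectation by (simp add: power2_eq_square algebra_simps)
    finally show ?thesis .
  qed
  have Xi: "integrable M (X t)" "integrable M (\<lambda>\<omega>. (X t \<omega>)\<^sup>2)" "integrable M (\<lambda>\<omega>. X t \<omega> * Y t \<omega>)"
    using integrable_cong_AE_imp[OF _ _ XZ] integrable_cong_AE_imp[OF Z2i _ sq(1)] integrable_cong_AE_imp[OF ZYi _ sq(2)] Z1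
    by (auto simp: has_bochner_integral_iff)
  have EX: "expectation (X t) = 0"
    using integral_cong_AE[OF _ _ XZ] Z1 by (simp add: has_bochner_integral_iff)
  have EX2: "variance (X t) = \<mu>\<^sup>2 * (jump_moment 2 / 2) * ?D + 1 / 2 * \<sigma>\<^sup>2 * supOU_mean"
    using integral_cong_AE[OF _ _ sq(1)] EX EZ2 by simp
  have EXY: "expectation (\<lambda>\<omega>. X t \<omega> * Y t \<omega>) = \<mu> * (jump_moment 2 / 2) * ?C"
    using integral_cong_AE[OF _ _ sq(2)] EZY by simp
  have W: "\<mu>\<^sup>2 * Vbar * inverse (\<integral>r. 1 / r \<partial>\<pi>) = \<mu>\<^sup>2 * (jump_moment 2 / 2)"
    "\<mu> * Vbar * inverse (\<integral>r. 1 / r \<partial>\<pi>) = \<mu> * (jump_moment 2 / 2)"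
    by (simp_all only: mult.assoc Vbar)
  show ?thesis
    unfolding W drift_weight_def[symmetric] Ybar using Xi EX EX2 EXY by (simp only: add.commute simp_thms)
qed

end
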